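(* Let $T=\begin{pmatrix}A&B\\C&-A^*\end{pmatrix}$ be a uniformly positive, r0-diagonally dominant Hamiltonian operator matrix on $H\times H$ with a Riesz basis of Jordan chains, where each eigenvalue has finite multiplicity and $\sigma_p(T)$ is contained in a strip around $i\mathbb R$. (i) If $U$ is a hypermaximal $J_1$-neutral, $T$-invariant, compatible subspace of $H\times H$, then $U=\Gamma(X)$ where $X$ is bounded, selfadjoint, boundedly invertible, $X\mathcal D(A)=\mathcal D(A^* )$, and $X$ is a solution of the Riccati equation $$A^*Xu+XAu+XBXu-Cu=0,\qquad u\in\mathcal D(A).\qquad(1)$$ Moreover, the solutions $X_+$ and $X_-$ corresponding to the compatible subspaces $U_\pm=\overline{\sum_{\lambda\in\sigma_p^\pm(T)}\mathcal L(\lambda)}$ (i.e. $U_\pm=\Gamma(X_\pm)$) are uniformly positive and uniformly negative, respectively, and $$X_-\le X\le X_+,\qquad X_-^{-1}\le X^{-1}\le X_+^{-1}.\qquad(2)$$ (ii) If $X$ is a closed symmetric operator on $H$ satisfying $\mathcal D(A)\subset\mathcal D(X)$, $X\mathcal D(A)\subset\mathcal D(B)$, and $$(Xu|Av)+(Au|Xv)+(BXu|Xv)-(Cu|v)=0,\qquad u,v\in\mathcal D(A),$$ then $X$ is bounded, $X\mathcal D(A)\subset\mathcal D(A^* )$, and $(1)$ and the first chain of inequalities $X_-\le X\le X_+$ in $(2)$ hold. If in addition $T$ has a compact resolvent, then $\Gamma(X)$ is hypermaximal $J_1$-neutral, $T$-invariant and compatible, and hence all conclusions of (i) hold for $X$.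 (iii) If $X:H\to H$ is bounded and $\Gamma(X)$ is $T$-invariant and compatible, then there exists a projection $P:H\to H$ such that $$X=X_+P+X_-(I-P).$$
   Context: $H$ is a complex separable Hilbert space with scalar product $(\cdot|\cdot)$, linear in the first argument. Hamiltonian operator matrix: a block operator matrix $T=\begin{pmatrix}A&B\\C&-A^*\end{pmatrix}$ on $H\times H$ with domain $\mathcal D(T)=(\mathcal D(A)\cap\mathcal D(C))\times(\mathcal D(A^* )\cap\mathcal D(B))$, where $A,B,C$ are densely defined linear operators on $H$, $B$ and $C$ are symmetric, and $T$ is densely defined. $T$ is uniformly positive if $B,C\ge\gamma$ for some $\gamma>0$ (i.e. $(Bv|v)\ge\gamma\|v\|^2$ on $\mathcal D(B)$, similarly for $C$). $T$ is diagonally dominant if $C$ is relatively bounded to $A$ and $B$ is relatively bounded to $A^*$, i.e. $\mathcal D(A)\subset\mathcal D(C)$, $\mathcal D(A^* )\subset\mathcal D(B)$, and there are constants $a,b\ge 0$ with $\|Cu\|\le a\|u\|+b\|Au\|$ for $u\in\mathcal D(A)$ and $\|Bv\|\le a\|v\|+b\|A^*v\|$ for $v\in\mathcal D(A^* )$. A diagonally dominant $T$, decomposed as $T=G+S$ with $G=\begin{pmatrix}A&0\\0&-A^*\end{pmatrix}$, $S=\begin{pmatrix}0&B\\C&0\end{pmatrix}$, is r0-diagonally dominant if there is a sequence $(z_k)$ in $\varrho(G)$ with $\lim_{k\to\infty}\|S(G-z_k)^{-1}\|=0$. $\mathcal L(\lambda)=\bigcup_k\ker(T-\lambda)^k$ is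 the root subspace; finite multiplicity means $\dim\mathcal L(\lambda)<\infty$; $\sigma_p^\pm(T)$ are the sets of eigenvalues in the open right/left half-plane. A Jordan chain is a sequence $x_1,\dots,x_n$ in $\mathcal L(\lambda)$ with $(T-\lambda)x_1=0$, $(T-\lambda)x_k=x_{k-1}$ for $k\ge2$. A Riesz basis of a separable Hilbert space $V$ is a sequence $(v_k)$ for which there is an isomorphism $\Phi:V\to V$ with $(\Phi v_k)$ an orthonormal basis; a Riesz basis of Jordan chains for $T$ is a Riesz basis of $H\times H$ made up of Jordan chains of $T$. A strip around $i\mathbb R$ is a set $\{z:|\operatorname{Re}z|\le a\}$, $a\geq 0$. Under the hypotheses of the theorem the root subspaces $\mathcal L(\lambda)$, $\lambda\in\sigma_p(T)$, form a Riesz basis of subspaces of $H\times H$ (i.e. for some isomorphism $\Phi$ of $H\times H$ the images $\Phi(\mathcal L(\lambda))$ are pairwise orthogonal with dense linear span). A subspace $U$ is compatible if $U=\overline{\sum_{\lambda\in\sigma_p(T)}U_\lambda}$ for some subspaces $U_\lambda\subset\mathcal L(\lambda)$. $U$ is $T$-invariant if $T(U\cap\mathcal D(T))\subset U$. $J_1=\begin{pmatrix}0&-iI\\ iI&0\end{pmatrix}$, $\langle x|y\rangle=(J_1x|y)$ on $H\times H$; $U$ is hypermaximal $J_1$-neutral if $U=U^{\langle\perp\rangle}:=\{x:\langle x|y\rangle=0\ \forall y\in U\}$. $\Gamma(X)=\{(u,Xu):u\in\mathcal D(X)\}$. Boundedly invertible means bijective with bounded inverse. A projection is a bounded idempotent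 operator (not necessarily orthogonal). An operator $X$ is uniformly positive (negative) if $(Xu|u)\ge\delta\|u\|^2$ ($-(Xu|u)\ge\delta\|u\|^2$) for some $\delta>0$ and all $u$. *)

theory Defs
  imports "HOL-Analysis.Analysis"
begin

section \<open>Complex Hilbert spaces\<close>

text \<open>
  The scalar product is linear in the first argument.  The remaining properties (positivity,
  definiteness) follow from \<open>norm_eq_sqrt_cinner\<close> and the axioms of a norm.
\<close>

class complex_inner = real_normed_vector +
  fixes scaleC :: "complex \<Rightarrow> 'a \<Rightarrow> 'a"  (infixr "*\<^sub>C" 75)
    and cinner :: "'a \<Rightarrow> 'a \<Rightarrow> complex"
  assumes scaleC_add_right: "c *\<^sub>C (x + y) = c *\<^sub>C x + c *\<^sub>C y"
    and scaleC_add_left: "(c + d) *\<^sub>C x = c *\<^sub>C x + d *\<^sub>C x"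
    and scaleC_scaleC: "c *\<^sub>C d *\<^sub>C x = (c * d) *\<^sub>C x"
    and scaleR_scaleC: "r *\<^sub>R x = complex_of_real r *\<^sub>C x"
    and cinner_add_left: "cinner (x + y) z = cinner x z + cinner y z"
    and cinner_scaleC_left: "cinner (c *\<^sub>C x) y = c * cinner x y"
    and cinner_commute: "cinner x y = cnj (cinner y x)"
    and norm_eq_sqrt_cinner: "norm x = sqrt (Re (cinner x x))"

class complex_hilbert = complex_inner + complete_space

lemma scaleC_one: "1 *\<^sub>C x = (x :: 'a::complex_inner)"
  using scaleR_scaleC[of 1 x] by simp

global_interpretation complex_vector: vector_space "scaleC :: complex \<Rightarrow> 'a \<Rightarrow> 'a::complex_inner"
  defines cspan = "complex_vector.span"
    and csubspace = "complex_vector.subspace"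
  by unfold_locales (simp_all add: scaleC_add_right scaleC_add_left scaleC_scaleC scaleC_one)

lemma Re_cinner_self: "Re (cinner x x) = (norm (x :: 'a::complex_inner))\<^sup>2"
proof -
  have "0 \<le> sqrt (Re (cinner x x))"
    by (metis norm_eq_sqrt_cinner norm_ge_zero)
  then show ?thesis
    by (simp add: norm_eq_sqrt_cinner)
qed

text \<open>
  The orthogonal sum of two Hilbert spaces.  Its norm, topology and completeness are those
  of the library's product of normed spaces.
\<close>

instantiation prod :: (complex_inner, complex_inner) complex_inner
begin

definition scaleC_prod :: "complex \<Rightarrow> 'a \<times> 'b \<Rightarrow> 'a \<times> 'b" where
  "scaleC_prod c x = (c *\<^sub>C fst x, c *\<^sub>C snd x)"

definition cinner_prod :: "'a \<times> 'b \<Rightarrow> 'a \<times> 'b \<Rightarrow> complex" where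
  "cinner_prod x y = cinner (fst x) (fst y) + cinner (snd x) (snd y)"

instance
proof
  fix x y z :: "'a \<times> 'b" and c d :: complex and r :: real
  show "c *\<^sub>C (x + y) = c *\<^sub>C x + c *\<^sub>C y"
    by (simp add: scaleC_prod_def scaleC_add_right)
  show "(c + d) *\<^sub>C x = c *\<^sub>C x + d *\<^sub>C x"
    by (simp add: scaleC_prod_def scaleC_add_left)
  show "c *\<^sub>C d *\<^sub>C x = (c * d) *\<^sub>C x"
    by (simp add: scaleC_prod_def scaleC_scaleC)
  show "r *\<^sub>R x = complex_of_real r *\<^sub>C x"
    by (simp add: scaleC_prod_def scaleR_prod_def scaleR_scaleC)
  show "cinner (x + y) z = cinner x z + cinner y z"
    by (simp add: cinner_prod_def cinner_add_left)
  show "cinner (c *\<^sub>C x) y = c * cinner x y"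
    by (simp add: cinner_prod_def scaleC_prod_def cinner_scaleC_left algebra_simps)
  show "cinner x y = cnj (cinner y x)"
    by (simp add: cinner_prod_def cinner_commute[of "fst x"] cinner_commute[of "snd x"])
  show "norm x = sqrt (Re (cinner x x))"
    by (simp add: cinner_prod_def norm_prod_def Re_cinner_self)
qed

end

instance prod :: (complex_hilbert, complex_hilbert) complex_hilbert ..

definition bounded_clinear :: "('a::complex_inner \<Rightarrow> 'a) \<Rightarrow> bool" where
  "bounded_clinear f \<longleftrightarrow> bounded_linear f \<and> (\<forall>c x. f (c *\<^sub>C x) = c *\<^sub>C f x)"

definition isomorphism :: "('a::complex_inner \<Rightarrow> 'a) \<Rightarrow> bool" where
  "isomorphism \<Phi> \<longleftrightarrow> bij \<Phi> \<and> bounded_clinear \<Phi> \<and> bounded_clinear (inv \<Phi>)"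

definition projection :: "('a::complex_inner \<Rightarrow> 'a) \<Rightarrow> bool" where
  "projection P \<longleftrightarrow> bounded_clinear P \<and> (\<forall>x. P (P x) = P x)"

text \<open>
  Bases are indexed by a set rather than by the natural numbers, so that the finite-dimensional
  case is covered as well; for a countable index set the order of enumeration does not matter.
\<close>

definition orthonormal_basis :: "'i set \<Rightarrow> ('i \<Rightarrow> 'a::complex_inner) \<Rightarrow> bool" where
  "orthonormal_basis I e \<longleftrightarrow>
    (\<forall>i\<in>I. \<forall>j\<in>I. cinner (e i) (e j) = (if i = j then 1 else 0)) \<and>
    closure (cspan (e ` I)) = UNIV"

definition riesz_basis :: "'i set \<Rightarrow> ('i \<Rightarrow> 'a::complex_inner) \<Rightarrow> bool" where
  "riesz_basis I v \<longleftrightarrow> (\<exists>\<Phi>. isomorphism \<Phi> \<and> orthonormal_basis I (\<Phi> \<circ> v))"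


section \<open>Unbounded operators\<close>

text \<open>
  An operator is a domain together with a function; the values of the function outside the
  domain are irrelevant.
\<close>

datatype 'a operator = Operator (opdom: "'a set") (opapp: "'a \<Rightarrow> 'a")

definition linear_operator :: "'a::complex_inner operator \<Rightarrow> bool" where
  "linear_operator X \<longleftrightarrow> csubspace (opdom X) \<and>
    (\<forall>u\<in>opdom X. \<forall>v\<in>opdom X. opapp X (u + v) = opapp X u + opapp X v) \<and>
    (\<forall>c. \<forall>u\<in>opdom X. opapp X (c *\<^sub>C u) = c *\<^sub>C opapp X u)"

definition densely_defined :: "'a::complex_inner operator \<Rightarrow> bool" where
  "densely_defined X \<longleftrightarrow> closure (opdom X) = UNIV"

definition bounded_operator :: "'a::complex_inner operator \<Rightarrow> bool" where
  "bounded_operator X \<longleftrightarrow> opdom X = UNIV \<and> bounded_clinear (opapp X)"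

definition graph :: "'a operator \<Rightarrow> ('a \<times> 'a) set" where
  "graph X = {(u, opapp X u) | u. u \<in> opdom X}"

definition closed_operator :: "'a::complex_inner operator \<Rightarrow> bool" where
  "closed_operator X \<longleftrightarrow> closed (graph X)"

text \<open>The vector \<open>w\<close> below is unique if \<open>X\<close> is densely defined.\<close>

definition adjoint_op :: "'a::complex_inner operator \<Rightarrow> 'a operator" where
  "adjoint_op X = Operator
    {v. \<exists>w. \<forall>u\<in>opdom X. cinner (opapp X u) v = cinner u w}
    (\<lambda>v. THE w. \<forall>u\<in>opdom X. cinner (opapp X u) v = cinner u w)"

definition symmetric_operator :: "'a::complex_inner operator \<Rightarrow> bool" where
  "symmetric_operator X \<longleftrightarrow> linear_operator X \<and> densely_defined X \<and>
    (\<forall>u\<in>opdom X. \<forall>v\<in>opdom X. cinner (opapp X u) v = cinner u (opapp X v))"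

definition selfadjoint :: "'a::complex_inner operator \<Rightarrow> bool" where
  "selfadjoint X \<longleftrightarrow> linear_operator X \<and> densely_defined X \<and>
    opdom (adjoint_op X) = opdom X \<and> (\<forall>u\<in>opdom X. opapp (adjoint_op X) u = opapp X u)"

definition inverse_op :: "'a operator \<Rightarrow> 'a operator" where
  "inverse_op X = Operator (opapp X ` opdom X) (inv_into (opdom X) (opapp X))"

definition boundedly_invertible :: "'a::complex_inner operator \<Rightarrow> bool" where
  "boundedly_invertible X \<longleftrightarrow>
    bij_betw (opapp X) (opdom X) UNIV \<and> bounded_operator (inverse_op X)"

text \<open>
  In the next three definitions the scalar products are real for symmetric operators, which
  are the only ones they are applied to.
\<close>

definition uniformly_positive :: "'a::complex_inner operator \<Rightarrow> bool" where
  "uniformly_positive X \<longleftrightarrow>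
    (\<exists>\<delta>>0. \<forall>u\<in>opdom X. Re (cinner (opapp X u) u) \<ge> \<delta> * (norm u)\<^sup>2)"

definition uniformly_negative :: "'a::complex_inner operator \<Rightarrow> bool" where
  "uniformly_negative X \<longleftrightarrow>
    (\<exists>\<delta>>0. \<forall>u\<in>opdom X. - Re (cinner (opapp X u) u) \<ge> \<delta> * (norm u)\<^sup>2)"

definition le_op :: "'a::complex_inner operator \<Rightarrow> 'a operator \<Rightarrow> bool"  (infix "\<le>\<^sub>o\<^sub>p" 50) where
  "X \<le>\<^sub>o\<^sub>p Y \<longleftrightarrow> opdom X = opdom Y \<and>
    (\<forall>u\<in>opdom X. Re (cinner (opapp X u) u) \<le> Re (cinner (opapp Y u) u))"

definition shift_op :: "'a::complex_inner operator \<Rightarrow> complex \<Rightarrow> 'a operator" where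
  "shift_op T z = Operator (opdom T) (\<lambda>x. opapp T x - z *\<^sub>C x)"

definition comp_op :: "'a operator \<Rightarrow> 'a operator \<Rightarrow> 'a operator" where
  "comp_op X Y = Operator {x \<in> opdom Y. opapp Y x \<in> opdom X} (opapp X \<circ> opapp Y)"

primrec power_op :: "'a operator \<Rightarrow> nat \<Rightarrow> 'a operator" where
  "power_op T 0 = Operator UNIV (\<lambda>x. x)"
| "power_op T (Suc k) = comp_op T (power_op T k)"

definition kernel :: "'a::zero operator \<Rightarrow> 'a set" where
  "kernel T = {x \<in> opdom T. opapp T x = 0}"

definition resolvent_set :: "'a::complex_inner operator \<Rightarrow> complex set" where
  "resolvent_set T = {z. boundedly_invertible (shift_op T z)}"

definition resolvent :: "'a::complex_inner operator \<Rightarrow> complex \<Rightarrow> 'a operator" where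
  "resolvent T z = inverse_op (shift_op T z)"

definition has_compact_resolvent :: "'a::complex_inner operator \<Rightarrow> bool" where
  "has_compact_resolvent T \<longleftrightarrow> (\<exists>z\<in>resolvent_set T.
    \<forall>M. bounded M \<longrightarrow> compact (closure (opapp (resolvent T z) ` M)))"

definition eigenvalues :: "'a::complex_inner operator \<Rightarrow> complex set" where
  "eigenvalues T = {z. \<exists>x. x \<noteq> 0 \<and> x \<in> kernel (shift_op T z)}"

definition root_subspace :: "'a::complex_inner operator \<Rightarrow> complex \<Rightarrow> 'a set" where
  "root_subspace T z = (\<Union>k. kernel (power_op (shift_op T z) k))"

definition finite_multiplicity :: "'a::complex_inner operator \<Rightarrow> complex \<Rightarrow> bool" where
  "finite_multiplicity T z \<longleftrightarrow> (\<exists>E. finite E \<and> root_subspace T z = cspan E)"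

text \<open>The members of a Jordan chain of length \<open>n\<close> are \<open>x 0, \<dots>, x (n - 1)\<close>.\<close>

definition jordan_chain ::
  "'a::complex_inner operator \<Rightarrow> complex \<Rightarrow> nat \<Rightarrow> (nat \<Rightarrow> 'a) \<Rightarrow> bool" where
  "jordan_chain T z n x \<longleftrightarrow>
    (\<forall>k<n. x k \<in> root_subspace T z \<and> x k \<in> opdom T \<and>
      opapp (shift_op T z) (x k) = (if k = 0 then 0 else x (k - 1)))"

text \<open>The \<open>j\<close>-th chain has length \<open>n j\<close>, eigenvalue \<open>z j\<close> and members \<open>x j k\<close>, \<open>k < n j\<close>.\<close>

definition has_riesz_basis_of_jordan_chains :: "'a::complex_inner operator \<Rightarrow> bool" where
  "has_riesz_basis_of_jordan_chains T \<longleftrightarrow>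
    (\<exists>(J :: nat set) n z x. (\<forall>j\<in>J. jordan_chain T (z j) (n j) (x j)) \<and>
      riesz_basis (SIGMA j:J. {..<n j}) (\<lambda>(j, k). x j k))"

definition invariant_subspace :: "'a operator \<Rightarrow> 'a set \<Rightarrow> bool" where
  "invariant_subspace T U \<longleftrightarrow> opapp T ` (U \<inter> opdom T) \<subseteq> U"

text \<open>The span of the union is the algebraic sum of the subspaces.\<close>

definition compatible :: "'a::complex_inner operator \<Rightarrow> 'a set \<Rightarrow> bool" where
  "compatible T U \<longleftrightarrow>
    (\<exists>V. (\<forall>z\<in>eigenvalues T. csubspace (V z) \<and> V z \<subseteq> root_subspace T z) \<and>
      U = closure (cspan (\<Union>z\<in>eigenvalues T. V z)))"

definition spectral_subspace :: "'a::complex_inner operator \<Rightarrow> complex set \<Rightarrow> 'a set" where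
  "spectral_subspace T \<Omega> = closure (cspan (\<Union>z\<in>eigenvalues T \<inter> \<Omega>. root_subspace T z))"


section \<open>Hamiltonian operator matrices\<close>

definition hamiltonian_matrix ::
  "'a::complex_inner operator \<Rightarrow> 'a operator \<Rightarrow> 'a operator \<Rightarrow> ('a \<times> 'a) operator" where
  "hamiltonian_matrix A B C = Operator
    ((opdom A \<inter> opdom C) \<times> (opdom (adjoint_op A) \<inter> opdom B))
    (\<lambda>(u, v). (opapp A u + opapp B v, opapp C u - opapp (adjoint_op A) v))"

definition is_hamiltonian ::
  "'a::complex_inner operator \<Rightarrow> 'a operator \<Rightarrow> 'a operator \<Rightarrow> bool" where
  "is_hamiltonian A B C \<longleftrightarrow>
    linear_operator A \<and> densely_defined A \<and> symmetric_operator B \<and> symmetric_operator C \<and>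
    densely_defined (hamiltonian_matrix A B C)"

definition uniformly_positive_hamiltonian ::
  "'a::complex_inner operator \<Rightarrow> 'a operator \<Rightarrow> bool" where
  "uniformly_positive_hamiltonian B C \<longleftrightarrow> (\<exists>\<gamma>>0.
    (\<forall>v\<in>opdom B. Re (cinner (opapp B v) v) \<ge> \<gamma> * (norm v)\<^sup>2) \<and>
    (\<forall>v\<in>opdom C. Re (cinner (opapp C v) v) \<ge> \<gamma> * (norm v)\<^sup>2))"

definition diagonally_dominant ::
  "'a::complex_inner operator \<Rightarrow> 'a operator \<Rightarrow> 'a operator \<Rightarrow> bool" where
  "diagonally_dominant A B C \<longleftrightarrow>
    opdom A \<subseteq> opdom C \<and> opdom (adjoint_op A) \<subseteq> opdom B \<and>
    (\<exists>a\<ge>0. \<exists>b\<ge>0.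
      (\<forall>u\<in>opdom A. norm (opapp C u) \<le> a * norm u + b * norm (opapp A u)) \<and>
      (\<forall>v\<in>opdom (adjoint_op A).
        norm (opapp B v) \<le> a * norm v + b * norm (opapp (adjoint_op A) v)))"

definition diagonal_part :: "'a::complex_inner operator \<Rightarrow> ('a \<times> 'a) operator" where
  "diagonal_part A = Operator (opdom A \<times> opdom (adjoint_op A))
    (\<lambda>(u, v). (opapp A u, - opapp (adjoint_op A) v))"

definition offdiagonal_part ::
  "'a::complex_inner operator \<Rightarrow> 'a operator \<Rightarrow> ('a \<times> 'a) operator" where
  "offdiagonal_part B C = Operator (opdom C \<times> opdom B) (\<lambda>(u, v). (opapp B v, opapp C u))"

text \<open>
  Diagonal dominance makes \<open>S (G - z)\<^sup>-\<^sup>1\<close> an everywhere defined bounded operator for \<open>z\<close> in the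
  resolvent set of \<open>G\<close>, so that \<^const>\<open>onorm\<close> is its operator norm.
\<close>

definition r0_diagonally_dominant ::
  "'a::complex_inner operator \<Rightarrow> 'a operator \<Rightarrow> 'a operator \<Rightarrow> bool" where
  "r0_diagonally_dominant A B C \<longleftrightarrow> diagonally_dominant A B C \<and>
    (\<exists>z. (\<forall>k::nat. z k \<in> resolvent_set (diagonal_part A)) \<and>
      (\<lambda>k. onorm (opapp (comp_op (offdiagonal_part B C) (resolvent (diagonal_part A) (z k)))))
        \<longlonglongrightarrow> 0)"

definition J1 :: "'a::complex_inner \<times> 'a \<Rightarrow> 'a \<times> 'a" where
  "J1 = (\<lambda>(u, v). ((- \<i>) *\<^sub>C v, \<i> *\<^sub>C u))"

definition hypermaximal_neutral :: "('a::complex_inner \<times> 'a) set \<Rightarrow> bool" where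
  "hypermaximal_neutral U \<longleftrightarrow> U = {x. \<forall>y\<in>U. cinner (J1 x) y = 0}"

text \<open>The Riccati equation on the domain of \<open>A\<close>, including that all its terms are defined.\<close>

definition riccati_solution ::
  "'a::complex_inner operator \<Rightarrow> 'a operator \<Rightarrow> 'a operator \<Rightarrow> 'a operator \<Rightarrow> bool" where
  "riccati_solution A B C X \<longleftrightarrow> (\<forall>u\<in>opdom A.
    u \<in> opdom X \<and> u \<in> opdom C \<and> opapp A u \<in> opdom X \<and>
    opapp X u \<in> opdom (adjoint_op A) \<and> opapp X u \<in> opdom B \<and> opapp B (opapp X u) \<in> opdom X \<and>
    opapp (adjoint_op A) (opapp X u) + opapp X (opapp A u)
      + opapp X (opapp B (opapp X u)) - opapp C u = 0)"

definition regular_riccati_solution ::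
  "'a::complex_inner operator \<Rightarrow> 'a operator \<Rightarrow> 'a operator \<Rightarrow> 'a operator \<Rightarrow> bool" where
  "regular_riccati_solution A B C X \<longleftrightarrow>
    bounded_operator X \<and> selfadjoint X \<and> boundedly_invertible X \<and>
    opapp X ` opdom A = opdom (adjoint_op A) \<and> riccati_solution A B C X"

end

theory Submission
  imports Defs
begin

text \<open>
  The matrix \<open>T\<close> is skew with respect to \<open>J\<^sub>1\<close>, so root subspaces of eigenvalues in the same open
  half-plane are \<open>J\<^sub>1\<close>-orthogonal, and \<open>U\<^sub>+\<close> and \<open>U\<^sub>-\<close> are neutral.  There are no imaginary
  eigenvalues and the root vectors are complete, hence \<open>U\<^sub>+ + U\<^sub>-\<close> is the whole space and both are
  hypermaximal.  The derivative of \<open>2 Re (u | v)\<close> along \<open>e\<^sup>t\<^sup>T\<close> is at least \<open>2 \<gamma> (\<parallel>u\<parallel>\<^sup>2 + \<parallel>v\<parallel>\<^sup>2)\<close>;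
  together with the strip condition a Lyapunov argument makes \<open>Re (u | v)\<close> uniformly positive on
  \<open>U\<^sub>+\<close> and uniformly negative on \<open>U\<^sub>-\<close>.

  A compatible hypermaximal neutral \<open>U\<close> is the sum of its parts \<open>p\<close> in \<open>U\<^sub>+\<close> and \<open>q\<close> in \<open>U\<^sub>-\<close>, and
  neutrality of \<open>p + q\<close> bounds \<open>\<parallel>p\<parallel> + \<parallel>q\<parallel>\<close> by either component of \<open>p + q\<close>.  So \<open>U\<close> is the graph of a
  bounded operator with bounded inverse, and the inequalities are a direct computation.  The
  domains match because \<open>(G - z\<^sub>k) (T - z\<^sub>k)\<^sup>-\<^sup>1\<close> tends to the identity and \<open>(T - z\<^sub>k)\<^sup>-\<^sup>1\<close> leaves \<open>U\<close>
  invariant.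

  If \<open>X\<close> solves the weak equation, then \<open>d = X\<^sub>+ u - X u\<close> satisfies
  \<open>2 Re (d | (A + B X\<^sub>+) u) = (B d | d) \<ge> 0\<close>, and the same Lyapunov argument gives \<open>X \<le> X\<^sub>+\<close>; the form
  bounds \<open>X\<^sub>- \<le> X \<le> X\<^sub>+\<close> make \<open>X\<close> bounded.  For compact resolvent, the projections to the root
  subspaces are strong limits of polynomials in the resolvent, so they leave the graph of \<open>X\<close>
  invariant.
\<close>


section \<open>Complex inner product spaces\<close>

text \<open>The semigroup of \<open>T\<close> is never constructed. On finite sums of complete
  Jordan chains its orbits are exponential polynomials, so the Lyapunov estimates are proved on
  algebraic spans of chains and then carried to closures. Two facts make the constants survive this
  passage: in the coordinates of the Riesz basis \<open>T\<close> is diagonal plus a shift of norm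
  at most 1, whatever the chain lengths, so the growth of \<open>norm (\<Phi> x)\<close> is
  controlled by the strip width plus 1; and r0-dominance provides a point \<open>z\<close> with a
  bounded inverse of \<open>T - z\<close> that maps every such span into itself. The obstacle in the
  weak Riccati equation is that \<open>X\<close> is not known to be bounded, so an inequality on a
  span does not extend by continuity. The cure is to approximate \<open>(T - z) x\<close> instead of
  \<open>x\<close>: \<open>X\<close> after the first component of the resolvent is defined
  everywhere and, by symmetry of \<open>X\<close> and a Baire argument, bounded. Two symmetries
  halve the work: a sign \<open>\<sigma>\<close> treats both half-planes at once, and swapping the
  two components turns statements on \<open>X\<close> into statements on its inverse.\<close>

lemma cinner_add_right: "cinner x (y + z) = cinner x y + cinner x (z :: 'a::complex_inner)"
  by (metis cinner_add_left cinner_commute complex_cnj_add)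

lemma cinner_scaleC_right: "cinner x (c *\<^sub>C y) = cnj c * cinner x (y :: 'a::complex_inner)"
  by (metis cinner_scaleC_left cinner_commute complex_cnj_mult)

lemma scaleC_zero_left [simp]: "0 *\<^sub>C x = (0 :: 'a::complex_inner)"
  and scaleC_zero_right [simp]: "c *\<^sub>C 0 = (0 :: 'a::complex_inner)"
  and scaleC_one_left [simp]: "1 *\<^sub>C x = (x :: 'a::complex_inner)"
  and scaleC_minus_left [simp]: "(- c) *\<^sub>C x = - (c *\<^sub>C (x :: 'a::complex_inner))"
  and scaleC_minus_right [simp]: "c *\<^sub>C (- x) = - (c *\<^sub>C (x :: 'a::complex_inner))"
  and scaleC_diff_left: "(c - d) *\<^sub>C x = c *\<^sub>C x - d *\<^sub>C (x :: 'a::complex_inner)"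
  and scaleC_diff_right: "c *\<^sub>C (x - y) = c *\<^sub>C x - c *\<^sub>C (y :: 'a::complex_inner)"
  by (simp_all add: complex_vector.scale_left_diff_distrib complex_vector.scale_right_diff_distrib)

lemma cinner_zero_left [simp]: "cinner 0 (x :: 'a::complex_inner) = 0"
  using cinner_scaleC_left[of 0 x x] by simp

lemma cinner_zero_right [simp]: "cinner (x :: 'a::complex_inner) 0 = 0"
  using cinner_scaleC_right[of x 0 x] by simp

lemma cinner_minus_left [simp]: "cinner (- x) y = - cinner x (y :: 'a::complex_inner)"
  using cinner_scaleC_left[of "-1" x y] by simp

lemma cinner_minus_right [simp]: "cinner x (- y) = - cinner x (y :: 'a::complex_inner)"
  using cinner_scaleC_right[of x "-1" y] by simp

lemma cinner_diff_left: "cinner (x - y) z = cinner x z - cinner y (z :: 'a::complex_inner)"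
  using cinner_add_left[of x "-y" z] by simp

lemma cinner_diff_right: "cinner x (y - z) = cinner x y - cinner x (z :: 'a::complex_inner)"
  using cinner_add_right[of x y "-z"] by simp

lemmas cinner_algebra = cinner_add_left cinner_add_right cinner_diff_left cinner_diff_right
  cinner_scaleC_left cinner_scaleC_right

lemma cinner_sum_left: "cinner (\<Sum>i\<in>I. f i) y = (\<Sum>i\<in>I. cinner (f i) (y :: 'a::complex_inner))"
  by (induction I rule: infinite_finite_induct) (simp_all add: cinner_add_left)

lemma cinner_sum_right: "cinner y (\<Sum>i\<in>I. f i) = (\<Sum>i\<in>I. cinner (y :: 'a::complex_inner) (f i))"
  by (induction I rule: infinite_finite_induct) (simp_all add: cinner_add_right)

lemma scaleC_sum_right: "c *\<^sub>C (\<Sum>i\<in>I. f i) = (\<Sum>i\<in>I. c *\<^sub>C (f i :: 'a::complex_inner))"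
  by (induction I rule: infinite_finite_induct) (simp_all add: scaleC_add_right)

lemma Re_cinner_commute: "Re (cinner x y) = Re (cinner y (x :: 'a::complex_inner))"
  by (metis cinner_commute complex_cnj(1) complex.sel(1) complex_eqI cnj.sel(1))

lemma cinner_self: "cinner x x = complex_of_real ((norm (x :: 'a::complex_inner))\<^sup>2)"
proof -
  have "Im (cinner x x) = 0"
    by (metis Reals_cnj_iff cinner_commute complex_is_Real_iff)
  then show ?thesis
    by (simp add: complex_eq_iff Re_cinner_self)
qed

lemma cinner_self_eq_0 [simp]: "cinner x x = 0 \<longleftrightarrow> x = (0 :: 'a::complex_inner)"
  by (simp add: cinner_self)

lemma cinner_eq_0_commute: "cinner x y = 0 \<longleftrightarrow> cinner y (x :: 'a::complex_inner) = 0"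
  by (metis cinner_commute complex_cnj_zero_iff)

lemma norm_scaleC: "norm (c *\<^sub>C x) = cmod c * norm (x :: 'a::complex_inner)"
proof -
  have "complex_of_real ((norm (c *\<^sub>C x))\<^sup>2) = c * cnj c * complex_of_real ((norm x)\<^sup>2)"
    by (simp add: cinner_self[symmetric] cinner_algebra del: of_real_power)
  also have "\<dots> = complex_of_real ((cmod c * norm x)\<^sup>2)"
    by (simp add: complex_norm_square[symmetric] power_mult_distrib del: of_real_power)
  finally have "(norm (c *\<^sub>C x))\<^sup>2 = (cmod c * norm x)\<^sup>2"
    using of_real_eq_iff by blast
  then show ?thesis
    by simp
qed

lemma norm_add_square:
  "(norm (x + y))\<^sup>2 = (norm x)\<^sup>2 + 2 * Re (cinner x y) + (norm (y :: 'a::complex_inner))\<^sup>2"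
  using Re_cinner_commute[of x y] by (simp flip: Re_cinner_self add: cinner_algebra)

lemma norm_diff_square:
  "(norm (x - y))\<^sup>2 = (norm x)\<^sup>2 - 2 * Re (cinner x y) + (norm (y :: 'a::complex_inner))\<^sup>2"
  using norm_add_square[of x "-y"] by simp

lemma cinner_cauchy_schwarz: "cmod (cinner x y) \<le> norm x * norm (y :: 'a::complex_inner)"
proof (cases "y = 0")
  case False
  define c where "c = cinner x y / complex_of_real ((norm y)\<^sup>2)"
  have cc: "cinner x y * cnj (cinner x y) = (complex_of_real (cmod (cinner x y)))\<^sup>2"
    using complex_norm_square[of "cinner x y"] by simp
  have "0 \<le> (norm (x - c *\<^sub>C y))\<^sup>2"
    by simp
  also have "\<dots> = (norm x)\<^sup>2 - 2 * Re (cnj c * cinner x y) + (cmod c)\<^sup>2 * (norm y)\<^sup>2"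
    by (simp add: norm_diff_square cinner_scaleC_right norm_scaleC power_mult_distrib)
  also have "cnj c * cinner x y = complex_of_real ((cmod (cinner x y))\<^sup>2 / (norm y)\<^sup>2)"
    by (simp add: c_def cc mult.commute[of "cnj _"])
  also have "(cmod c)\<^sup>2 * (norm y)\<^sup>2 = (cmod (cinner x y))\<^sup>2 / (norm y)\<^sup>2"
    using False unfolding c_def norm_divide norm_of_real by (simp add: power_divide power2_eq_square)
  finally have "(cmod (cinner x y))\<^sup>2 / (norm y)\<^sup>2 \<le> (norm x)\<^sup>2"
    by (simp del: of_real_power of_real_divide)
  then have "(cmod (cinner x y))\<^sup>2 \<le> (norm x * norm y)\<^sup>2"
    using False by (simp add: field_simps power_mult_distrib)
  then show ?thesis
    by (rule power2_le_imp_le) simp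
qed simp

lemma Re_cinner_le: "Re (cinner x y) \<le> norm x * norm (y :: 'a::complex_inner)"
  by (meson cinner_cauchy_schwarz complex_Re_le_cmod order_trans)

lemma bounded_bilinear_cinner: "bounded_bilinear (cinner :: 'a::complex_inner \<Rightarrow> 'a \<Rightarrow> complex)"
proof
  show "\<exists>K. \<forall>a b :: 'a. cmod (cinner a b) \<le> norm a * norm b * K"
    by (rule exI[of _ 1]) (simp add: cinner_cauchy_schwarz)
qed (simp_all add: cinner_algebra scaleR_scaleC scaleR_conv_of_real)

lemmas tendsto_cinner = bounded_bilinear.tendsto[OF bounded_bilinear_cinner]
lemmas continuous_on_cinner [continuous_intros] =
  bounded_bilinear.continuous_on[OF bounded_bilinear_cinner]

lemma bounded_linear_scaleC: "bounded_linear (\<lambda>x :: 'a::complex_inner. c *\<^sub>C x)"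
  by (rule bounded_linear_intro[of _ "cmod c"])
    (simp_all add: scaleC_add_right scaleR_scaleC scaleC_scaleC norm_scaleC mult.commute)

lemmas tendsto_scaleC = bounded_linear.tendsto[OF bounded_linear_scaleC]

lemma dense_cinner_eq_0:
  fixes w :: "'a::complex_inner"
  assumes "closure D = UNIV" "\<And>u. u \<in> D \<Longrightarrow> cinner u w = 0"
  shows "w = 0"
proof -
  have "cinner w w = 0"
    by (rule continuous_constant_on_closure[of D])
      (use assms in \<open>auto intro!: continuous_intros\<close>)
  then show ?thesis by simp
qed

lemma dense_cinner_unique:
  fixes w :: "'a::complex_inner"
  assumes "closure D = UNIV" "\<And>u. u \<in> D \<Longrightarrow> cinner u w = cinner u w'"
  shows "w = w'"
  using dense_cinner_eq_0[OF assms(1), of "w - w'"] assms(2) by (simp add: cinner_algebra)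


section \<open>Closed subspaces\<close>

lemmas csubspaceI = complex_vector.subspaceI
lemmas csubspace_0 = complex_vector.subspace_0
lemmas csubspace_add = complex_vector.subspace_add
lemmas csubspace_diff = complex_vector.subspace_diff
lemmas csubspace_scale = complex_vector.subspace_scale
lemmas csubspace_sum = complex_vector.subspace_sum

lemma csubspace_closure:
  fixes S :: "'a::complex_inner set"
  assumes "csubspace S"
  shows "csubspace (closure S)"
proof (rule csubspaceI)
  show "0 \<in> closure S"
    using csubspace_0[OF assms] closure_subset by blast
next
  fix x y assume "x \<in> closure S" "y \<in> closure S"
  then obtain f g where "\<And>n. f n \<in> S" "f \<longlonglongrightarrow> x" "\<And>n. g n \<in> S" "g \<longlonglongrightarrow> y"
    by (auto simp: closure_sequential)
  then show "x + y \<in> closure S"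
    unfolding closure_sequential
    by (intro exI[of _ "\<lambda>n. f n + g n"]) (auto intro: tendsto_add csubspace_add[OF assms])
next
  fix c x assume "x \<in> closure S"
  then obtain f where "\<And>n. f n \<in> S" "f \<longlonglongrightarrow> x"
    by (auto simp: closure_sequential)
  then show "c *\<^sub>C x \<in> closure S"
    unfolding closure_sequential
    by (intro exI[of _ "\<lambda>n. c *\<^sub>C f n"]) (auto intro: tendsto_scaleC csubspace_scale[OF assms])
qed

lemma csubspace_cspan: "csubspace (cspan (S :: 'a::complex_inner set))"
  by (rule complex_vector.subspace_span)

lemma csubspace_closure_cspan: "csubspace (closure (cspan (S :: 'a::complex_inner set)))"
  by (intro csubspace_closure csubspace_cspan)

lemma closure_cspan_mono: "S \<subseteq> S' \<Longrightarrow> closure (cspan S) \<subseteq> closure (cspan (S' :: 'a::complex_inner set))"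
  by (intro closure_mono complex_vector.span_mono)

lemma closure_cspan_minimal:
  "S \<subseteq> M \<Longrightarrow> csubspace M \<Longrightarrow> closed M \<Longrightarrow> closure (cspan (S :: 'a::complex_inner set)) \<subseteq> M"
  by (intro closure_minimal complex_vector.span_minimal)

lemma clinear_vimage_csubspace:
  fixes f :: "'a::complex_inner \<Rightarrow> 'b::complex_inner"
  assumes "\<And>x y. f (x + y) = f x + f y" "\<And>c x. f (c *\<^sub>C x) = c *\<^sub>C f x" "csubspace M"
  shows "csubspace {x. f x \<in> M}"
proof (rule csubspaceI)
  show "0 \<in> {x. f x \<in> M}"
    using assms(2)[of 0 0] csubspace_0[OF assms(3)] by simp
qed (use assms in \<open>auto intro: csubspace_add csubspace_scale\<close>)

text \<open>The preimage of \<open>M\<close> under a bounded \<open>f\<close> is again a closed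
  subspace, so a mapping property of a closed span needs checking on generators only.\<close>

lemma closure_cspan_map:
  fixes f :: "'a::complex_inner \<Rightarrow> 'a"
  assumes "bounded_clinear f" "\<And>x. x \<in> S \<Longrightarrow> f x \<in> M" "csubspace M" "closed M"
    and "x \<in> closure (cspan S)"
  shows "f x \<in> M"
proof -
  have lin: "f (x + y) = f x + f y" "f (c *\<^sub>C x) = c *\<^sub>C f x" for x y c
    using assms(1) by (auto simp: bounded_clinear_def linear_simps)
  have "closed (f -` M)"
    using assms(1,4) by (intro closed_vimage) (auto simp: bounded_clinear_def linear_continuous_on)
  then have "closure (cspan S) \<subseteq> {x. f x \<in> M}"
    using assms(2) clinear_vimage_csubspace[of f M] lin assms(3)
    by (intro closure_cspan_minimal) (auto simp: vimage_def)
  then show ?thesis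
    using assms(5) by auto
qed

text \<open>A minimizing sequence for the distance to \<open>M\<close> is Cauchy by the parallelogram law.\<close>

lemma orthogonal_projection_exists:
  fixes M :: "'a::complex_hilbert set"
  assumes "closed M" "csubspace M"
  shows "\<exists>p\<in>M. \<forall>m\<in>M. cinner (x - p) m = 0"
proof -
  define d where "d = (INF m\<in>M. (norm (x - m))\<^sup>2)"
  have ne: "M \<noteq> {}"
    using csubspace_0[OF assms(2)] by auto
  have d_le: "d \<le> (norm (x - m))\<^sup>2" if "m \<in> M" for m
    unfolding d_def using that by (intro cINF_lower bdd_belowI[of _ 0]) auto
  have "\<exists>m\<in>M. (norm (x - m))\<^sup>2 < d + inverse (real (Suc n))" for n
  proof -
    have "d < d + inverse (real (Suc n))"
      by simp
    then have "(INF m\<in>M. (norm (x - m))\<^sup>2) < d + inverse (real (Suc n))"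
      by (simp only: d_def)
    moreover have "bdd_below ((\<lambda>m. (norm (x - m))\<^sup>2) ` M)"
      by (rule bdd_belowI[of _ 0]) auto
    ultimately show ?thesis
      by (simp only: cINF_less_iff[OF ne])
  qed
  then obtain f where f: "\<And>n. f n \<in> M" "\<And>n. (norm (x - f n))\<^sup>2 < d + inverse (real (Suc n))"
    by metis
  have par: "(norm (f k - f n))\<^sup>2 \<le> 2 * (inverse (real (Suc k)) + inverse (real (Suc n)))" for k n
  proof -
    have "(1/2) *\<^sub>C (f k + f n) \<in> M"
      using f assms(2) by (intro csubspace_scale csubspace_add) auto
    then have "4 * d \<le> 4 * (norm (x - (1/2) *\<^sub>C (f k + f n)))\<^sup>2"
      using d_le by simp
    also have "\<dots> = (norm (2 *\<^sub>C (x - (1/2) *\<^sub>C (f k + f n))))\<^sup>2"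
      by (simp only: norm_scaleC power_mult_distrib) simp
    also have "2 *\<^sub>C (x - (1/2) *\<^sub>C (f k + f n)) = (x - f k) + (x - f n)"
      using scaleC_add_left[of 1 1 x] by (simp add: scaleC_diff_right scaleC_scaleC)
    also have "(norm \<dots>)\<^sup>2 = 2 * (norm (x - f k))\<^sup>2 + 2 * (norm (x - f n))\<^sup>2 - (norm (f k - f n))\<^sup>2"
      using norm_diff_square[of "x - f n" "x - f k"]
      by (simp add: norm_add_square Re_cinner_commute[of "x - f n"])
    finally have *: "4 * d \<le> 2 * (norm (x - f k))\<^sup>2 + 2 * (norm (x - f n))\<^sup>2 - (norm (f k - f n))\<^sup>2" .
    have arith: "r \<le> 2 * (i + j)" if "4 * d \<le> 2 * a + 2 * b - r" "a < d + i" "b < d + j" for a b r i j :: real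
    proof -
      have "2 * a < 2 * d + 2 * i" "2 * b < 2 * d + 2 * j"
        using that by simp_all
      then show ?thesis
        using that(1) by (simp only: distrib_left)
    qed
    show ?thesis
      by (rule arith[OF * f(2) f(2)])
  qed
  have "Cauchy f"
  proof (rule CauchyI)
    fix e :: real assume "0 < e"
    then obtain N where N: "inverse (real (Suc N)) < e\<^sup>2 / 4"
      using reals_Archimedean[of "e\<^sup>2 / 4"] by auto
    have "norm (f m - f n) < e" if "m \<ge> N" "n \<ge> N" for m n
    proof -
      have "inverse (real (Suc m)) \<le> inverse (real (Suc N))" "inverse (real (Suc n)) \<le> inverse (real (Suc N))"
        using that by (auto intro!: le_imp_inverse_le)
      then have "(norm (f m - f n))\<^sup>2 < e\<^sup>2"
        using par[of m n] N by argo
      then show ?thesis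
        using \<open>0 < e\<close> by (simp add: power2_less_imp_less)
    qed
    then show "\<exists>M. \<forall>m\<ge>M. \<forall>n\<ge>M. norm (f m - f n) < e" by blast
  qed
  then obtain p where p: "f \<longlonglongrightarrow> p"
    using Cauchy_convergent convergent_def by blast
  have "p \<in> M"
    using assms(1) f(1) p closed_sequentially by blast
  have "(\<lambda>n. d + inverse (real (Suc n))) \<longlonglongrightarrow> d + 0"
    by (intro tendsto_intros LIMSEQ_inverse_real_of_nat)
  moreover have "(\<lambda>n. (norm (x - f n))\<^sup>2) \<longlonglongrightarrow> (norm (x - p))\<^sup>2"
    by (intro tendsto_intros p)
  ultimately have "(norm (x - p))\<^sup>2 \<le> d + 0"
    using f(2) by (intro LIMSEQ_le[of "\<lambda>n. (norm (x - f n))\<^sup>2"]) (auto intro: less_imp_le)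
  then have pd: "(norm (x - p))\<^sup>2 \<le> d"
    by simp
  have "cinner (x - p) m = 0" if "m \<in> M" for m
  proof -
    define c where "c = cinner (x - p) m"
    \<comment> \<open>Shifting \<open>p\<close> by \<open>t c m\<close> changes the squared distance
      by \<open>- 2 t |c|^2 + t^2 |c|^2 |m|^2\<close>. As \<open>t |m|^2 < 1\<close>, this is
      negative unless \<open>c = 0\<close>; the added 1 covers \<open>m = 0\<close>.\<close>
    define t where "t = 1 / ((norm m)\<^sup>2 + 1)"
    have t: "t > 0" "t * (norm m)\<^sup>2 < 1"
      by (simp_all add: t_def add_nonneg_pos)
    have "p + (complex_of_real t * c) *\<^sub>C m \<in> M"
      using \<open>p \<in> M\<close> that assms(2) by (intro csubspace_add csubspace_scale)
    then have "(norm (x - p))\<^sup>2 \<le> (norm (x - (p + (complex_of_real t * c) *\<^sub>C m)))\<^sup>2"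
      using pd d_le order_trans by blast
    also have "x - (p + (complex_of_real t * c) *\<^sub>C m) = (x - p) - (complex_of_real t * c) *\<^sub>C m"
      by simp
    also have "(norm \<dots>)\<^sup>2 = (norm (x - p))\<^sup>2 - 2 * (t * (cmod c)\<^sup>2) + (t * cmod c * norm m)\<^sup>2"
    proof -
      have "Re (cnj c * c) = (cmod c)\<^sup>2"
        by (simp add: mult.commute[of "cnj c"] complex_norm_square[symmetric] del: of_real_power)
      then show ?thesis
        using t(1) unfolding norm_diff_square
        by (simp add: cinner_scaleC_right norm_scaleC norm_mult c_def[symmetric] mult.assoc)
    qed
    finally have "2 * (t * (cmod c)\<^sup>2) \<le> t * (cmod c)\<^sup>2 * (t * (norm m)\<^sup>2)"
      by (simp add: power_mult_distrib power2_eq_square mult_ac)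
    also have "\<dots> \<le> t * (cmod c)\<^sup>2 * 1"
      using t by (intro mult_left_mono) auto
    finally have "c = 0"
      using t(1) by (simp add: mult_le_0_iff)
    then show ?thesis by (simp add: c_def)
  qed
  then show ?thesis
    using \<open>p \<in> M\<close> by blast
qed

lemma dense_if_orthogonal_trivial:
  fixes M :: "'a::complex_hilbert set"
  assumes "closed M" "csubspace M" "\<And>w. (\<And>m. m \<in> M \<Longrightarrow> cinner w m = 0) \<Longrightarrow> w = 0"
  shows "M = UNIV"
proof -
  have "x \<in> M" for x
  proof -
    obtain p where "p \<in> M" "\<forall>m\<in>M. cinner (x - p) m = 0"
      using orthogonal_projection_exists[OF assms(1,2)] by blast
    then show ?thesis
      using assms(3)[of "x - p"] by auto
  qed
  then show ?thesis by auto
qed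


section \<open>Bounded operators\<close>

lemma bounded_clinearI:
  fixes f :: "'a::complex_inner \<Rightarrow> 'a"
  assumes "\<And>x y. f (x + y) = f x + f y" "\<And>c x. f (c *\<^sub>C x) = c *\<^sub>C f x"
    and "\<And>x. norm (f x) \<le> norm x * K"
  shows "bounded_clinear f"
  unfolding bounded_clinear_def
  using assms by (auto intro!: bounded_linear_intro[of f K] simp: scaleR_scaleC)

lemma bounded_clinear_scaleC: "bounded_clinear f \<Longrightarrow> f (c *\<^sub>C x) = c *\<^sub>C f x"
  and bounded_clinear_add: "bounded_clinear f \<Longrightarrow> f (x + y) = f x + f y"
  and bounded_clinear_diff: "bounded_clinear f \<Longrightarrow> f (x - y) = f x - f y"
  and bounded_clinear_0: "bounded_clinear f \<Longrightarrow> f 0 = 0"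
  and bounded_clinear_tendsto: "bounded_clinear f \<Longrightarrow> (g \<longlongrightarrow> a) F \<Longrightarrow> ((\<lambda>x. f (g x)) \<longlongrightarrow> f a) F"
  and bounded_clinear_continuous_on: "bounded_clinear f \<Longrightarrow> continuous_on S f"
  by (auto simp: bounded_clinear_def linear_simps linear_continuous_on intro: bounded_linear.tendsto)

lemma bounded_clinear_bound:
  assumes "bounded_clinear f"
  obtains K where "K > 0" "\<And>x. norm (f x) \<le> K * norm x"
  using assms bounded_linear.pos_bounded unfolding bounded_clinear_def by (metis mult.commute)

lemma bounded_clinear_sum: "bounded_clinear f \<Longrightarrow> f (\<Sum>i\<in>I. g i) = (\<Sum>i\<in>I. f (g i))"
  by (induction I rule: infinite_finite_induct) (simp_all add: bounded_clinear_add bounded_clinear_0)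

lemma Cauchy_norm_le:
  fixes f :: "nat \<Rightarrow> 'a::real_normed_vector" and g :: "nat \<Rightarrow> 'b::real_normed_vector"
  assumes "g \<longlonglongrightarrow> l" and le: "\<And>m k. norm (f m - f k) \<le> c * norm (g m - g k)"
  shows "Cauchy f"
proof (rule CauchyI)
  fix r :: real assume "0 < r"
  then obtain M where M: "\<forall>m\<ge>M. \<forall>k\<ge>M. norm (g m - g k) < r / (\<bar>c\<bar> + 1)"
    using CauchyD[OF LIMSEQ_imp_Cauchy[OF assms(1)], of "r / (\<bar>c\<bar> + 1)"] by auto
  have "norm (f m - f k) < r" if "m \<ge> M" "k \<ge> M" for m k
  proof -
    have "norm (f m - f k) \<le> (\<bar>c\<bar> + 1) * norm (g m - g k)"
      by (rule order_trans[OF le]) (intro mult_right_mono, auto)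
    also have "\<dots> < r"
      using M that by (simp add: field_simps add_pos_nonneg)
    finally show ?thesis .
  qed
  then show "\<exists>M. \<forall>m\<ge>M. \<forall>k\<ge>M. norm (f m - f k) < r" by blast
qed

lemma id_plus_contraction_surj:
  fixes K :: "'a::{real_normed_vector,complete_space} \<Rightarrow> 'a"
  assumes "\<And>x y. norm (K x - K y) \<le> c * norm (x - y)" "c < 1"
  shows "\<exists>x. x + K x = y"
proof -
  \<comment> \<open>A solution is a fixed point of \<open>\<lambda>x. y - K x\<close>. Banach's
    theorem wants a nonnegative constant, while \<open>c\<close> may be negative.\<close>
  have c: "0 \<le> max c 0" "max c 0 < 1"
    using assms(2) by auto
  have "norm ((y - K u) - (y - K v)) \<le> max c 0 * norm (u - v)" for u v
  proof -
    have "norm ((y - K u) - (y - K v)) = norm (K u - K v)"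
      by (simp add: norm_minus_commute)
    also have "\<dots> \<le> c * norm (u - v)"
      by (rule assms)
    also have "\<dots> \<le> max c 0 * norm (u - v)"
      by (intro mult_right_mono) auto
    finally show ?thesis .
  qed
  then have "\<exists>!x. y - K x = x"
    using c by (intro banach_fix_type[of "max c 0"]) (auto simp: dist_norm)
  then show ?thesis
    by (metis diff_add_cancel)
qed

text \<open>
  The closed sets in the Baire argument are the common sublevel sets of the functionals
  \<open>y \<mapsto> (L y | v)\<close>, where \<open>v\<close> ranges over \<open>D\<close>.
\<close>

lemma weakly_bounded_imp_bounded:
  fixes L :: "'b::{real_normed_vector,complete_space} \<Rightarrow> 'a::complex_inner"
  assumes add: "\<And>x y. L (x + y) = L x + L y" and scale: "\<And>r x. L (r *\<^sub>R x) = r *\<^sub>R L x"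
    and dense: "closure D = UNIV"
    and weak: "\<And>v. v \<in> D \<Longrightarrow> \<exists>K. \<forall>y. cmod (cinner (L y) v) \<le> norm y * K"
  shows "\<exists>K. \<forall>y. norm (L y) \<le> norm y * K"
proof -
  have bl: "bounded_linear (\<lambda>y. cinner (L y) v)" if v: "v \<in> D" for v
  proof -
    obtain K where "\<forall>y. cmod (cinner (L y) v) \<le> norm y * K"
      using weak[OF v] by blast
    then show ?thesis
      by (intro bounded_linear_intro[of _ K])
        (simp_all add: add scale cinner_algebra scaleR_scaleC scaleR_conv_of_real)
  qed
  define F where "F n = {y. \<forall>v\<in>D. cmod (cinner (L y) v) \<le> real n * norm v}" for n :: nat
  have "closed (F n)" for n
  proof -
    have "F n = (\<Inter>v\<in>D. {y. cmod (cinner (L y) v) \<le> real n * norm v})"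
      by (auto simp: F_def)
    then show ?thesis
      by (auto intro!: closed_Collect_le continuous_intros
          bounded_linear.continuous_on[OF bl])
  qed
  moreover have "\<exists>n. y \<in> F n" for y
  proof -
    obtain n where "norm (L y) \<le> real n"
      using real_arch_simple by blast
    then have "\<forall>v\<in>D. cmod (cinner (L y) v) \<le> real n * norm v"
      by (meson cinner_cauchy_schwarz mult_right_mono norm_ge_zero order_trans)
    then show ?thesis
      by (auto simp: F_def)
  qed
  then have "(\<Union>n. F n) = UNIV"
    by auto
  moreover have "completely_metrizable_space (euclidean :: 'b topology)"
    by (rule completely_metrizable_space_euclidean)
  ultimately have "\<exists>n. interior (F n) \<noteq> {}"
  proof -
    assume cl: "\<And>n. closed (F n)" and un: "(\<Union>n. F n) = UNIV"
      and cms: "completely_metrizable_space (euclidean :: 'b topology)"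
    show ?thesis
    proof (rule ccontr)
      assume "\<nexists>n. interior (F n) \<noteq> {}"
      then have "(euclidean :: 'b topology) interior_of \<Union>(range F) = {}"
        using cl cms by (intro Baire_category_alt) auto
      then show False
        using un by simp
    qed
  qed
  then obtain n where "interior (F n) \<noteq> {}" ..
  then obtain a e where e: "0 < e" and ball: "ball a e \<subseteq> F n"
    by (meson ex_in_conv mem_interior)
  have bound: "cmod (cinner (L y) v) \<le> norm y * (4 * real n / e) * norm v" if v: "v \<in> D" for y v
  proof (cases "y = 0")
    case True
    then show ?thesis using scale[of 0 0] by simp
  next
    case False
    \<comment> \<open>\<open>t y\<close> has length \<open>e / 2\<close>, so \<open>a\<close> and
      \<open>a + t y\<close> both lie in the ball. Their difference gives the bound
      \<open>2 n |v|\<close> at \<open>t y\<close>, and division by \<open>t\<close> produces the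
      constant \<open>4 n / e\<close>.\<close>
    define t where "t = e / (2 * norm y)"
    have t: "t > 0" "norm (t *\<^sub>R y) < e"
      using False e by (auto simp: t_def)
    have *: "L (t *\<^sub>R y) = L (a + t *\<^sub>R y) - L a"
      by (simp add: add)
    have "a + t *\<^sub>R y \<in> F n" "a \<in> F n"
      using ball t e by (auto simp: dist_norm)
    then have "cmod (cinner (L (a + t *\<^sub>R y)) v) \<le> real n * norm v" "cmod (cinner (L a) v) \<le> real n * norm v"
      using v by (auto simp: F_def)
    then have "cmod (cinner (L (t *\<^sub>R y)) v) \<le> 2 * real n * norm v"
      unfolding * cinner_diff_left
      using norm_triangle_ineq4[of "cinner (L (a + t *\<^sub>R y)) v" "cinner (L a) v"] by simp
    moreover have "cmod (cinner (L (t *\<^sub>R y)) v) = t * cmod (cinner (L y) v)"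
      using t(1) by (simp add: scale scaleR_scaleC cinner_scaleC_left norm_mult)
    ultimately have "t * cmod (cinner (L y) v) \<le> 2 * real n * norm v"
      by simp
    then show ?thesis
      using False e by (simp add: t_def field_simps)
  qed
  have "norm (L y) \<le> norm y * (4 * real n / e)" for y
  proof -
    have "cmod (cinner (L y) v) \<le> norm y * (4 * real n / e) * norm v" for v
    proof -
      have "closed {v. cmod (cinner (L y) v) \<le> norm y * (4 * real n / e) * norm v}"
        by (intro closed_Collect_le continuous_intros)
      then have "closure D \<subseteq> {v. cmod (cinner (L y) v) \<le> norm y * (4 * real n / e) * norm v}"
        using bound by (intro closure_minimal) auto
      then show ?thesis
        using dense by auto
    qed
    from this[of "L y"] have *: "(norm (L y))\<^sup>2 \<le> norm y * (4 * real n / e) * norm (L y)"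
      by (simp add: cinner_self norm_power)
    then show ?thesis
    proof (cases "L y = 0")
      case False
      then have "0 < norm (L y)" by simp
      moreover have "norm (L y) * norm (L y) \<le> norm y * (4 * real n / e) * norm (L y)"
        using * by (simp add: power2_eq_square)
      ultimately show ?thesis
        using mult_right_le_imp_le by blast
    qed (use e in simp)
  qed
  then show ?thesis by blast
qed


section \<open>Hypermaximal neutral subspaces\<close>

text \<open>The \<open>J1\<close> form without its factor \<open>\<i>\<close> (see
  \<open>cinner_J1\<close>): the neutral subspaces are the same, and the form is skew-Hermitian
  instead of Hermitian.\<close>

definition symplectic :: "'a::complex_inner \<times> 'a \<Rightarrow> 'a \<times> 'a \<Rightarrow> complex" where
  "symplectic x y = cinner (fst x) (snd y) - cinner (snd x) (fst y)"

text \<open>Half the quadratic form of the symmetry that swaps the components. On the graph of a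
  symmetric operator it is the quadratic form of that operator, so definiteness of the subspace
  becomes definiteness of the operator.\<close>

definition hyperbolic :: "'a::complex_inner \<times> 'a \<Rightarrow> real" where
  "hyperbolic x = Re (cinner (fst x) (snd x))"

lemma scaleC_Pair: "c *\<^sub>C (u, v) = (c *\<^sub>C u, c *\<^sub>C v)"
  and fst_scaleC [simp]: "fst (c *\<^sub>C x) = c *\<^sub>C fst x"
  and snd_scaleC [simp]: "snd (c *\<^sub>C x) = c *\<^sub>C snd x"
  by (simp_all add: scaleC_prod_def)

lemma cinner_J1: "cinner (J1 x) y = \<i> * symplectic x y"
  by (cases x; cases y)
    (simp add: J1_def cinner_prod_def symplectic_def cinner_scaleC_left algebra_simps)

lemma hypermaximal_neutral_iff:
  "hypermaximal_neutral U \<longleftrightarrow> U = {x. \<forall>y\<in>U. symplectic x y = 0}"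
  by (simp add: hypermaximal_neutral_def cinner_J1)

lemma symplectic_add_left: "symplectic (x + y) z = symplectic x z + symplectic y z"
  and symplectic_add_right: "symplectic z (x + y) = symplectic z x + symplectic z y"
  and symplectic_diff_left: "symplectic (x - y) z = symplectic x z - symplectic y z"
  and symplectic_diff_right: "symplectic z (x - y) = symplectic z x - symplectic z y"
  and symplectic_scaleC_left: "symplectic (c *\<^sub>C x) y = c * symplectic x y"
  and symplectic_scaleC_right: "symplectic x (c *\<^sub>C y) = cnj c * symplectic x y"
  and symplectic_zero_left [simp]: "symplectic 0 y = 0"
  and symplectic_zero_right [simp]: "symplectic y 0 = 0"
  by (simp_all add: symplectic_def cinner_algebra algebra_simps)

lemma symplectic_commute: "symplectic x y = - cnj (symplectic y x)"
  by (simp add: symplectic_def cinner_commute[of "fst x"] cinner_commute[of "snd x"])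

lemma symplectic_eq_0_commute: "symplectic x y = 0 \<longleftrightarrow> symplectic y x = 0"
  by (metis symplectic_commute complex_cnj_zero_iff neg_equal_0_iff_equal)

lemma continuous_on_symplectic [continuous_intros]:
  "continuous_on S f \<Longrightarrow> continuous_on S g \<Longrightarrow> continuous_on S (\<lambda>x. symplectic (f x) (g x))"
  unfolding symplectic_def by (intro continuous_intros)

lemma continuous_on_hyperbolic [continuous_intros]:
  "continuous_on S f \<Longrightarrow> continuous_on S (\<lambda>x. hyperbolic (f x))"
  unfolding hyperbolic_def by (intro continuous_intros)

lemma closed_symplectic_complement: "closed {x. \<forall>y\<in>U. symplectic x y = 0}"
proof -
  have "{x. \<forall>y\<in>U. symplectic x y = 0} = (\<Inter>y\<in>U. {x. symplectic x y = 0})"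
    by auto
  then show ?thesis
    by (auto intro!: closed_Collect_eq continuous_intros)
qed

lemma csubspace_symplectic_complement: "csubspace {x. \<forall>y\<in>U. symplectic x y = 0}"
  by (intro csubspaceI) (simp_all add: symplectic_add_left symplectic_scaleC_left)

text \<open>A symplectic complement is always a closed subspace, so orthogonality passes from
  generators to closed spans, one argument at a time.\<close>

lemma symplectic_closure_cspan_eq_0:
  assumes "\<And>x y. x \<in> S \<Longrightarrow> y \<in> S' \<Longrightarrow> symplectic x y = 0"
    and "x \<in> closure (cspan S)" "y \<in> closure (cspan S')"
  shows "symplectic x y = 0"
proof -
  note * = csubspace_symplectic_complement closed_symplectic_complement
  have 1: "closure (cspan S) \<subseteq> {x. \<forall>z\<in>S'. symplectic x z = 0}"
    using * assms(1) by (intro closure_cspan_minimal) auto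
  then have "closure (cspan S') \<subseteq> {y. \<forall>z\<in>closure (cspan S). symplectic y z = 0}"
    using * symplectic_eq_0_commute by (intro closure_cspan_minimal) fastforce+
  then show ?thesis
    using assms(2,3) symplectic_eq_0_commute by blast
qed

lemma hypermaximal_neutral_closed: "hypermaximal_neutral U \<Longrightarrow> closed U"
  and hypermaximal_neutral_csubspace: "hypermaximal_neutral U \<Longrightarrow> csubspace U"
  using closed_symplectic_complement[of U] csubspace_symplectic_complement[of U]
  by (simp_all flip: hypermaximal_neutral_iff add: hypermaximal_neutral_iff[THEN iffD1, symmetric])

lemma hypermaximal_neutral_symplectic:
  "hypermaximal_neutral U \<Longrightarrow> x \<in> U \<Longrightarrow> y \<in> U \<Longrightarrow> symplectic x y = 0"
  by (auto simp: hypermaximal_neutral_iff)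

lemma hypermaximal_neutral_memI:
  "hypermaximal_neutral U \<Longrightarrow> (\<And>y. y \<in> U \<Longrightarrow> symplectic x y = 0) \<Longrightarrow> x \<in> U"
  by (auto simp: hypermaximal_neutral_iff)

lemma symplectic_swap: "symplectic (prod.swap x) (prod.swap y) = - symplectic x y"
  by (simp add: symplectic_def)

lemma hyperbolic_swap: "hyperbolic (prod.swap x) = hyperbolic x"
  by (simp add: hyperbolic_def Re_cinner_commute)

lemma norm_swap: "norm (prod.swap x) = norm x"
  by (simp add: norm_prod_def add.commute)

text \<open>The swap only changes the sign of the symplectic form, and it turns the graph of an
  injective operator into the graph of its inverse.\<close>

lemma hypermaximal_neutral_swap:
  assumes "hypermaximal_neutral U"
  shows "hypermaximal_neutral (prod.swap ` U)"
  unfolding hypermaximal_neutral_iff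
proof (intro set_eqI)
  fix x
  have "x \<in> prod.swap ` U \<longleftrightarrow> prod.swap x \<in> U"
    by (metis imageE image_eqI swap_swap)
  also have "\<dots> \<longleftrightarrow> (\<forall>y\<in>U. symplectic (prod.swap x) y = 0)"
    using assms hypermaximal_neutral_symplectic hypermaximal_neutral_memI by blast
  also have "\<dots> \<longleftrightarrow> (\<forall>y\<in>U. symplectic x (prod.swap y) = 0)"
    using symplectic_swap[of x] by (metis neg_equal_0_iff_equal swap_swap)
  finally show "x \<in> prod.swap ` U \<longleftrightarrow> x \<in> {x. \<forall>y\<in>prod.swap ` U. symplectic x y = 0}"
    by simp
qed

lemma norm_fst_le_norm: "norm (fst x) \<le> norm (x :: 'a::real_normed_vector \<times> 'b::real_normed_vector)"
  and norm_snd_le_norm: "norm (snd x) \<le> norm (x :: 'a::real_normed_vector \<times> 'b::real_normed_vector)"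
  by (metis norm_fst_le prod.collapse) (metis norm_snd_le prod.collapse)

text \<open>
  Neutrality of \<open>p + q\<close> turns \<open>(p\<^sub>1 | p\<^sub>2) - (q\<^sub>1 | q\<^sub>2)\<close> into \<open>(p\<^sub>1 + q\<^sub>1 | p\<^sub>2 - q\<^sub>2)\<close> up to an
  imaginary part, so the first component alone controls the whole vector.
\<close>

lemma norm_le_fst_if_dichotomy:
  fixes p q :: "'a::complex_inner \<times> 'a"
  assumes "\<delta> > 0" and p: "\<delta> * (norm p)\<^sup>2 \<le> hyperbolic p" and q: "\<delta> * (norm q)\<^sup>2 \<le> - hyperbolic q"
    and pq: "symplectic p q = 0"
  shows "\<delta> * norm (p + q) \<le> 2 * norm (fst (p + q))"
proof -
  let ?s = "norm p + norm q"
  have "Re (cinner (fst p) (snd q)) = Re (cinner (fst q) (snd p))"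
    using pq Re_cinner_commute[of "snd p" "fst q"] by (simp add: symplectic_def)
  then have "hyperbolic p - hyperbolic q = Re (cinner (fst (p + q)) (snd p - snd q))"
    by (simp add: hyperbolic_def cinner_algebra)
  also have "\<dots> \<le> norm (fst (p + q)) * norm (snd p - snd q)"
    by (rule Re_cinner_le)
  also have "norm (snd p - snd q) \<le> ?s"
    using norm_triangle_ineq4[of "snd p" "snd q"] norm_snd_le_norm[of p] norm_snd_le_norm[of q] by linarith
  finally have "\<delta> * (norm p)\<^sup>2 + \<delta> * (norm q)\<^sup>2 \<le> norm (fst (p + q)) * ?s"
    using p q by (simp add: mult_left_mono)
  moreover have "?s\<^sup>2 \<le> 2 * (norm p)\<^sup>2 + 2 * (norm q)\<^sup>2"
    using sum_squares_bound[of "norm p" "norm q"] by (simp add: power2_sum)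
  then have "\<delta> * ?s\<^sup>2 \<le> \<delta> * (2 * (norm p)\<^sup>2 + 2 * (norm q)\<^sup>2)"
    using assms(1) by (intro mult_left_mono) auto
  ultimately have "(\<delta> * ?s) * ?s \<le> (2 * norm (fst (p + q))) * ?s"
    by (simp add: power2_eq_square algebra_simps)
  then have "\<delta> * ?s \<le> 2 * norm (fst (p + q))"
  proof (cases "?s = 0")
    case False
    then have "0 < ?s"
      by (metis add_nonneg_nonneg norm_ge_zero order_le_less)
    with \<open>(\<delta> * ?s) * ?s \<le> _\<close> show ?thesis
      by (rule mult_right_le_imp_le)
  qed (simp only:, simp)
  moreover have "\<delta> * norm (p + q) \<le> \<delta> * ?s"
    using assms(1) by (simp add: norm_triangle_ineq)
  ultimately show ?thesis
    by linarith
qed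

text \<open>The bound makes the first component injective on \<open>U\<close> with closed range. If
  \<open>w\<close> is orthogonal to that range, then \<open>(0, w)\<close> is symplectically
  orthogonal to \<open>U\<close>, hence in \<open>U\<close> by maximality, hence zero by the bound;
  so the range is everything. Neutrality of the graph is symmetry of \<open>f\<close>.\<close>

lemma hypermaximal_neutral_graph:
  fixes U :: "('a::complex_hilbert \<times> 'a) set"
  assumes U: "hypermaximal_neutral U" and bound: "\<And>x. x \<in> U \<Longrightarrow> norm (snd x) \<le> c * norm (fst x)"
  obtains f where "bounded_clinear f" "U = range (\<lambda>u. (u, f u))"
    "\<And>u v. cinner (f u) v = cinner u (f v)"
proof -
  note sub = hypermaximal_neutral_csubspace[OF U] and closed = hypermaximal_neutral_closed[OF U]
  have dom_sub: "csubspace (fst ` U)"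
  proof (rule csubspaceI)
    show "0 \<in> fst ` U"
      using csubspace_0[OF sub] by (metis fst_zero imageI)
    show "x + y \<in> fst ` U" if "x \<in> fst ` U" "y \<in> fst ` U" for x y
      using that csubspace_add[OF sub] by (metis (no_types, lifting) fst_add image_iff)
    show "c *\<^sub>C x \<in> fst ` U" if "x \<in> fst ` U" for c x
      using that csubspace_scale[OF sub] by (metis (no_types, lifting) fst_scaleC image_iff)
  qed
  have dom_closed: "closed (fst ` U)"
    unfolding closed_sequential_limits
  proof (intro allI impI)
    fix g l assume "(\<forall>n. g n \<in> fst ` U) \<and> g \<longlonglongrightarrow> l"
    then have g: "\<And>n. \<exists>v. (g n, v) \<in> U" "g \<longlonglongrightarrow> l"
      by force+
    then obtain h where h: "\<And>n. (g n, h n) \<in> U"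
      by metis
    have c: "norm (h m - h n) \<le> c * norm (g m - g n)" for m n
      using bound[OF csubspace_diff[OF sub h h]] by simp
    have "Cauchy h"
      by (rule Cauchy_norm_le[OF g(2) c])
    then obtain v where "h \<longlonglongrightarrow> v"
      using Cauchy_convergent convergent_def by blast
    then have "(\<lambda>n. (g n, h n)) \<longlonglongrightarrow> (l, v)"
      using g(2) by (intro tendsto_intros)
    then have "(l, v) \<in> U"
      using closed_sequentially[OF closed, of "\<lambda>n. (g n, h n)"] h by simp
    then show "l \<in> fst ` U" by force
  qed
  have dom_perp: "w = 0" if "\<And>m. m \<in> fst ` U \<Longrightarrow> cinner w m = 0" for w
  proof -
    have "(0, w) \<in> U"
      using that by (intro hypermaximal_neutral_memI[OF U]) (auto simp: symplectic_def)
    then show ?thesis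
      using bound by fastforce
  qed
  have dom: "fst ` U = UNIV"
    by (rule dense_if_orthogonal_trivial[OF dom_closed dom_sub]) (rule dom_perp)
  have "\<exists>v. (u, v) \<in> U" for u
  proof -
    have "u \<in> fst ` U"
      by (simp add: dom)
    then show ?thesis by force
  qed
  then obtain f where f: "\<And>u. (u, f u) \<in> U"
    by metis
  have unique: "v = f u" if "(u, v) \<in> U" for u v
  proof -
    have "(u, v) - (u, f u) \<in> U"
      using that f by (intro csubspace_diff sub)
    from bound[OF this] show ?thesis by simp
  qed
  have "bounded_clinear f"
  proof (rule bounded_clinearI[of f c])
    show "f (x + y) = f x + f y" for x y
      using unique[of "x + y" "f x + f y"] csubspace_add[OF sub f[of x] f[of y]] by simp
    show "f (a *\<^sub>C x) = a *\<^sub>C f x" for a x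
      using unique[of "a *\<^sub>C x" "a *\<^sub>C f x"] csubspace_scale[OF sub f[of x], of a]
      by (simp add: scaleC_Pair)
    show "norm (f x) \<le> norm x * c" for x
      using bound[OF f] by (simp add: mult.commute)
  qed
  moreover have "U = range (\<lambda>u. (u, f u))"
    using f unique by auto
  moreover have "cinner (f u) v = cinner u (f v)" for u v
    using hypermaximal_neutral_symplectic[OF U f f, of u v] by (simp add: symplectic_def)
  ultimately show thesis
    by (rule that)
qed

lemma hypermaximal_neutral_range:
  fixes f :: "'a::complex_inner \<Rightarrow> 'a"
  assumes "\<And>u v. cinner (f u) v = cinner u (f v)"
  shows "hypermaximal_neutral (range (\<lambda>u. (u, f u)))"
  unfolding hypermaximal_neutral_iff
proof (intro set_eqI iffI)
  fix x assume "x \<in> {x. \<forall>y\<in>range (\<lambda>u. (u, f u)). symplectic x y = 0}"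
  then have "cinner (snd x) u = cinner (f (fst x)) u" for u
    by (simp add: symplectic_def assms)
  then have "snd x = f (fst x)"
    by (metis dense_cinner_unique[of UNIV] cinner_commute closure_UNIV)
  then show "x \<in> range (\<lambda>u. (u, f u))"
    by (intro image_eqI[of _ _ "fst x"]) (simp_all add: prod_eq_iff)
qed (auto simp: symplectic_def assms)

lemma graph_UNIV: "graph (Operator UNIV f) = range (\<lambda>u. (u, f u))"
  by (auto simp: graph_def)

lemma selfadjoint_UNIV:
  fixes f :: "'a::complex_inner \<Rightarrow> 'a"
  assumes "bounded_clinear f" "\<And>u v. cinner (f u) v = cinner u (f v)"
  shows "selfadjoint (Operator UNIV f)"
proof -
  have "(THE w. \<forall>u. cinner (f u) v = cinner u w) = f v" for v
    using assms(2) dense_cinner_unique[of UNIV] by (intro the_equality) auto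
  then show ?thesis
    using assms unfolding selfadjoint_def adjoint_op_def linear_operator_def densely_defined_def
    by (auto simp: bounded_clinear_add bounded_clinear_scaleC)
qed

lemma inverse_op_UNIV:
  assumes "\<And>u. g (f u) = u" "\<And>v. f (g v) = v"
  shows "inverse_op (Operator UNIV f) = Operator UNIV g"
proof -
  have "bij f"
    using assms by (metis bijI')
  moreover have "inv f = g"
    using assms by (intro inv_equality)
  ultimately show ?thesis
    by (simp add: inverse_op_def bij_is_surj)
qed

lemma boundedly_invertible_UNIV:
  assumes "bounded_clinear g" "\<And>u. g (f u) = u" "\<And>v. f (g v) = v"
  shows "boundedly_invertible (Operator UNIV f)"
proof -
  have "bij f"
    using assms by (metis bijI')
  then show ?thesis
    unfolding boundedly_invertible_def
    using assms inverse_op_UNIV[of g f] by (simp add: bounded_operator_def)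
qed

section \<open>Neutral subspaces that split along a positive and a negative one\<close>

definition splits_along :: "('a::ab_group_add) set \<Rightarrow> 'a set \<Rightarrow> 'a set \<Rightarrow> bool" where
  "splits_along Up Um U \<longleftrightarrow> (\<forall>x\<in>U. \<exists>p\<in>U \<inter> Up. \<exists>q\<in>U \<inter> Um. x = p + q)"

text \<open>Only two subspaces occur, no operator: the assumptions survive the swap of components,
  so each result on graphs has a twin on inverses.\<close>

locale dichotomy =
  fixes Up Um :: "('a::complex_hilbert \<times> 'a) set" and \<delta> :: real
  assumes \<delta>_pos: "\<delta> > 0"
    and Up_neutral: "hypermaximal_neutral Up" and Um_neutral: "hypermaximal_neutral Um"
    and Up_positive: "\<And>x. x \<in> Up \<Longrightarrow> \<delta> * (norm x)\<^sup>2 \<le> hyperbolic x"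
    and Um_negative: "\<And>x. x \<in> Um \<Longrightarrow> \<delta> * (norm x)\<^sup>2 \<le> - hyperbolic x"
begin

lemma swap: "dichotomy (prod.swap ` Up) (prod.swap ` Um) \<delta>"
proof unfold_locales
  show "\<delta> * (norm x)\<^sup>2 \<le> hyperbolic x" if "x \<in> prod.swap ` Up" for x
    using that Up_positive[of "prod.swap x"] unfolding hyperbolic_swap norm_swap by auto
  show "\<delta> * (norm x)\<^sup>2 \<le> - hyperbolic x" if "x \<in> prod.swap ` Um" for x
    using that Um_negative[of "prod.swap x"] unfolding hyperbolic_swap norm_swap by auto
qed (auto simp: \<delta>_pos Up_neutral Um_neutral hypermaximal_neutral_swap)

lemma splits_along_swap:
  assumes "splits_along Up Um U"
  shows "splits_along (prod.swap ` Up) (prod.swap ` Um) (prod.swap ` U)"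
  unfolding splits_along_def
proof
  fix x assume "x \<in> prod.swap ` U"
  then obtain y where y: "y \<in> U" "x = prod.swap y"
    by auto
  then obtain p q where "p \<in> U \<inter> Up" "q \<in> U \<inter> Um" "y = p + q"
    using assms unfolding splits_along_def by blast
  then show "\<exists>p\<in>prod.swap ` U \<inter> prod.swap ` Up. \<exists>q\<in>prod.swap ` U \<inter> prod.swap ` Um. x = p + q"
    using y by (intro bexI[of _ "prod.swap p"] bexI[of _ "prod.swap q"]) (auto simp: prod_eq_iff)
qed

lemma graph_exists:
  assumes "hypermaximal_neutral U" "splits_along Up Um U"
  obtains f where "bounded_clinear f" "U = range (\<lambda>u. (u, f u))"
    "\<And>u v. cinner (f u) v = cinner u (f v)"
proof (rule hypermaximal_neutral_graph[OF assms(1), of "2 / \<delta>"])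
  fix x assume "x \<in> U"
  then obtain p q where pq: "p \<in> U \<inter> Up" "q \<in> U \<inter> Um" "x = p + q"
    using assms(2) unfolding splits_along_def by blast
  then have "\<delta> * norm x \<le> 2 * norm (fst x)"
    using norm_le_fst_if_dichotomy[OF \<delta>_pos Up_positive[of p] Um_negative[of q]]
      hypermaximal_neutral_symplectic[OF assms(1), of p q] by blast
  moreover have "norm (snd x) \<le> norm x"
    by (rule norm_snd_le_norm)
  then have "\<delta> * norm (snd x) \<le> \<delta> * norm x"
    using \<delta>_pos by simp
  ultimately have "\<delta> * norm (snd x) \<le> 2 * norm (fst x)"
    by (rule order_trans[rotated])
  then show "norm (snd x) \<le> 2 / \<delta> * norm (fst x)"
    using \<delta>_pos by (simp add: field_simps)
qed blast

text \<open>Split \<open>(u, f u) = (a, fp a) + (b, fm b)\<close>. Neutrality of \<open>U\<close>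
  gives \<open>(fp a | b) = (a | fm b)\<close>, so the mixed terms cancel and
  \<open>(fp u | u) - (f u | u) = (fp b | b) - (fm b | b)\<close>, a difference of a nonnegative and
  a nonpositive number. The lower bound is the same computation with \<open>a\<close>.\<close>

lemma graph_between:
  assumes U: "hypermaximal_neutral U" "splits_along Up Um U"
    and f: "bounded_clinear f" "U = range (\<lambda>u. (u, f u))"
    and fp: "bounded_clinear fp" "Up = range (\<lambda>u. (u, fp u))"
    and fm: "bounded_clinear fm" "Um = range (\<lambda>u. (u, fm u))"
  shows "Re (cinner (fm u) u) \<le> Re (cinner (f u) u)" "Re (cinner (f u) u) \<le> Re (cinner (fp u) u)"
proof -
  have sym: "cinner (fp u) v = cinner u (fp v)" "cinner (fm u) v = cinner u (fm v)" for u v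
    using hypermaximal_neutral_symplectic[OF Up_neutral, of "(u, fp u)" "(v, fp v)"] fp(2)
      hypermaximal_neutral_symplectic[OF Um_neutral, of "(u, fm u)" "(v, fm v)"] fm(2)
    by (auto simp: symplectic_def)
  have nonneg: "0 \<le> Re (cinner (fp w) w)" "Re (cinner (fm w) w) \<le> 0" for w
  proof -
    have "0 \<le> \<delta> * (norm x)\<^sup>2" for x :: "'a \<times> 'a"
      using \<delta>_pos by simp
    then have "0 \<le> hyperbolic (w, fp w)" "0 \<le> - hyperbolic (w, fm w)"
      using Up_positive[of "(w, fp w)"] Um_negative[of "(w, fm w)"]
      unfolding fp(2) fm(2) by (meson order_trans rangeI)+
    then show "0 \<le> Re (cinner (fp w) w)" "Re (cinner (fm w) w) \<le> 0"
      using Re_cinner_commute[of w] by (simp_all add: hyperbolic_def)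
  qed
  obtain p q where pq: "p \<in> U \<inter> Up" "q \<in> U \<inter> Um" "(u, f u) = p + q"
    using U(2) f(2) unfolding splits_along_def by blast
  obtain a b where ab: "p = (a, fp a)" "q = (b, fm b)"
    using pq fp(2) fm(2) by auto
  then have u: "u = a + b" "f u = fp a + fm b"
    using pq(3) by auto
  have 1: "cinner (fp a) b = cinner a (fm b)"
    using hypermaximal_neutral_symplectic[OF U(1), of p q] pq ab by (simp add: symplectic_def)
  then have 2: "cinner (fp b) a = cinner (fm b) a" "cinner (fp a) b = cinner (fm a) b"
    by (metis cinner_commute sym(1)) (simp add: 1 sym(2))
  have "cinner (fp u) u - cinner (f u) u = cinner (fp b) b - cinner (fm b) b"
    by (simp add: u(2)) (simp add: u(1) bounded_clinear_add[OF fp(1)] cinner_algebra 2)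
  then show "Re (cinner (f u) u) \<le> Re (cinner (fp u) u)"
    using nonneg[of b] by (metis (no_types) diff_ge_0_iff_ge dual_order.trans minus_complex.sel(1))
  have "cinner (f u) u - cinner (fm u) u = cinner (fp a) a - cinner (fm a) a"
    by (simp add: u(2)) (simp add: u(1) bounded_clinear_add[OF fm(1)] cinner_algebra 2)
  then show "Re (cinner (fm u) u) \<le> Re (cinner (f u) u)"
    using nonneg[of a] by (metis (no_types) diff_ge_0_iff_ge dual_order.trans minus_complex.sel(1))
qed

text \<open>\<open>graph_exists\<close> applied to the swapped subspaces: \<open>U\<close> is then a
  graph over either component, and the two functions are inverse to each other.\<close>

lemma inverse_graph_exists:
  assumes U: "hypermaximal_neutral U" "splits_along Up Um U"
    and f: "U = range (\<lambda>u. (u, f u))"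
  obtains g where "bounded_clinear g" "\<And>u. g (f u) = u" "\<And>v. f (g v) = v"
proof -
  obtain g where g: "bounded_clinear g" "prod.swap ` U = range (\<lambda>v. (v, g v))"
    by (rule dichotomy.graph_exists[OF swap hypermaximal_neutral_swap[OF U(1)]
          splits_along_swap[OF U(2)]])
  have "g (f u) = u" for u
  proof -
    have "(f u, u) \<in> prod.swap ` U"
      using f by (auto simp: image_iff)
    then show ?thesis using g(2) by auto
  qed
  moreover have "f (g v) = v" for v
  proof -
    have "(v, g v) \<in> prod.swap ` U"
      using g(2) by auto
    then show ?thesis using f by auto
  qed
  ultimately show thesis
    using that g(1) by blast
qed

lemma inverse_graph_between:
  assumes U: "hypermaximal_neutral U" "splits_along Up Um U"
    and f: "U = range (\<lambda>u. (u, f u))" "bounded_clinear g" "\<And>u. g (f u) = u" "\<And>v. f (g v) = v"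
    and fp: "Up = range (\<lambda>u. (u, fp u))" "bounded_clinear gp" "\<And>u. gp (fp u) = u" "\<And>v. fp (gp v) = v"
    and fm: "Um = range (\<lambda>u. (u, fm u))" "bounded_clinear gm" "\<And>u. gm (fm u) = u" "\<And>v. fm (gm v) = v"
  shows "Re (cinner (gm u) u) \<le> Re (cinner (g u) u)" "Re (cinner (g u) u) \<le> Re (cinner (gp u) u)"
proof -
  have swap_graph: "prod.swap ` range (\<lambda>u. (u, h u)) = range (\<lambda>v. (v, k v))"
    if "\<And>u. k (h u) = u" "\<And>v. h (k v) = v" for h k :: "'a \<Rightarrow> 'a"
  proof -
    have "(h u, u) \<in> range (\<lambda>v. (v, k v))" for u
      by (metis that(1) rangeI)
    moreover have "(v, k v) \<in> prod.swap ` range (\<lambda>u. (u, h u))" for v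
      by (metis that(2) rangeI image_eqI swap_simp)
    ultimately show ?thesis by auto
  qed
  show "Re (cinner (gm u) u) \<le> Re (cinner (g u) u)" "Re (cinner (g u) u) \<le> Re (cinner (gp u) u)"
    using dichotomy.graph_between[OF swap hypermaximal_neutral_swap[OF U(1)] splits_along_swap[OF U(2)],
        of g gp gm u]
    using f fp fm swap_graph by auto
qed

end


section \<open>A Lyapunov theorem for Jordan chains\<close>

lemma exp_times_power_tendsto_0:
  fixes w \<nu> :: complex
  assumes "Re w > 0"
  shows "((\<lambda>t. exp (w * of_real t) * (\<nu> * of_real t) ^ m) \<longlongrightarrow> 0) at_bot"
  unfolding filterlim_at_bot_mirror
proof (rule tendsto_norm_zero_cancel)
  have "filterlim (\<lambda>t. Re w * t) at_top at_top"
    using assms by (intro filterlim_tendsto_pos_mult_at_top[OF tendsto_const _ filterlim_ident])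
  then have "((\<lambda>t. (Re w * t) ^ m / exp (Re w * t)) \<longlongrightarrow> 0) at_top"
    by (rule filterlim_compose[OF tendsto_power_div_exp_0])
  then have "((\<lambda>t. (cmod \<nu> / Re w) ^ m * ((Re w * t) ^ m / exp (Re w * t))) \<longlongrightarrow> 0) at_top"
    by (rule tendsto_mult_right_zero)
  moreover have "\<forall>\<^sub>F t in at_top. (cmod \<nu> / Re w) ^ m * ((Re w * t) ^ m / exp (Re w * t))
      = norm (exp (w * of_real (- t)) * (\<nu> * of_real (- t)) ^ m)"
    using eventually_ge_at_top[of 0]
  proof eventually_elim
    case (elim t)
    then show ?case
      using assms
      by (simp add: norm_mult norm_power norm_divide norm_exp_eq_Re exp_minus field_simps power_mult_distrib)
  qed
  ultimately show "((\<lambda>t. norm (exp (w * of_real (- t)) * (\<nu> * of_real (- t)) ^ m)) \<longlongrightarrow> 0) at_top"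
    by (simp cong: tendsto_cong add: Lim_transform_eventually)
qed

text \<open>The coordinates of \<open>e\<^sup>t\<^sup>S x\<close> on a Jordan chain of length \<open>n\<close>, where \<open>a\<close> are those of \<open>x\<close>.\<close>

definition chain_orbit :: "complex \<Rightarrow> complex \<Rightarrow> nat \<Rightarrow> (nat \<Rightarrow> complex) \<Rightarrow> nat \<Rightarrow> complex \<Rightarrow> complex" where
  "chain_orbit w \<nu> n a k z =
    (\<Sum>m<n. (if k + m < n then a (k + m) else 0) * (exp (w * z) * (\<nu> * z) ^ m) / fact m)"

lemma chain_orbit_0: "k < n \<Longrightarrow> chain_orbit w \<nu> n a k 0 = a k"
  by (cases n) (simp_all add: chain_orbit_def sum.lessThan_Suc_shift)

text \<open>With this value past the end of the chain, the differential recursion holds for the last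
  member as well, without a case distinction.\<close>

lemma chain_orbit_beyond: "n \<le> k \<Longrightarrow> chain_orbit w \<nu> n a k z = 0"
  by (simp add: chain_orbit_def)

lemma chain_orbit_deriv:
  "(chain_orbit w \<nu> n a k has_field_derivative
    w * chain_orbit w \<nu> n a k z + \<nu> * chain_orbit w \<nu> n a (Suc k) z) (at z)"
proof (cases n)
  case (Suc N)
  define c where "c m = (if k + m < n then a (k + m) else 0)" for m
  define p where "p m z = (\<nu> * z) ^ m / fact m" for m and z :: complex
  have p: "(p 0 has_field_derivative 0) (at z)" "(p (Suc m) has_field_derivative \<nu> * p m z) (at z)" for m
  proof -
    show "(p 0 has_field_derivative 0) (at z)"
      by (simp add: p_def[abs_def])
    have "(p (Suc m) has_field_derivative of_nat (Suc m) * (\<nu> * z) ^ m * \<nu> / fact (Suc m)) (at z)"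
      unfolding p_def[abs_def]
      by (rule DERIV_cong[OF DERIV_cdivide[OF DERIV_power[OF DERIV_cmult_Id]]]) simp
    also have "of_nat (Suc m) * (\<nu> * z) ^ m * \<nu> / fact (Suc m) = \<nu> * p m z"
      by (simp add: p_def divide_simps del: of_nat_Suc)
    finally show "(p (Suc m) has_field_derivative \<nu> * p m z) (at z)" .
  qed
  have orbit: "chain_orbit w \<nu> n a k z = exp (w * z) * (\<Sum>m<Suc N. c m * p m z)" for z
    by (simp add: chain_orbit_def c_def p_def Suc sum_distrib_left distrib_left mult_ac)
  have orbit_Suc: "chain_orbit w \<nu> n a (Suc k) z = exp (w * z) * (\<Sum>m<N. c (Suc m) * p m z)"
  proof -
    have "chain_orbit w \<nu> n a (Suc k) z = exp (w * z) * (\<Sum>m<Suc N. c (Suc m) * p m z)"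
    proof -
      have "(if Suc k + m < n then a (Suc k + m) else 0) = c (Suc m)" for m
        by (simp add: c_def)
      then show ?thesis
        by (simp only: chain_orbit_def p_def Suc sum_distrib_left) (simp add: mult_ac)
    qed
    \<comment> \<open>Since \<open>n = Suc N\<close>, the index \<open>k + Suc N\<close> lies
      outside the chain. Dropping this term makes the sum as long as the one that differentiation
      produces.\<close>
    also have "c (Suc N) = 0"
      by (simp add: c_def Suc)
    then have "(\<Sum>m<Suc N. c (Suc m) * p m z) = (\<Sum>m<N. c (Suc m) * p m z)"
      by simp
    finally show ?thesis .
  qed
  have "((\<lambda>z. \<Sum>m<Suc N. c m * p m z) has_field_derivative (\<Sum>m<N. c (Suc m) * (\<nu> * p m z))) (at z)"
    unfolding sum.lessThan_Suc_shift
    by (auto intro!: derivative_eq_intros p sum.cong simp: mult_ac)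
  then have "((\<lambda>z. exp (w * z) * (\<Sum>m<Suc N. c m * p m z)) has_field_derivative
      exp (w * z) * w * (\<Sum>m<Suc N. c m * p m z) + (\<Sum>m<N. c (Suc m) * (\<nu> * p m z)) * exp (w * z)) (at z)"
    by (intro DERIV_mult) (auto intro!: derivative_eq_intros)
  moreover have "chain_orbit w \<nu> n a k = (\<lambda>z. exp (w * z) * (\<Sum>m<Suc N. c m * p m z))"
    using orbit by blast
  moreover have "(\<Sum>m<N. c (Suc m) * (\<nu> * p m z)) * exp (w * z) = \<nu> * chain_orbit w \<nu> n a (Suc k) z"
    by (simp add: orbit_Suc sum_distrib_left sum_distrib_right mult_ac)
  ultimately show ?thesis
    by (simp add: orbit mult_ac del: sum.lessThan_Suc)
qed (simp add: chain_orbit_def[abs_def])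

lemma chain_orbit_tendsto_0:
  assumes "Re w > 0"
  shows "((\<lambda>t. chain_orbit w \<nu> n a k (of_real t)) \<longlongrightarrow> 0) at_bot"
  unfolding chain_orbit_def
  by (intro tendsto_null_sum tendsto_divide_zero tendsto_mult_right_zero
      exp_times_power_tendsto_0 assms)

text \<open>The action of the chain relation on coordinates: \<open>S\<close> lowers the index of
  basis vectors, so the new coordinate \<open>k\<close> receives the old coordinate
  \<open>k + 1\<close>.\<close>

definition chain_map ::
  "('j \<Rightarrow> complex) \<Rightarrow> complex \<Rightarrow> ('j \<Rightarrow> nat) \<Rightarrow> ('j \<times> nat \<Rightarrow> complex) \<Rightarrow> 'j \<times> nat \<Rightarrow> complex" where
  "chain_map w \<nu> n a = (\<lambda>(j, k). w j * a (j, k) + (if Suc k < n j then \<nu> * a (j, Suc k) else 0))"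

text \<open>
  The form increases along the orbits of \<open>S\<close>, which tend to \<open>0\<close> in the past because the spectrum
  lies in the right half-plane; hence its values are nonnegative.
\<close>

lemma lyapunov_matrix:
  fixes B :: "'j \<times> nat \<Rightarrow> 'j \<times> nat \<Rightarrow> complex" and n :: "'j \<Rightarrow> nat"
  defines "form \<equiv> \<lambda>F a a'. \<Sum>i\<in>(SIGMA j:F. {..<n j}). \<Sum>l\<in>(SIGMA j:F. {..<n j}). a i * cnj (a' l) * B i l"
  assumes w: "\<And>j. j \<in> F \<Longrightarrow> Re (w j) > 0"
    and increasing: "\<And>a. 0 \<le> Re (form F (chain_map w \<nu> n a) a + form F a (chain_map w \<nu> n a))"
  shows "0 \<le> Re (form F a a)"
proof -
  let ?I = "SIGMA j:F. {..<n j}"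
  define c where "c t = (\<lambda>(j, k). chain_orbit (w j) \<nu> (n j) (\<lambda>m. a (j, m)) k (of_real t))" for t
  define q where "q t = Re (form F (c t) (c t))" for t
  have c_deriv: "((\<lambda>t. c t i) has_vector_derivative chain_map w \<nu> n (c t) i) (at t)" for t i
  proof -
    obtain j k where i: "i = (j, k)" by fastforce
    have "chain_map w \<nu> n (c t) i = w j * c t (j, k) + \<nu> * c t (j, Suc k)"
      by (simp add: chain_map_def i c_def chain_orbit_beyond)
    then show ?thesis
      unfolding i c_def prod.case
      by (simp only:) (rule has_vector_derivative_real_field, rule chain_orbit_deriv)
  qed
  have "(q has_real_derivative Re (form F (chain_map w \<nu> n (c t)) (c t) + form F (c t) (chain_map w \<nu> n (c t)))) (at t)"
    for t
  proof -
    have "((\<lambda>t. form F (c t) (c t)) has_vector_derivative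
      (\<Sum>i\<in>?I. \<Sum>l\<in>?I. (c t i * cnj (chain_map w \<nu> n (c t) l) + chain_map w \<nu> n (c t) i * cnj (c t l)) * B i l)) (at t)"
      unfolding form_def
      by (intro has_vector_derivative_sum has_vector_derivative_mult_left has_vector_derivative_mult
          has_vector_derivative_cnj c_deriv)
    also have "(\<Sum>i\<in>?I. \<Sum>l\<in>?I. (c t i * cnj (chain_map w \<nu> n (c t) l) + chain_map w \<nu> n (c t) i * cnj (c t l)) * B i l)
      = form F (chain_map w \<nu> n (c t)) (c t) + form F (c t) (chain_map w \<nu> n (c t))"
      by (simp add: form_def distrib_right sum.distrib)
    finally have "(q has_vector_derivative
        Re (form F (chain_map w \<nu> n (c t)) (c t) + form F (c t) (chain_map w \<nu> n (c t)))) (at t)"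
      unfolding q_def by (rule bounded_linear.has_vector_derivative[OF bounded_linear_Re])
    then show ?thesis
      by (simp add: has_real_derivative_iff_has_vector_derivative)
  qed
  then have mono: "q s \<le> q t" if "s \<le> t" for s t
    using DERIV_nonneg_imp_nondecreasing[OF that] increasing by blast
  have c_lim: "((\<lambda>t. c t i) \<longlongrightarrow> 0) at_bot" if "i \<in> ?I" for i
    using that w by (auto simp: c_def intro: chain_orbit_tendsto_0)
  have "((\<lambda>t. form F (c t) (c t)) \<longlongrightarrow> 0) at_bot"
    unfolding form_def
  proof (intro tendsto_null_sum)
    fix i l assume "i \<in> ?I" "l \<in> ?I"
    then have "((\<lambda>t. c t i * cnj (c t l) * B i l) \<longlongrightarrow> 0 * cnj 0 * B i l) at_bot"
      by (intro tendsto_intros c_lim)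
    then show "((\<lambda>t. c t i * cnj (c t l) * B i l) \<longlongrightarrow> 0) at_bot" by simp
  qed
  then have "(q \<longlongrightarrow> Re 0) at_bot"
    unfolding q_def by (rule tendsto_Re)
  moreover have "\<forall>\<^sub>F t in at_bot. q t \<le> q 0"
    using eventually_le_at_bot[of 0] by eventually_elim (rule mono)
  ultimately have "0 \<le> q 0"
    using tendsto_upperbound[of q "Re 0" at_bot "q 0"] by (simp add: trivial_limit_at_bot_linorder)
  moreover have "form F (c 0) (c 0) = form F a a"
    unfolding form_def by (intro sum.cong refl) (auto simp: c_def chain_orbit_0)
  ultimately show ?thesis
    by (simp add: q_def)
qed

text \<open>The sum runs over complete chains rather than over arbitrary finite index sets, because
  only such sums keep their index set when the chain relation is applied.\<close>

lemma cspan_chains_explicit: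
  fixes e :: "'j \<times> nat \<Rightarrow> 'v::complex_inner" and n :: "'j \<Rightarrow> nat"
  assumes "x \<in> cspan (e ` (SIGMA j:J. {..<n j}))"
  obtains F a where "finite F" "F \<subseteq> J" "x = (\<Sum>i\<in>(SIGMA j:F. {..<n j}). a i *\<^sub>C e i)"
proof -
  \<comment> \<open>Coefficients have to vanish off \<open>F\<close> so that two sums can be
    extended to the union of their chain sets before they are added.\<close>
  define M where "M = {x. \<exists>F a. finite F \<and> F \<subseteq> J \<and> (\<forall>i. fst i \<notin> F \<longrightarrow> a i = 0) \<and>
    x = (\<Sum>i\<in>(SIGMA j:F. {..<n j}). a i *\<^sub>C e i)}"
  have extend: "(\<Sum>i\<in>(SIGMA j:F. {..<n j}). a i *\<^sub>C e i) = (\<Sum>i\<in>(SIGMA j:F'. {..<n j}). a i *\<^sub>C e i)"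
    if "finite F'" "F \<subseteq> F'" "\<forall>i. fst i \<notin> F \<longrightarrow> a i = 0" for F F' and a :: "'j \<times> nat \<Rightarrow> complex"
    using that by (intro sum.mono_neutral_left) auto
  have "csubspace M"
  proof (rule csubspaceI)
    show "0 \<in> M"
      unfolding M_def by (auto intro!: exI[of _ "{}"] exI[of _ "\<lambda>_. 0"])
  next
    fix x y assume "x \<in> M" "y \<in> M"
    then obtain F a F' a' where
      x: "finite F" "F \<subseteq> J" "\<forall>i. fst i \<notin> F \<longrightarrow> a i = 0" "x = (\<Sum>i\<in>(SIGMA j:F. {..<n j}). a i *\<^sub>C e i)" and
      y: "finite F'" "F' \<subseteq> J" "\<forall>i. fst i \<notin> F' \<longrightarrow> a' i = 0" "y = (\<Sum>i\<in>(SIGMA j:F'. {..<n j}). a' i *\<^sub>C e i)"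
      unfolding M_def by blast
    have "x = (\<Sum>i\<in>(SIGMA j:F\<union>F'. {..<n j}). a i *\<^sub>C e i)" "y = (\<Sum>i\<in>(SIGMA j:F\<union>F'. {..<n j}). a' i *\<^sub>C e i)"
      using x y extend[of "F \<union> F'" F a] extend[of "F \<union> F'" F' a'] by auto
    then have "x + y = (\<Sum>i\<in>(SIGMA j:F\<union>F'. {..<n j}). (a i + a' i) *\<^sub>C e i)"
      by (simp add: sum.distrib scaleC_add_left)
    then show "x + y \<in> M"
      unfolding M_def using x y
      by (auto intro!: exI[of _ "F \<union> F'"] exI[of _ "\<lambda>i. a i + a' i"])
  next
    fix c x assume "x \<in> M"
    then obtain F a where
      x: "finite F" "F \<subseteq> J" "\<forall>i. fst i \<notin> F \<longrightarrow> a i = 0" "x = (\<Sum>i\<in>(SIGMA j:F. {..<n j}). a i *\<^sub>C e i)"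
      unfolding M_def by blast
    then have "c *\<^sub>C x = (\<Sum>i\<in>(SIGMA j:F. {..<n j}). (c * a i) *\<^sub>C e i)"
      by (simp add: scaleC_sum_right scaleC_scaleC)
    then show "c *\<^sub>C x \<in> M"
      unfolding M_def using x
      by (auto intro!: exI[of _ F] exI[of _ "\<lambda>i. c * a i"])
  qed
  moreover have "e i \<in> M" if "i \<in> (SIGMA j:J. {..<n j})" for i
  proof -
    have "e i = (\<Sum>l\<in>(SIGMA j:{fst i}. {..<n j}). (if l = i then 1 else 0) *\<^sub>C e l)"
      using that by (subst sum.remove[of _ i]) (auto simp: finite_SigmaI intro!: sum.neutral)
    then show ?thesis
      unfolding M_def using that
      by (intro CollectI exI[of _ "{fst i}"] exI[of _ "\<lambda>l. if l = i then 1 else 0"]) auto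
  qed
  ultimately have "cspan (e ` (SIGMA j:J. {..<n j})) \<subseteq> M"
    by (intro complex_vector.span_minimal) auto
  then show thesis
    using assms that unfolding M_def by blast
qed

lemma chain_map_image:
  fixes e :: "'j \<times> nat \<Rightarrow> 'v::complex_inner"
  assumes "finite F" and chain: "\<And>j k. j \<in> F \<Longrightarrow> k < n j \<Longrightarrow>
      s (j, k) = w j *\<^sub>C e (j, k) + (if k = 0 then 0 else \<nu> *\<^sub>C e (j, k - 1))"
  shows "(\<Sum>i\<in>(SIGMA j:F. {..<n j}). a i *\<^sub>C s i) = (\<Sum>i\<in>(SIGMA j:F. {..<n j}). chain_map w \<nu> n a i *\<^sub>C e i)"
proof -
  have "(\<Sum>k<n j. a (j, k) *\<^sub>C s (j, k)) = (\<Sum>k<n j. chain_map w \<nu> n a (j, k) *\<^sub>C e (j, k))" if "j \<in> F" for j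
  proof (cases "n j")
    case (Suc N)
    have "(\<Sum>k<n j. a (j, k) *\<^sub>C s (j, k)) = (\<Sum>k<n j. a (j, k) *\<^sub>C w j *\<^sub>C e (j, k))
        + (\<Sum>k<Suc N. a (j, k) *\<^sub>C (if k = 0 then 0 else \<nu> *\<^sub>C e (j, k - 1)))"
      using chain[OF that] by (simp add: scaleC_add_right sum.distrib flip: Suc)
    also have "(\<Sum>k<Suc N. a (j, k) *\<^sub>C (if k = 0 then 0 else \<nu> *\<^sub>C e (j, k - 1)))
        = (\<Sum>k<N. (\<nu> * a (j, Suc k)) *\<^sub>C e (j, k))"
      unfolding sum.lessThan_Suc_shift by (simp add: scaleC_scaleC mult.commute)
    also have "\<dots> = (\<Sum>k<Suc N. (if Suc k < n j then \<nu> * a (j, Suc k) else 0) *\<^sub>C e (j, k))"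
      by (simp add: Suc)
    finally show ?thesis
      by (simp add: chain_map_def scaleC_add_left sum.distrib scaleC_scaleC mult.commute flip: Suc)
  qed simp
  then have "(\<Sum>j\<in>F. \<Sum>k<n j. a (j, k) *\<^sub>C s (j, k)) = (\<Sum>j\<in>F. \<Sum>k<n j. chain_map w \<nu> n a (j, k) *\<^sub>C e (j, k))"
    by (rule sum.cong[OF refl])
  then show ?thesis
    using assms(1) by (simp add: sum.Sigma prod.case_eq_if)
qed

text \<open>\<open>lyapunov_matrix\<close> without coordinates. Sesquilinearity and linearity are
  asked for on the span only, since later \<open>b\<close> contains an operator \<open>X\<close> and
  \<open>S\<close> is a multiple of \<open>T\<close>, both defined on a proper domain.\<close>

lemma lyapunov_cspan:
  fixes e :: "'j \<times> nat \<Rightarrow> 'v::complex_inner" and n :: "'j \<Rightarrow> nat" and b :: "'v \<Rightarrow> 'v \<Rightarrow> complex"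
    and J :: "'j set"
  defines "E \<equiv> cspan (e ` (SIGMA j:J. {..<n j}))"
  assumes b_add: "\<And>x y z. x \<in> E \<Longrightarrow> y \<in> E \<Longrightarrow> z \<in> E \<Longrightarrow> b (x + y) z = b x z + b y z"
      "\<And>x y z. x \<in> E \<Longrightarrow> y \<in> E \<Longrightarrow> z \<in> E \<Longrightarrow> b z (x + y) = b z x + b z y"
    and b_scale: "\<And>c x y. x \<in> E \<Longrightarrow> y \<in> E \<Longrightarrow> b (c *\<^sub>C x) y = c * b x y"
      "\<And>c x y. x \<in> E \<Longrightarrow> y \<in> E \<Longrightarrow> b y (c *\<^sub>C x) = cnj c * b y x"
    and S_add: "\<And>x y. x \<in> E \<Longrightarrow> y \<in> E \<Longrightarrow> S (x + y) = S x + S y"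
    and S_scale: "\<And>c x. x \<in> E \<Longrightarrow> S (c *\<^sub>C x) = c *\<^sub>C S x"
    and chain: "\<And>j k. j \<in> J \<Longrightarrow> k < n j \<Longrightarrow>
      S (e (j, k)) = w j *\<^sub>C e (j, k) + (if k = 0 then 0 else \<nu> *\<^sub>C e (j, k - 1))"
    and w: "\<And>j. j \<in> J \<Longrightarrow> n j > 0 \<Longrightarrow> Re (w j) > 0"
    and increasing: "\<And>x. x \<in> E \<Longrightarrow> 0 \<le> Re (b (S x) x + b x (S x))"
    and x: "x \<in> E"
  shows "0 \<le> Re (b x x)"
proof -
  \<comment> \<open>An empty chain has no eigenvector, so the sign of its \<open>w j\<close> is
    unknown; such chains are discarded before \<open>lyapunov_matrix\<close> is applied.\<close>
  let ?J = "{j\<in>J. n j > 0}"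
  have E: "csubspace E"
    unfolding E_def by (rule csubspace_cspan)
  have "(SIGMA j:J. {..<n j}) = (SIGMA j:?J. {..<n j})"
    by auto
  then have "x \<in> cspan (e ` (SIGMA j:?J. {..<n j}))"
    using x by (simp add: E_def)
  then obtain F a where F: "finite F" "F \<subseteq> ?J" and xa: "x = (\<Sum>i\<in>(SIGMA j:F. {..<n j}). a i *\<^sub>C e i)"
    by (rule cspan_chains_explicit)
  let ?I = "SIGMA j:F. {..<n j}"
  have fin: "finite ?I"
    using F by auto
  have e: "e i \<in> E" if "i \<in> ?I" for i
    using that F unfolding E_def by (intro complex_vector.span_base) auto
  have sumE: "(\<Sum>i\<in>I. a i *\<^sub>C e i) \<in> E" if "I \<subseteq> ?I" for I and a :: "'j \<times> nat \<Rightarrow> complex"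
    using that e by (intro csubspace_sum[OF E] csubspace_scale[OF E]) auto
  have zero: "b 0 y = 0" "b y 0 = 0" if "y \<in> E" for y
    using b_scale[of 0 y 0] csubspace_0[OF E] that by simp_all
  have left: "b (\<Sum>i\<in>I. a i *\<^sub>C e i) y = (\<Sum>i\<in>I. a i * b (e i) y)"
    if "y \<in> E" "I \<subseteq> ?I" for I a y
    using finite_subset[OF that(2) fin] that(2)
  proof (induction I rule: finite_induct)
    case (insert i I)
    then show ?case
      using b_add(1)[of "a i *\<^sub>C e i" "\<Sum>i\<in>I. a i *\<^sub>C e i" y] b_scale(1)[of "e i" y] that(1) e sumE[of I a]
        csubspace_scale[OF E]
      by simp
  qed (use that zero in simp)
  have right: "b y (\<Sum>i\<in>I. a i *\<^sub>C e i) = (\<Sum>i\<in>I. cnj (a i) * b y (e i))"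
    if "y \<in> E" "I \<subseteq> ?I" for I a y
    using finite_subset[OF that(2) fin] that(2)
  proof (induction I rule: finite_induct)
    case (insert i I)
    then show ?case
      using b_add(2)[of "a i *\<^sub>C e i" "\<Sum>i\<in>I. a i *\<^sub>C e i" y] b_scale(2)[of "e i" y] that(1) e sumE[of I a]
        csubspace_scale[OF E]
      by simp
  qed (use that zero in simp)
  have form: "b (\<Sum>i\<in>?I. a i *\<^sub>C e i) (\<Sum>i\<in>?I. a' i *\<^sub>C e i) = (\<Sum>i\<in>?I. \<Sum>l\<in>?I. a i * cnj (a' l) * b (e i) (e l))" for a a'
    by (simp add: left[OF sumE] right e sum_distrib_left mult.assoc)
  have S_sum: "S (\<Sum>i\<in>I. a i *\<^sub>C e i) = (\<Sum>i\<in>I. a i *\<^sub>C S (e i))" if "I \<subseteq> ?I" for a I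
    using finite_subset[OF that fin] that
  proof (induction I rule: finite_induct)
    case empty
    then show ?case using S_scale[of 0 0] csubspace_0[OF E] by simp
  next
    case (insert i I)
    then show ?case
      using S_add[of "a i *\<^sub>C e i" "\<Sum>i\<in>I. a i *\<^sub>C e i"] S_scale[of "e i"] e sumE[of I a] csubspace_scale[OF E]
      by simp
  qed
  have S: "S (\<Sum>i\<in>?I. a i *\<^sub>C e i) = (\<Sum>i\<in>?I. chain_map w \<nu> n a i *\<^sub>C e i)" for a
    unfolding S_sum[OF order_refl] using chain F by (intro chain_map_image) auto
  have "0 \<le> Re (\<Sum>i\<in>?I. \<Sum>l\<in>?I. a i * cnj (a l) * b (e i) (e l))"
  proof (rule lyapunov_matrix)
    show "0 < Re (w j)" if "j \<in> F" for j
      using w that F(2) by auto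
    show "0 \<le> Re ((\<Sum>i\<in>?I. \<Sum>l\<in>?I. chain_map w \<nu> n a i * cnj (a l) * b (e i) (e l))
        + (\<Sum>i\<in>?I. \<Sum>l\<in>?I. a i * cnj (chain_map w \<nu> n a l) * b (e i) (e l)))" for a
      using increasing[OF sumE[OF order_refl, of a]] unfolding S form .
  qed
  then show ?thesis
    by (simp add: xa form)
qed


section \<open>Root subspaces\<close>

lemma shift_op_simps [simp]: "opdom (shift_op T z) = opdom T" "opapp (shift_op T z) x = opapp T x - z *\<^sub>C x"
  by (simp_all add: shift_op_def)

text \<open>\<open>power_op\<close> adds the new factor on the outside; root vectors need the
  innermost factor peeled off, with the domains tracked.\<close>

lemma power_op_Suc_shift:
  "x \<in> opdom (power_op T (Suc k)) \<longleftrightarrow> x \<in> opdom T \<and> opapp T x \<in> opdom (power_op T k)"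
  "opapp (power_op T (Suc k)) x = opapp (power_op T k) (opapp T x)"
proof (induction k arbitrary: x)
  case (Suc k)
  { case 1
    show ?case
      using Suc.IH[of x] by (auto simp: comp_op_def simp del: power_op.simps(2) simp: power_op.simps(2)[of T "Suc k"] power_op.simps(2)[of T k]) }
  { case 2
    show ?case
      using Suc.IH(2)[of x] by (simp add: comp_op_def) }
qed (simp_all add: comp_op_def)

lemma kernel_power_op_0: "kernel (power_op T 0) = {0}"
  by (auto simp: kernel_def)

lemma kernel_power_op_Suc:
  "x \<in> kernel (power_op T (Suc k)) \<longleftrightarrow> x \<in> opdom T \<and> opapp T x \<in> kernel (power_op T k)"
  unfolding kernel_def mem_Collect_eq power_op_Suc_shift by blast

text \<open>Induction on a power of \<open>T - z\<close> that kills \<open>x\<close>, with the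
  exponent hidden: a property passes from \<open>(T - z) x\<close> to \<open>x\<close>.\<close>

lemma root_subspace_induct [consumes 1, case_names zero step]:
  assumes "x \<in> root_subspace T z"
    and "P 0"
    and "\<And>x. x \<in> opdom T \<Longrightarrow> opapp T x - z *\<^sub>C x \<in> root_subspace T z \<Longrightarrow>
      P (opapp T x - z *\<^sub>C x) \<Longrightarrow> P x"
  shows "P x"
proof -
  obtain k where "x \<in> kernel (power_op (shift_op T z) k)"
    using assms(1) by (auto simp: root_subspace_def)
  then show ?thesis
  proof (induction k arbitrary: x)
    case 0
    then show ?case using assms(2) by (simp add: kernel_power_op_0 del: power_op.simps)
  next
    case (Suc k)
    then have "x \<in> opdom T" "opapp T x - z *\<^sub>C x \<in> kernel (power_op (shift_op T z) k)"
      by (simp_all add: kernel_power_op_Suc del: power_op.simps)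
    then show ?case
      using assms(3) Suc.IH by (auto simp: root_subspace_def)
  qed
qed

lemma root_subspace_0: "0 \<in> root_subspace T z"
  unfolding root_subspace_def using kernel_power_op_0 by blast

lemma root_subspaceI:
  assumes "x \<in> opdom T" "opapp T x - z *\<^sub>C x \<in> root_subspace T z"
  shows "x \<in> root_subspace T z"
proof -
  obtain k where "opapp T x - z *\<^sub>C x \<in> kernel (power_op (shift_op T z) k)"
    using assms(2) by (auto simp: root_subspace_def)
  then have "x \<in> kernel (power_op (shift_op T z) (Suc k))"
    using assms(1) by (simp add: kernel_power_op_Suc del: power_op.simps)
  then show ?thesis
    by (auto simp: root_subspace_def simp del: power_op.simps)
qed

lemma linear_operator_add:
    "linear_operator T \<Longrightarrow> x \<in> opdom T \<Longrightarrow> y \<in> opdom T \<Longrightarrow> opapp T (x + y) = opapp T x + opapp T y"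
  and linear_operator_scale: "linear_operator T \<Longrightarrow> x \<in> opdom T \<Longrightarrow> opapp T (c *\<^sub>C x) = c *\<^sub>C opapp T x"
  and linear_operator_csubspace: "linear_operator T \<Longrightarrow> csubspace (opdom T)"
  by (auto simp: linear_operator_def)

lemma linear_operator_0: "linear_operator T \<Longrightarrow> opapp T 0 = 0"
  using linear_operator_scale[of T 0 0] linear_operator_csubspace[of T] csubspace_0 by fastforce

lemma linear_operator_diff:
  assumes "linear_operator T" "x \<in> opdom T" "y \<in> opdom T"
  shows "opapp T (x - y) = opapp T x - opapp T y"
proof -
  have "x - y \<in> opdom T"
    using assms linear_operator_csubspace csubspace_diff by blast
  then have "opapp T (x - y + y) = opapp T (x - y) + opapp T y"
    using assms by (intro linear_operator_add)
  then show ?thesis by simp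
qed

lemma root_subspace_opdom: "linear_operator T \<Longrightarrow> x \<in> root_subspace T z \<Longrightarrow> x \<in> opdom T"
  by (erule root_subspace_induct) (auto intro: csubspace_0 linear_operator_csubspace)

lemma root_subspace_shift:
  assumes "linear_operator T" "x \<in> root_subspace T z"
  shows "opapp T x - z *\<^sub>C x \<in> root_subspace T z"
  using assms(2) by (cases rule: root_subspace_induct)
    (simp_all add: linear_operator_0[OF assms(1)] root_subspace_0)

text \<open>For sums, the induction runs over \<open>x\<close> with \<open>y\<close> arbitrary: both
  are replaced by their images under \<open>T - z\<close>, so no common exponent has to be
  chosen.\<close>

lemma csubspace_root_subspace:
  assumes "linear_operator T"
  shows "csubspace (root_subspace T z)"
proof (rule csubspaceI)
  note sub = linear_operator_csubspace[OF assms]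
  show "x + y \<in> root_subspace T z" if "x \<in> root_subspace T z" "y \<in> root_subspace T z" for x y
    using that
  proof (induction x arbitrary: y rule: root_subspace_induct)
    case (step x)
    have y: "y \<in> opdom T"
      using root_subspace_opdom[OF assms] step by blast
    have "(opapp T x - z *\<^sub>C x) + (opapp T y - z *\<^sub>C y) \<in> root_subspace T z"
      using step root_subspace_shift[OF assms] by blast
    also have "(opapp T x - z *\<^sub>C x) + (opapp T y - z *\<^sub>C y) = opapp T (x + y) - z *\<^sub>C (x + y)"
      using linear_operator_add[OF assms step.hyps(1) y] by (simp add: scaleC_add_right)
    finally show ?case
      by (rule root_subspaceI[OF csubspace_add[OF sub step.hyps(1) y]])
  qed simp
  show "c *\<^sub>C x \<in> root_subspace T z" if "x \<in> root_subspace T z" for c x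
    using that
  proof (induction x rule: root_subspace_induct)
    case (step x)
    have "opapp T (c *\<^sub>C x) - z *\<^sub>C c *\<^sub>C x = c *\<^sub>C (opapp T x - z *\<^sub>C x)"
      using step.hyps(1) assms
      by (simp add: linear_operator_scale scaleC_diff_right scaleC_scaleC mult.commute)
    with step.IH have "opapp T (c *\<^sub>C x) - z *\<^sub>C c *\<^sub>C x \<in> root_subspace T z"
      by simp
    then show ?case
      by (rule root_subspaceI[OF csubspace_scale[OF sub step.hyps(1)]])
  qed (simp add: root_subspace_0)
qed (rule root_subspace_0)

lemma root_subspace_eigenvalue:
  assumes "linear_operator T" "x \<in> root_subspace T z" "x \<noteq> 0"
  shows "z \<in> eigenvalues T"
proof (rule ccontr)
  assume "z \<notin> eigenvalues T"
  then have *: "y = 0" if "y \<in> opdom T" "opapp T y - z *\<^sub>C y = 0" for y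
    using that by (auto simp: eigenvalues_def kernel_def)
  have "x = 0"
    using assms(2) by (induction rule: root_subspace_induct) (use * in auto)
  with assms(3) show False by simp
qed

lemma spectral_subspace_compatible:
  assumes "linear_operator T"
  shows "compatible T (spectral_subspace T \<Omega>)"
proof -
  define V where "V z = (if z \<in> \<Omega> then root_subspace T z else {0})" for z
  have "csubspace (V z)" "V z \<subseteq> root_subspace T z" for z
    using csubspace_root_subspace[OF assms] root_subspace_0
    by (auto simp: V_def intro!: csubspaceI)
  moreover have "cspan (\<Union>z\<in>eigenvalues T. V z) = cspan (\<Union>z\<in>eigenvalues T \<inter> \<Omega>. root_subspace T z)"
  proof (rule subset_antisym)
    have "(\<Union>z\<in>eigenvalues T. V z) \<subseteq> cspan (\<Union>z\<in>eigenvalues T \<inter> \<Omega>. root_subspace T z)"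
      by (auto simp: V_def complex_vector.span_zero intro: complex_vector.span_base split: if_splits)
    then show "cspan (\<Union>z\<in>eigenvalues T. V z) \<subseteq> cspan (\<Union>z\<in>eigenvalues T \<inter> \<Omega>. root_subspace T z)"
      by (intro complex_vector.span_minimal csubspace_cspan)
    show "cspan (\<Union>z\<in>eigenvalues T \<inter> \<Omega>. root_subspace T z) \<subseteq> cspan (\<Union>z\<in>eigenvalues T. V z)"
      by (intro complex_vector.span_mono) (auto simp: V_def)
  qed
  ultimately show ?thesis
    unfolding compatible_def spectral_subspace_def by (metis (no_types))
qed


section \<open>Hamiltonian operator matrices\<close>

lemma adjoint_op_eq:
  assumes "densely_defined A" "v \<in> opdom (adjoint_op A)" "u \<in> opdom A"
  shows "cinner (opapp A u) v = cinner u (opapp (adjoint_op A) v)"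
proof -
  obtain w where w: "\<forall>u\<in>opdom A. cinner (opapp A u) v = cinner u w"
    using assms(2) by (auto simp: adjoint_op_def)
  have "(THE w. \<forall>u\<in>opdom A. cinner (opapp A u) v = cinner u w) = w"
    using w dense_cinner_unique[of "opdom A"] assms(1)
    by (intro the_equality) (auto simp: densely_defined_def)
  then show ?thesis
    using w assms(3) by (simp add: adjoint_op_def)
qed

lemma adjoint_opI:
  assumes "densely_defined A" "\<And>u. u \<in> opdom A \<Longrightarrow> cinner (opapp A u) v = cinner u w"
  shows "v \<in> opdom (adjoint_op A)" "opapp (adjoint_op A) v = w"
proof -
  show v: "v \<in> opdom (adjoint_op A)"
    using assms(2) by (auto simp: adjoint_op_def)
  show "opapp (adjoint_op A) v = w"
    using assms adjoint_op_eq[OF assms(1) v] dense_cinner_unique[of "opdom A"]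
    by (metis densely_defined_def)
qed

lemma linear_operator_adjoint_op:
  assumes "densely_defined A"
  shows "linear_operator (adjoint_op A)"
proof -
  note eq = adjoint_op_eq[OF assms] and I = adjoint_opI[OF assms]
  have add: "x + y \<in> opdom (adjoint_op A)"
      "opapp (adjoint_op A) (x + y) = opapp (adjoint_op A) x + opapp (adjoint_op A) y"
    if "x \<in> opdom (adjoint_op A)" "y \<in> opdom (adjoint_op A)" for x y
  proof -
    have *: "cinner (opapp A u) (x + y) = cinner u (opapp (adjoint_op A) x + opapp (adjoint_op A) y)"
      if "u \<in> opdom A" for u
      using eq[OF \<open>x \<in> _\<close> that] eq[OF \<open>y \<in> _\<close> that] by (simp add: cinner_add_right)
    show "x + y \<in> opdom (adjoint_op A)"
      "opapp (adjoint_op A) (x + y) = opapp (adjoint_op A) x + opapp (adjoint_op A) y"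
      using I[OF *] by blast+
  qed
  have scale: "c *\<^sub>C x \<in> opdom (adjoint_op A)"
      "opapp (adjoint_op A) (c *\<^sub>C x) = c *\<^sub>C opapp (adjoint_op A) x"
    if "x \<in> opdom (adjoint_op A)" for c x
  proof -
    have *: "cinner (opapp A u) (c *\<^sub>C x) = cinner u (c *\<^sub>C opapp (adjoint_op A) x)"
      if "u \<in> opdom A" for u
      using eq[OF \<open>x \<in> _\<close> that] by (simp add: cinner_scaleC_right)
    show "c *\<^sub>C x \<in> opdom (adjoint_op A)"
      "opapp (adjoint_op A) (c *\<^sub>C x) = c *\<^sub>C opapp (adjoint_op A) x"
      using I[OF *] by blast+
  qed
  have "0 \<in> opdom (adjoint_op A)"
    by (rule I(1)[of _ 0]) simp
  then show ?thesis
    unfolding linear_operator_def using add scale by (auto intro: csubspaceI)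
qed

locale hamiltonian =
  fixes A B C :: "'a::complex_hilbert operator" and \<gamma> a b :: real
  assumes A_linear: "linear_operator A" and A_dense: "densely_defined A"
    and B_symmetric: "symmetric_operator B" and C_symmetric: "symmetric_operator C"
    and \<gamma>_pos: "\<gamma> > 0"
    and B_positive: "\<And>v. v \<in> opdom B \<Longrightarrow> \<gamma> * (norm v)\<^sup>2 \<le> Re (cinner (opapp B v) v)"
    and C_positive: "\<And>v. v \<in> opdom C \<Longrightarrow> \<gamma> * (norm v)\<^sup>2 \<le> Re (cinner (opapp C v) v)"
    and A_C: "opdom A \<subseteq> opdom C" and A'_B: "opdom (adjoint_op A) \<subseteq> opdom B"
    and ab: "0 \<le> a" "0 \<le> b"
    and C_bound: "\<And>u. u \<in> opdom A \<Longrightarrow> norm (opapp C u) \<le> a * norm u + b * norm (opapp A u)"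
    and B_bound: "\<And>v. v \<in> opdom (adjoint_op A) \<Longrightarrow>
      norm (opapp B v) \<le> a * norm v + b * norm (opapp (adjoint_op A) v)"
begin

abbreviation "A' \<equiv> adjoint_op A"
abbreviation "T \<equiv> hamiltonian_matrix A B C"

lemmas A'_eq = adjoint_op_eq[OF A_dense]
lemmas A'_linear = linear_operator_adjoint_op[OF A_dense]

lemma BC_linear: "linear_operator B" "linear_operator C"
  using B_symmetric C_symmetric by (auto simp: symmetric_operator_def)

lemma B_sym: "u \<in> opdom B \<Longrightarrow> v \<in> opdom B \<Longrightarrow> cinner (opapp B u) v = cinner u (opapp B v)"
  and C_sym: "u \<in> opdom C \<Longrightarrow> v \<in> opdom C \<Longrightarrow> cinner (opapp C u) v = cinner u (opapp C v)"
  using B_symmetric C_symmetric by (auto simp: symmetric_operator_def)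

lemma opdom_T: "opdom T = opdom A \<times> opdom A'"
  using A_C A'_B by (auto simp: hamiltonian_matrix_def)

lemma mem_opdom_T: "x \<in> opdom T \<longleftrightarrow> fst x \<in> opdom A \<and> snd x \<in> opdom A'"
  by (cases x) (simp add: opdom_T)

lemma opapp_T: "opapp T x =
    (opapp A (fst x) + opapp B (snd x), opapp C (fst x) - opapp A' (snd x))"
  by (simp add: hamiltonian_matrix_def case_prod_beta)

lemma memB: "v \<in> opdom A' \<Longrightarrow> v \<in> opdom B" and memC: "u \<in> opdom A \<Longrightarrow> u \<in> opdom C"
  using A_C A'_B by auto

lemma T_linear: "linear_operator T"
  unfolding linear_operator_def
proof (intro conjI ballI allI)
  note lin = A_linear A'_linear BC_linear
  note sub = lin[THEN linear_operator_csubspace]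
  show "csubspace (opdom T)"
    using sub by (intro csubspaceI) (auto simp: mem_opdom_T csubspace_0 csubspace_add csubspace_scale)
  show "opapp T (x + y) = opapp T x + opapp T y" if "x \<in> opdom T" "y \<in> opdom T" for x y
    using that lin by (simp add: opapp_T mem_opdom_T linear_operator_add memB memC)
  show "opapp T (c *\<^sub>C x) = c *\<^sub>C opapp T x" if "x \<in> opdom T" for c x
    using that lin
    by (simp add: opapp_T mem_opdom_T linear_operator_scale memB memC scaleC_Pair scaleC_add_right
        scaleC_diff_right)
qed

lemma T_skew:
  assumes "x \<in> opdom T" "y \<in> opdom T"
  shows "symplectic (opapp T x) y = - symplectic x (opapp T y)"
proof -
  have "cinner (opapp A' (snd x)) (fst y) = cinner (snd x) (opapp A (fst y))"
    using assms A'_eq by (metis cinner_commute mem_opdom_T)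
  then show ?thesis
    using assms by (simp add: symplectic_def opapp_T cinner_algebra mem_opdom_T A'_eq memB memC
        B_sym[symmetric] C_sym[symmetric])
qed

text \<open>The contributions of \<open>A\<close> and of its adjoint cancel, which leaves
  \<open>(B v | v) + (C u | u)\<close>. The right-hand side is the time derivative of
  \<open>hyperbolic\<close> along an orbit of \<open>T\<close>.\<close>

lemma T_accretive:
  assumes "x \<in> opdom T"
  shows "\<gamma> * (norm x)\<^sup>2 \<le> Re (cinner (fst (opapp T x)) (snd x) + cinner (fst x) (snd (opapp T x)))"
proof -
  have dom: "fst x \<in> opdom A" "snd x \<in> opdom A'"
    using assms by (simp_all add: mem_opdom_T)
  have "Re (cinner (fst (opapp T x)) (snd x) + cinner (fst x) (snd (opapp T x)))
      = Re (cinner (opapp B (snd x)) (snd x)) + Re (cinner (opapp C (fst x)) (fst x))"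
    using dom Re_cinner_commute[of "fst x" "opapp C (fst x)"]
    by (simp add: opapp_T cinner_algebra A'_eq)
  moreover have "\<gamma> * (norm x)\<^sup>2 = \<gamma> * (norm (fst x))\<^sup>2 + \<gamma> * (norm (snd x))\<^sup>2"
    by (simp add: norm_prod_def distrib_left)
  ultimately show ?thesis
    using B_positive[OF memB[OF dom(2)]] C_positive[OF memC[OF dom(1)]] by linarith
qed

text \<open>At an eigenvector the right-hand side of \<open>T_accretive\<close> is
  \<open>2 Re z\<close> times \<open>hyperbolic x\<close>, while the left-hand side is
  positive.\<close>

lemma eigenvalue_Re_nonzero:
  assumes "z \<in> eigenvalues T"
  shows "Re z \<noteq> 0"
proof
  assume "Re z = 0"
  obtain x where x: "x \<noteq> 0" "x \<in> opdom T" "opapp T x = z *\<^sub>C x"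
    using assms by (auto simp: eigenvalues_def kernel_def)
  have "Re (z * cinner (fst x) (snd x) + cnj z * cinner (fst x) (snd x)) = 2 * Re z * Re (cinner (fst x) (snd x))"
    by simp
  then have "\<gamma> * (norm x)\<^sup>2 \<le> 0"
    using T_accretive[OF x(2)] \<open>Re z = 0\<close> by (simp add: x(3) cinner_algebra)
  then show False
    using \<gamma>_pos x(1) by (simp add: mult_le_0_iff)
qed

text \<open>For eigenvectors, \<open>T_skew\<close> gives
  \<open>(\<zeta> + cnj \<mu>) * symplectic x y = 0\<close>. The nested inductions reduce root
  vectors to this, because the terms with \<open>(T - \<zeta>) x\<close> and
  \<open>(T - \<mu>) y\<close> vanish by hypothesis. The excluded pairs are mirror images in the
  imaginary axis.\<close>

lemma root_subspaces_symplectic: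
  assumes "x \<in> root_subspace T \<zeta>" "y \<in> root_subspace T \<mu>" and "\<zeta> + cnj \<mu> \<noteq> 0"
  shows "symplectic x y = 0"
proof -
  have "\<forall>y\<in>root_subspace T \<mu>. symplectic x y = 0"
    using assms(1)
  proof (induction rule: root_subspace_induct)
    case (step x)
    show ?case
    proof
      fix y assume "y \<in> root_subspace T \<mu>"
      then show "symplectic x y = 0"
      proof (induction rule: root_subspace_induct)
        case (step y)
        have "y \<in> root_subspace T \<mu>"
          using step.hyps by (rule root_subspaceI)
        then have "symplectic (opapp T x) y = \<zeta> * symplectic x y"
          using \<open>\<forall>y\<in>root_subspace T \<mu>. symplectic (opapp T x - \<zeta> *\<^sub>C x) y = 0\<close>
          by (simp add: symplectic_diff_left symplectic_scaleC_left)
        moreover have "symplectic x (opapp T y) = cnj \<mu> * symplectic x y"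
          using step.IH by (simp add: symplectic_diff_right symplectic_scaleC_right)
        ultimately have "(\<zeta> + cnj \<mu>) * symplectic x y = 0"
          using T_skew[OF \<open>x \<in> opdom T\<close> step.hyps(1)] by (metis add.left_inverse distrib_right)
        then show ?case using assms(3) by simp
      qed simp
    qed
  qed simp
  then show ?thesis using assms(2) by blast
qed

section \<open>Resolvents of \<open>G\<close> and \<open>T\<close>, and the domains of invariant
  graphs\<close>

abbreviation "G \<equiv> diagonal_part A"
abbreviation "S \<equiv> offdiagonal_part B C"

lemma opdom_G: "opdom G = opdom T"
  by (simp add: diagonal_part_def opdom_T)

lemma opapp_G: "opapp G x = (opapp A (fst x), - opapp A' (snd x))"
  by (simp add: diagonal_part_def case_prod_beta)

lemma opapp_S: "opapp S x = (opapp B (snd x), opapp C (fst x))"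
  by (simp add: offdiagonal_part_def case_prod_beta)

lemma T_eq_G_plus_S: "opapp T x = opapp G x + opapp S x"
  by (simp add: opapp_T opapp_G opapp_S)

lemma G_linear: "linear_operator G"
  unfolding linear_operator_def opdom_G
  using T_linear linear_operator_add[OF A_linear] linear_operator_add[OF A'_linear]
    linear_operator_scale[OF A_linear] linear_operator_scale[OF A'_linear]
  by (auto simp: linear_operator_def opapp_G mem_opdom_T scaleC_Pair)

lemma S_add: "x \<in> opdom T \<Longrightarrow> y \<in> opdom T \<Longrightarrow> opapp S (x + y) = opapp S x + opapp S y"
  and S_scale: "x \<in> opdom T \<Longrightarrow> opapp S (c *\<^sub>C x) = c *\<^sub>C opapp S x"
  and S_diff: "x \<in> opdom T \<Longrightarrow> y \<in> opdom T \<Longrightarrow> opapp S (x - y) = opapp S x - opapp S y"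
  using BC_linear
  by (simp_all add: opapp_S mem_opdom_T linear_operator_add linear_operator_scale
      linear_operator_diff scaleC_Pair memB memC)

lemma S_bound:
  assumes "x \<in> opdom T"
  shows "norm (opapp S x) \<le> 2 * a * norm x + 2 * b * norm (opapp G x)"
proof -
  have dom: "fst x \<in> opdom A" "snd x \<in> opdom A'"
    using assms by (simp_all add: mem_opdom_T)
  have "norm (opapp S x) \<le> norm (opapp B (snd x)) + norm (opapp C (fst x))"
    by (simp add: opapp_S norm_Pair_le)
  also have "\<dots> \<le> (a * norm (snd x) + b * norm (opapp A' (snd x))) + (a * norm (fst x) + b * norm (opapp A (fst x)))"
    by (intro add_mono B_bound C_bound dom)
  also have "\<dots> \<le> (a * norm x + b * norm (opapp G x)) + (a * norm x + b * norm (opapp G x))"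
    using norm_fst_le_norm[of "opapp G x"] norm_snd_le_norm[of "opapp G x"] ab
    by (intro add_mono mult_left_mono norm_fst_le_norm norm_snd_le_norm) (auto simp: opapp_G)
  finally show ?thesis by simp
qed

text \<open>\<open>Q = (G - z)\<^sup>-\<^sup>1\<close>, with \<open>\<parallel>S Q\<parallel> \<le> \<epsilon>\<close>.\<close>

definition diagonal_resolvent :: "real \<Rightarrow> complex \<Rightarrow> ('a \<times> 'a \<Rightarrow> 'a \<times> 'a) \<Rightarrow> bool" where
  "diagonal_resolvent \<epsilon> z Q \<longleftrightarrow> bounded_clinear Q \<and>
    (\<forall>\<xi>. Q \<xi> \<in> opdom T \<and> opapp G (Q \<xi>) - z *\<^sub>C Q \<xi> = \<xi>) \<and>
    (\<forall>x\<in>opdom T. Q (opapp G x - z *\<^sub>C x) = x) \<and>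
    (\<forall>x\<in>opdom T. norm (opapp S x) \<le> \<epsilon> * norm (opapp G x - z *\<^sub>C x))"

lemma diagonal_resolvent_exists:
  assumes r0: "r0_diagonally_dominant A B C" and "\<epsilon> > 0"
  obtains z Q where "diagonal_resolvent \<epsilon> z Q"
proof -
  obtain zs where zs: "\<And>k. zs k \<in> resolvent_set G"
      "(\<lambda>k. onorm (opapp (comp_op S (resolvent G (zs k))))) \<longlonglongrightarrow> 0"
    using r0 by (auto simp: r0_diagonally_dominant_def)
  have "\<forall>\<^sub>F k in sequentially. onorm (opapp (comp_op S (resolvent G (zs k)))) < \<epsilon>"
    using order_tendstoD(2)[OF zs(2)] \<open>\<epsilon> > 0\<close> by blast
  then obtain k where k: "onorm (opapp (comp_op S (resolvent G (zs k)))) < \<epsilon>"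
    by (meson eventually_sequentially order_refl)
  define z where "z = zs k"
  define Q where "Q = opapp (resolvent G z)"
  have inv: "boundedly_invertible (shift_op G z)"
    using zs(1)[of k] by (simp add: resolvent_set_def z_def)
  then have bij: "bij_betw (\<lambda>x. opapp G x - z *\<^sub>C x) (opdom T) UNIV"
    by (simp add: boundedly_invertible_def opdom_G bij_betw_def inj_on_def image_def)
  have Q: "bounded_clinear Q"
    using inv by (simp add: boundedly_invertible_def bounded_operator_def Q_def resolvent_def)
  have Q_inv: "Q = inv_into (opdom T) (\<lambda>x. opapp G x - z *\<^sub>C x)"
    by (simp add: Q_def resolvent_def inverse_op_def opdom_G shift_op_def)
  have right: "Q \<xi> \<in> opdom T" "opapp G (Q \<xi>) - z *\<^sub>C Q \<xi> = \<xi>" for \<xi>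
  proof -
    have "\<xi> \<in> (\<lambda>x. opapp G x - z *\<^sub>C x) ` opdom T"
      using bij by (simp add: bij_betw_def)
    then show "Q \<xi> \<in> opdom T" "opapp G (Q \<xi>) - z *\<^sub>C Q \<xi> = \<xi>"
      unfolding Q_inv by (rule inv_into_into, rule f_inv_into_f)
  qed
  have left: "Q (opapp G x - z *\<^sub>C x) = x" if "x \<in> opdom T" for x
    using inv_into_f_f[OF bij_betw_imp_inj_on[OF bij] that] by (simp add: Q_inv)
  have SQ: "opapp (comp_op S (resolvent G z)) = (\<lambda>\<xi>. opapp S (Q \<xi>))"
    by (simp add: comp_op_def Q_def comp_def)
  obtain M where M: "M > 0" "\<And>\<xi>. norm (Q \<xi>) \<le> M * norm \<xi>"
    using bounded_clinear_bound[OF Q] by blast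
  \<comment> \<open>\<open>onorm\<close> controls the values of a map only if that map is bounded,
    so relative boundedness has to come in before the smallness of \<open>onorm\<close> can be
    used.\<close>
  have "bounded_linear (\<lambda>\<xi>. opapp S (Q \<xi>))"
  proof (rule bounded_linear_intro)
    show "opapp S (Q (x + y)) = opapp S (Q x) + opapp S (Q y)" for x y
      by (simp add: bounded_clinear_add[OF Q] S_add right)
    show "opapp S (Q (r *\<^sub>R x)) = r *\<^sub>R opapp S (Q x)" for r x
      by (simp add: scaleR_scaleC bounded_clinear_scaleC[OF Q] S_scale right)
    show "norm (opapp S (Q \<xi>)) \<le> norm \<xi> * (2 * a * M + 2 * b * (1 + cmod z * M))" for \<xi>
    proof -
      have "opapp G (Q \<xi>) = \<xi> + z *\<^sub>C Q \<xi>"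
        using right(2)[of \<xi>] by (simp add: algebra_simps)
      then have "norm (opapp G (Q \<xi>)) \<le> norm \<xi> + cmod z * norm (Q \<xi>)"
        by (metis norm_scaleC norm_triangle_ineq)
      also have "\<dots> \<le> norm \<xi> + cmod z * (M * norm \<xi>)"
        by (intro add_left_mono mult_left_mono M(2)) simp
      finally have "2 * b * norm (opapp G (Q \<xi>)) \<le> 2 * b * (norm \<xi> + cmod z * (M * norm \<xi>))"
        using ab by (intro mult_left_mono) auto
      moreover have "2 * a * norm (Q \<xi>) \<le> 2 * a * (M * norm \<xi>)"
        using ab by (intro mult_left_mono M(2)) auto
      ultimately have "norm (opapp S (Q \<xi>)) \<le> 2 * a * (M * norm \<xi>) + 2 * b * (norm \<xi> + cmod z * (M * norm \<xi>))"
        using S_bound[OF right(1), of \<xi>] by linarith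
      then show ?thesis
        by (simp add: algebra_simps)
    qed
  qed
  then have SQ_bound: "norm (opapp S (Q \<xi>)) \<le> \<epsilon> * norm \<xi>" for \<xi>
  proof -
    have "norm (opapp S (Q \<xi>)) \<le> onorm (\<lambda>\<xi>. opapp S (Q \<xi>)) * norm \<xi>"
      by (rule onorm) fact
    also have "\<dots> \<le> \<epsilon> * norm \<xi>"
      using k by (intro mult_right_mono) (auto simp: SQ simp flip: z_def)
    finally show ?thesis .
  qed
  have "diagonal_resolvent \<epsilon> z Q"
    unfolding diagonal_resolvent_def
    using Q right left SQ_bound by (metis (no_types, lifting))
  then show thesis by (rule that)
qed

text \<open>\<open>R = (T - z)\<^sup>-\<^sup>1\<close>, close to the resolvent of \<open>G\<close> in the sense that \<open>\<parallel>I - (G - z) R\<parallel> \<le> \<epsilon>\<close>.\<close>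

definition hamiltonian_resolvent :: "real \<Rightarrow> complex \<Rightarrow> ('a \<times> 'a \<Rightarrow> 'a \<times> 'a) \<Rightarrow> bool" where
  "hamiltonian_resolvent \<epsilon> z R \<longleftrightarrow> bounded_clinear R \<and>
    (\<forall>\<xi>. R \<xi> \<in> opdom T \<and> opapp T (R \<xi>) - z *\<^sub>C R \<xi> = \<xi>) \<and>
    (\<forall>x\<in>opdom T. R (opapp T x - z *\<^sub>C x) = x) \<and>
    (\<forall>\<xi>. norm (\<xi> - (opapp G (R \<xi>) - z *\<^sub>C R \<xi>)) \<le> \<epsilon> * norm \<xi>)"

text \<open>\<open>T - z = (I + S Q) (G - z)\<close> with \<open>S Q\<close> a contraction. For
  \<open>\<epsilon> \<le> 1/2\<close> the norm of \<open>(G - z) x\<close> is at most twice that of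
  \<open>(T - z) x\<close>; this is the factor 2 in the conclusion.\<close>

lemma hamiltonian_resolvent_exists:
  assumes Q: "diagonal_resolvent \<epsilon> z Q" and \<epsilon>: "0 < \<epsilon>" "\<epsilon> \<le> 1/2"
  obtains R where "hamiltonian_resolvent (2 * \<epsilon>) z R"
proof -
  have Qb: "bounded_clinear Q" and QT: "\<And>\<xi>. Q \<xi> \<in> opdom T" and GQ: "\<And>\<xi>. opapp G (Q \<xi>) - z *\<^sub>C Q \<xi> = \<xi>"
    and QG: "\<And>x. x \<in> opdom T \<Longrightarrow> Q (opapp G x - z *\<^sub>C x) = x"
    and S: "\<And>x. x \<in> opdom T \<Longrightarrow> norm (opapp S x) \<le> \<epsilon> * norm (opapp G x - z *\<^sub>C x)"
    using Q by (auto simp: diagonal_resolvent_def)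
  obtain M where M: "M > 0" "\<And>\<xi>. norm (Q \<xi>) \<le> M * norm \<xi>"
    using bounded_clinear_bound[OF Qb] by blast
  have split: "opapp T x - z *\<^sub>C x = (opapp G x - z *\<^sub>C x) + opapp S x" for x
    by (simp add: T_eq_G_plus_S)
  have "\<exists>x\<in>opdom T. opapp T x - z *\<^sub>C x = \<xi>" for \<xi>
  proof -
    have "norm (opapp S (Q x) - opapp S (Q y)) \<le> \<epsilon> * norm (x - y)" for x y
      using S[OF QT, of "x - y"] unfolding GQ by (simp add: bounded_clinear_diff[OF Qb] S_diff QT)
    then obtain y where "y + opapp S (Q y) = \<xi>"
      using id_plus_contraction_surj[of "\<lambda>y. opapp S (Q y)" \<epsilon> \<xi>] \<epsilon> by auto
    then have "opapp T (Q y) - z *\<^sub>C Q y = \<xi>"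
      by (simp only: split GQ)
    then show ?thesis using QT by blast
  qed
  then obtain R where R: "\<And>\<xi>. R \<xi> \<in> opdom T" "\<And>\<xi>. opapp T (R \<xi>) - z *\<^sub>C R \<xi> = \<xi>"
    by metis
  have G_le: "norm (opapp G x - z *\<^sub>C x) \<le> 2 * norm (opapp T x - z *\<^sub>C x)" if "x \<in> opdom T" for x
  proof -
    have "norm (opapp G x - z *\<^sub>C x) \<le> norm (opapp T x - z *\<^sub>C x) + norm (opapp S x)"
      unfolding split by (metis add_diff_cancel_right' norm_triangle_ineq4)
    moreover have "\<epsilon> * norm (opapp G x - z *\<^sub>C x) \<le> 1/2 * norm (opapp G x - z *\<^sub>C x)"
      using \<epsilon> by (intro mult_right_mono) auto
    ultimately show ?thesis
      using S[OF that] by linarith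
  qed
  have unique: "x = y" if "x \<in> opdom T" "y \<in> opdom T" "opapp T x - z *\<^sub>C x = opapp T y - z *\<^sub>C y" for x y
  proof -
    have xy: "x - y \<in> opdom T"
      using that T_linear by (intro csubspace_diff linear_operator_csubspace)
    have "opapp T (x - y) - z *\<^sub>C (x - y) = 0"
      using that by (simp add: linear_operator_diff[OF T_linear] scaleC_diff_right algebra_simps)
    then have "opapp G (x - y) - z *\<^sub>C (x - y) = 0"
      using G_le[OF xy] by simp
    then show ?thesis
      using QG[OF xy] bounded_clinear_0[OF Qb] by simp
  qed
  note sub = linear_operator_csubspace[OF T_linear]
  have "bounded_clinear R"
  proof (rule bounded_clinearI)
    show "R (x + y) = R x + R y" for x y
    proof (rule unique)
      have "opapp T (R x + R y) - z *\<^sub>C (R x + R y) = (opapp T (R x) - z *\<^sub>C R x) + (opapp T (R y) - z *\<^sub>C R y)"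
        by (simp add: linear_operator_add[OF T_linear] R(1) scaleC_add_right)
      then show "opapp T (R (x + y)) - z *\<^sub>C R (x + y) = opapp T (R x + R y) - z *\<^sub>C (R x + R y)"
        by (simp add: R(2))
    qed (auto intro: R csubspace_add sub)
    show "R (c *\<^sub>C x) = c *\<^sub>C R x" for c x
    proof (rule unique)
      have "opapp T (c *\<^sub>C R x) - z *\<^sub>C c *\<^sub>C R x = c *\<^sub>C (opapp T (R x) - z *\<^sub>C R x)"
        by (simp add: linear_operator_scale[OF T_linear] R(1) scaleC_diff_right scaleC_scaleC mult.commute)
      then show "opapp T (R (c *\<^sub>C x)) - z *\<^sub>C R (c *\<^sub>C x) = opapp T (c *\<^sub>C R x) - z *\<^sub>C c *\<^sub>C R x"
        by (simp add: R(2))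
    qed (auto intro: R csubspace_scale sub)
    show "norm (R x) \<le> norm x * (2 * M)" for x
    proof -
      have "norm (R x) \<le> M * norm (opapp G (R x) - z *\<^sub>C R x)"
        using M(2) QG[OF R(1)] by metis
      also have "\<dots> \<le> M * (2 * norm x)"
        using G_le[OF R(1), of x] M(1) by (intro mult_left_mono) (auto simp: R(2))
      finally show ?thesis by (simp add: mult_ac)
    qed
  qed
  moreover have "R (opapp T x - z *\<^sub>C x) = x" if "x \<in> opdom T" for x
    by (rule unique[OF R(1) that R(2)])
  moreover have "norm (\<xi> - (opapp G (R \<xi>) - z *\<^sub>C R \<xi>)) \<le> 2 * \<epsilon> * norm \<xi>" for \<xi>
  proof -
    have "\<xi> - (opapp G (R \<xi>) - z *\<^sub>C R \<xi>) = opapp S (R \<xi>)"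
      using R(2)[of \<xi>] split[of "R \<xi>"] by (simp add: algebra_simps)
    then have "norm (\<xi> - (opapp G (R \<xi>) - z *\<^sub>C R \<xi>)) \<le> \<epsilon> * norm (opapp G (R \<xi>) - z *\<^sub>C R \<xi>)"
      using S[OF R(1)] by simp
    also have "\<dots> \<le> \<epsilon> * (2 * norm \<xi>)"
      using G_le[OF R(1), of \<xi>] \<epsilon> by (intro mult_left_mono) (auto simp: R(2))
    finally show ?thesis by simp
  qed
  ultimately have "hamiltonian_resolvent (2 * \<epsilon>) z R"
    unfolding hamiltonian_resolvent_def using R by blast
  then show thesis by (rule that)
qed

text \<open>Applying \<open>R\<close> to
  \<open>(T - z) x = (T - \<zeta>) x + (\<zeta> - z) x\<close> expresses \<open>R x\<close> through
  \<open>x\<close> and \<open>R ((T - \<zeta>) x)\<close>, to which the root induction applies. The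
  argument is algebraic, so it works in spans without closure too.\<close>

lemma resolvent_root_subspace:
  assumes R: "hamiltonian_resolvent \<epsilon> z R" and M: "csubspace M" "invariant_subspace T M"
    and x: "x \<in> root_subspace T \<zeta>" "x \<in> M"
  shows "R x \<in> M"
proof (cases "x = 0")
  case True
  then show ?thesis
    using R csubspace_0[OF M(1)] by (simp add: hamiltonian_resolvent_def bounded_clinear_0)
next
  case False
  have Rb: "bounded_clinear R" and RT: "\<And>x. x \<in> opdom T \<Longrightarrow> R (opapp T x - z *\<^sub>C x) = x"
    using R by (auto simp: hamiltonian_resolvent_def)
  have "\<zeta> \<noteq> z"
  proof
    assume "\<zeta> = z"
    moreover obtain y where "y \<noteq> 0" "y \<in> opdom T" "opapp T y - \<zeta> *\<^sub>C y = 0"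
      using root_subspace_eigenvalue[OF T_linear x(1) False] by (auto simp: eigenvalues_def kernel_def)
    ultimately show False
      using RT[of y] bounded_clinear_0[OF Rb] by simp
  qed
  have "x \<in> M \<longrightarrow> R x \<in> M"
    using x(1)
  proof (induction rule: root_subspace_induct)
    case (step x)
    show ?case
    proof
      assume "x \<in> M"
      then have "opapp T x - \<zeta> *\<^sub>C x \<in> M"
        using M step.hyps(1) by (auto simp: invariant_subspace_def intro!: csubspace_diff csubspace_scale)
      then have *: "R (opapp T x - \<zeta> *\<^sub>C x) \<in> M"
        using step.IH by simp
      have "opapp T x - z *\<^sub>C x = (opapp T x - \<zeta> *\<^sub>C x) + (\<zeta> - z) *\<^sub>C x"
        by (simp add: scaleC_diff_left)
      then have "x = R (opapp T x - \<zeta> *\<^sub>C x) + (\<zeta> - z) *\<^sub>C R x"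
        using RT[OF step.hyps(1)] by (simp only: bounded_clinear_add[OF Rb] bounded_clinear_scaleC[OF Rb])
      then have "(1 / (\<zeta> - z)) *\<^sub>C (x - R (opapp T x - \<zeta> *\<^sub>C x)) = (1 / (\<zeta> - z)) *\<^sub>C (\<zeta> - z) *\<^sub>C R x"
        by (metis add_diff_cancel_left')
      also have "\<dots> = R x"
        using \<open>\<zeta> \<noteq> z\<close> by (simp add: scaleC_scaleC)
      finally show "R x \<in> M"
        using * \<open>x \<in> M\<close> M(1) by (metis csubspace_diff csubspace_scale)
    qed
  qed (use bounded_clinear_0[OF Rb] csubspace_0[OF M(1)] in simp)
  then show ?thesis using x(2) by simp
qed

lemma resolvent_compatible:
  assumes R: "hamiltonian_resolvent \<epsilon> z R" and U: "compatible T U" "invariant_subspace T U"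
    and x: "x \<in> U"
  shows "R x \<in> U"
proof -
  obtain V where V: "\<And>z. z \<in> eigenvalues T \<Longrightarrow> V z \<subseteq> root_subspace T z"
    "U = closure (cspan (\<Union>z\<in>eigenvalues T. V z))"
    using U(1) by (auto simp: compatible_def)
  have sub: "csubspace U" "closed U"
    by (simp_all add: V(2) csubspace_closure_cspan)
  have "(\<Union>z\<in>eigenvalues T. V z) \<subseteq> U"
    unfolding V(2) by (rule order_trans[OF complex_vector.span_superset closure_subset])
  then have RV: "R y \<in> U" if "y \<in> (\<Union>z\<in>eigenvalues T. V z)" for y
    using that V(1) resolvent_root_subspace[OF R sub(1) U(2)] by blast
  have "bounded_clinear R"
    using R by (simp add: hamiltonian_resolvent_def)
  from closure_cspan_map[OF this RV sub] x show ?thesis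
    unfolding V(2) by blast
qed

text \<open>
  Since \<open>(G - z) R\<close> is close to the identity, so is its compression to a component of a graph; the
  corresponding diagonal entry therefore takes all values on the projected domain of \<open>T\<close>.
\<close>

lemma diagonal_entry_surj:
  fixes \<pi> :: "'a \<times> 'a \<Rightarrow> 'a" and \<iota> :: "'a \<Rightarrow> 'a \<times> 'a"
  assumes R: "hamiltonian_resolvent \<epsilon> z R" and K: "\<epsilon> * K < 1" "0 \<le> \<epsilon>"
    and \<pi>: "\<And>x y. \<pi> (x - y) = \<pi> x - \<pi> y" "\<And>x. norm (\<pi> x) \<le> norm x"
    and \<iota>: "\<And>u v. \<iota> (u - v) = \<iota> u - \<iota> v" "\<And>u. norm (\<iota> u) \<le> K * norm u" "\<And>u. \<pi> (\<iota> u) = u"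
  shows "\<exists>u. \<pi> (opapp G (R (\<iota> u)) - z *\<^sub>C R (\<iota> u)) = y"
proof -
  define h where "h \<xi> = opapp G (R \<xi>) - z *\<^sub>C R \<xi>" for \<xi>
  have Rb: "bounded_clinear R" and R_dom: "\<And>\<xi>. R \<xi> \<in> opdom T"
    and h: "\<And>\<xi>. norm (\<xi> - h \<xi>) \<le> \<epsilon> * norm \<xi>"
    using R by (auto simp: hamiltonian_resolvent_def h_def)
  have h_diff: "h (\<xi> - \<eta>) = h \<xi> - h \<eta>" for \<xi> \<eta>
    by (simp add: h_def bounded_clinear_diff[OF Rb] linear_operator_diff[OF G_linear] opdom_G R_dom
        scaleC_diff_right)
  have "norm ((\<pi> (h (\<iota> u)) - u) - (\<pi> (h (\<iota> v)) - v)) \<le> (\<epsilon> * K) * norm (u - v)" for u v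
  proof -
    have "(\<pi> (h (\<iota> u)) - u) - (\<pi> (h (\<iota> v)) - v) = - \<pi> (\<iota> (u - v) - h (\<iota> (u - v)))"
      by (simp add: \<pi>(1) \<iota>(1,3) h_diff)
    then have "norm ((\<pi> (h (\<iota> u)) - u) - (\<pi> (h (\<iota> v)) - v)) \<le> norm (\<iota> (u - v) - h (\<iota> (u - v)))"
      using \<pi>(2) by simp
    also have "\<dots> \<le> \<epsilon> * norm (\<iota> (u - v))"
      by (rule h)
    also have "\<dots> \<le> \<epsilon> * (K * norm (u - v))"
      using \<iota>(2) K(2) by (intro mult_left_mono)
    finally show ?thesis by simp
  qed
  then have "\<exists>u. u + (\<pi> (h (\<iota> u)) - u) = y"
    using K(1) by (intro id_plus_contraction_surj[of "\<lambda>u. \<pi> (h (\<iota> u)) - u" "\<epsilon> * K"])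
  then show ?thesis
    by (simp add: h_def)
qed

lemma resolvent_of_any_accuracy:
  assumes "r0_diagonally_dominant A B C" "\<epsilon> > 0"
  obtains z Q R where "diagonal_resolvent \<epsilon> z Q" "hamiltonian_resolvent \<epsilon> z R"
proof -
  \<comment> \<open>Half of \<open>\<epsilon>\<close>, because passing from \<open>G\<close> to
    \<open>T\<close> doubles the error. Both resolvents belong to the same \<open>z\<close>, so that
    they can be compared.\<close>
  define \<epsilon>' where "\<epsilon>' = min (\<epsilon> / 2) (1 / 2)"
  have \<epsilon>': "0 < \<epsilon>'" "\<epsilon>' \<le> 1/2" "\<epsilon>' \<le> \<epsilon> / 2"
    using assms(2) by (auto simp: \<epsilon>'_def)
  obtain z Q where Q: "diagonal_resolvent \<epsilon>' z Q"
    using diagonal_resolvent_exists[OF assms(1) \<epsilon>'(1)] .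
  obtain R where R: "hamiltonian_resolvent (2 * \<epsilon>') z R"
    using hamiltonian_resolvent_exists[OF Q \<epsilon>'(1,2)] .
  have mono: "s \<le> \<epsilon>' * norm x \<Longrightarrow> s \<le> \<epsilon> * norm x" "s \<le> 2 * \<epsilon>' * norm x \<Longrightarrow> s \<le> \<epsilon> * norm x"
    for s and x :: "'a \<times> 'a"
  proof -
    have "\<epsilon>' * norm x \<le> \<epsilon> * norm x" "2 * \<epsilon>' * norm x \<le> \<epsilon> * norm x"
      using \<epsilon>' by (auto intro!: mult_right_mono)
    then show "s \<le> \<epsilon>' * norm x \<Longrightarrow> s \<le> \<epsilon> * norm x" "s \<le> 2 * \<epsilon>' * norm x \<Longrightarrow> s \<le> \<epsilon> * norm x"
      by linarith+
  qed
  have "diagonal_resolvent \<epsilon> z Q" "hamiltonian_resolvent \<epsilon> z R"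
    using Q R mono unfolding diagonal_resolvent_def hamiltonian_resolvent_def by blast+
  then show thesis by (rule that)
qed

lemma diagonal_resolvent_inj:
  assumes Q: "diagonal_resolvent \<epsilon> z Q"
  shows "u \<in> opdom A \<Longrightarrow> w \<in> opdom A \<Longrightarrow> opapp A u - z *\<^sub>C u = opapp A w - z *\<^sub>C w \<Longrightarrow> u = w"
    and "u \<in> opdom A' \<Longrightarrow> w \<in> opdom A' \<Longrightarrow> - opapp A' u - z *\<^sub>C u = - opapp A' w - z *\<^sub>C w \<Longrightarrow> u = w"
proof -
  have QG: "\<And>x. x \<in> opdom T \<Longrightarrow> Q (opapp G x - z *\<^sub>C x) = x"
    using Q by (auto simp: diagonal_resolvent_def)
  have zero: "0 \<in> opdom A" "0 \<in> opdom A'"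
    using A_linear A'_linear by (auto intro: csubspace_0 linear_operator_csubspace)
  show "u = w" if "u \<in> opdom A" "w \<in> opdom A" "opapp A u - z *\<^sub>C u = opapp A w - z *\<^sub>C w"
    using QG[of "(u, 0)"] QG[of "(w, 0)"] that zero by (simp add: mem_opdom_T opapp_G scaleC_Pair)
  show "u = w" if "u \<in> opdom A'" "w \<in> opdom A'" "- opapp A' u - z *\<^sub>C u = - opapp A' w - z *\<^sub>C w"
    using QG[of "(0, u)"] QG[of "(0, w)"] that zero by (simp add: mem_opdom_T opapp_G scaleC_Pair)
qed

text \<open>For \<open>w\<close> in the domain of \<open>A\<close>,
  \<open>diagonal_entry_surj\<close> provides a point of \<open>U\<close> in the domain of
  \<open>T\<close> whose first component has the same image under \<open>A - z\<close> as
  \<open>w\<close>. Injectivity of \<open>A - z\<close> identifies this component with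
  \<open>w\<close>, and the second component, \<open>f w\<close>, lies in the domain of the adjoint.
  The other claim is the mirror image.\<close>

lemma graph_maps_domain:
  assumes r0: "r0_diagonally_dominant A B C"
    and U: "compatible T U" "invariant_subspace T U"
  shows "bounded_clinear f \<Longrightarrow> U = range (\<lambda>u. (u, f u)) \<Longrightarrow> w \<in> opdom A \<Longrightarrow> f w \<in> opdom A'"
    and "bounded_clinear f \<Longrightarrow> U = range (\<lambda>u. (f u, u)) \<Longrightarrow> v \<in> opdom A' \<Longrightarrow> f v \<in> opdom A"
proof -
  have common: "\<exists>\<epsilon> K z Q R. \<epsilon> * K < 1 \<and> 0 \<le> \<epsilon> \<and> (\<forall>u. norm (f u) + norm u \<le> K * norm u) \<and>
      diagonal_resolvent \<epsilon> z Q \<and> hamiltonian_resolvent \<epsilon> z R" if f: "bounded_clinear f"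
  proof -
    obtain c where c: "c > 0" "\<And>u. norm (f u) \<le> c * norm u"
      using bounded_clinear_bound[OF f] by blast
    \<comment> \<open>The graph embedding has norm at most \<open>c + 1\<close>, so accuracy
      \<open>1 / (c + 2)\<close> makes the product less than 1.\<close>
    have "0 < 1 / (c + 2)"
      using c(1) by simp
    then obtain z Q R where "diagonal_resolvent (1 / (c + 2)) z Q" "hamiltonian_resolvent (1 / (c + 2)) z R"
      using resolvent_of_any_accuracy[OF r0] by metis
    moreover have "1 / (c + 2) * (c + 1) < 1" "0 \<le> 1 / (c + 2)"
      using c(1) by simp_all
    moreover have "norm (f u) + norm u \<le> (c + 1) * norm u" for u
      using c(2)[of u] by (simp add: distrib_right)
    ultimately show ?thesis by blast
  qed
  have inU: "R x \<in> U" "R x \<in> opdom T" if "hamiltonian_resolvent \<epsilon> z R" "x \<in> U" for \<epsilon> z R x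
    using that resolvent_compatible[OF that(1) U] unfolding hamiltonian_resolvent_def by blast+
  show "f w \<in> opdom A'" if f: "bounded_clinear f" and graph: "U = range (\<lambda>u. (u, f u))" and w: "w \<in> opdom A"
  proof -
    obtain \<epsilon> K z Q R where K: "\<epsilon> * K < 1" "0 \<le> \<epsilon>" "\<And>u. norm (f u) + norm u \<le> K * norm u"
      and Q: "diagonal_resolvent \<epsilon> z Q" and R: "hamiltonian_resolvent \<epsilon> z R"
      using common[OF f] by blast
    have "\<exists>u. fst (opapp G (R (u, f u)) - z *\<^sub>C R (u, f u)) = opapp A w - z *\<^sub>C w"
    proof (rule diagonal_entry_surj[OF R K(1,2)])
      show "norm (u, f u) \<le> K * norm u" for u
        using K(3)[of u] norm_Pair_le[of u "f u"] by linarith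
    qed (auto simp: bounded_clinear_diff[OF f] norm_fst_le_norm)
    then obtain u where u: "fst (opapp G (R (u, f u)) - z *\<^sub>C R (u, f u)) = opapp A w - z *\<^sub>C w"
      by blast
    have x: "R (u, f u) \<in> U" "R (u, f u) \<in> opdom T"
      using inU[OF R, of "(u, f u)"] graph by auto
    have "opapp A (fst (R (u, f u))) - z *\<^sub>C fst (R (u, f u)) = opapp A w - z *\<^sub>C w"
      using u by (simp add: opapp_G)
    moreover have "fst (R (u, f u)) \<in> opdom A"
      using x(2) by (simp add: mem_opdom_T)
    ultimately have "fst (R (u, f u)) = w"
      using diagonal_resolvent_inj(1)[OF Q _ w] by blast
    then show ?thesis
      using x graph by (auto simp: mem_opdom_T)
  qed
  show "f v \<in> opdom A" if f: "bounded_clinear f" and graph: "U = range (\<lambda>u. (f u, u))" and v: "v \<in> opdom A'"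
  proof -
    obtain \<epsilon> K z Q R where K: "\<epsilon> * K < 1" "0 \<le> \<epsilon>" "\<And>u. norm (f u) + norm u \<le> K * norm u"
      and Q: "diagonal_resolvent \<epsilon> z Q" and R: "hamiltonian_resolvent \<epsilon> z R"
      using common[OF f] by blast
    have "\<exists>u. snd (opapp G (R (f u, u)) - z *\<^sub>C R (f u, u)) = - opapp A' v - z *\<^sub>C v"
    proof (rule diagonal_entry_surj[OF R K(1,2)])
      show "norm (f u, u) \<le> K * norm u" for u
        using K(3)[of u] norm_Pair_le[of "f u" u] by linarith
    qed (auto simp: bounded_clinear_diff[OF f] norm_snd_le_norm)
    then obtain u where u: "snd (opapp G (R (f u, u)) - z *\<^sub>C R (f u, u)) = - opapp A' v - z *\<^sub>C v"
      by blast
    have x: "R (f u, u) \<in> U" "R (f u, u) \<in> opdom T"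
      using inU[OF R, of "(f u, u)"] graph by auto
    have "- opapp A' (snd (R (f u, u))) - z *\<^sub>C snd (R (f u, u)) = - opapp A' v - z *\<^sub>C v"
      using u by (simp add: opapp_G)
    moreover have "snd (R (f u, u)) \<in> opdom A'"
      using x(2) by (simp add: mem_opdom_T)
    ultimately have "snd (R (f u, u)) = v"
      using diagonal_resolvent_inj(2)[OF Q _ v] by blast
    then show ?thesis
      using x graph by (auto simp: mem_opdom_T)
  qed
qed

text \<open>The Riccati equation is invariance of the graph read in components:
  \<open>T (u, f u)\<close> is again of the form \<open>(w, f w)\<close>.\<close>

lemma regular_riccati_solution_graph:
  assumes r0: "r0_diagonally_dominant A B C"
    and U: "compatible T U" "invariant_subspace T U"
    and f: "bounded_clinear f" "U = range (\<lambda>u. (u, f u))" "\<And>u v. cinner (f u) v = cinner u (f v)"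
    and g: "bounded_clinear g" "\<And>u. g (f u) = u" "\<And>v. f (g v) = v"
  shows "regular_riccati_solution A B C (Operator UNIV f)"
proof -
  note f_dom = graph_maps_domain(1)[OF r0 U f(1,2)]
  have "U = range (\<lambda>v. (g v, v))"
    unfolding f(2) using g(2,3) by (metis (mono_tags, lifting) image_iff subsetI subset_antisym rangeI)
  note g_dom = graph_maps_domain(2)[OF r0 U g(1) this]
  have "f ` opdom A = opdom A'"
    using f_dom g_dom g(3) by (metis image_subset_iff image_eqI subsetI subset_antisym)
  moreover have "riccati_solution A B C (Operator UNIV f)"
    unfolding riccati_solution_def
  proof
    fix u assume u: "u \<in> opdom A"
    have "(u, f u) \<in> U \<inter> opdom T"
      using u f_dom f(2) by (auto simp: mem_opdom_T)
    then have "opapp T (u, f u) \<in> U"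
      using U(2) by (auto simp: invariant_subspace_def)
    then have "f (opapp A u + opapp B (f u)) = opapp C u - opapp A' (f u)"
      unfolding f(2) by (auto simp: opapp_T)
    then show "u \<in> opdom (Operator UNIV f) \<and> u \<in> opdom C \<and> opapp A u \<in> opdom (Operator UNIV f) \<and>
      opapp (Operator UNIV f) u \<in> opdom A' \<and> opapp (Operator UNIV f) u \<in> opdom B \<and>
      opapp B (opapp (Operator UNIV f) u) \<in> opdom (Operator UNIV f) \<and>
      opapp A' (opapp (Operator UNIV f) u) + opapp (Operator UNIV f) (opapp A u)
        + opapp (Operator UNIV f) (opapp B (opapp (Operator UNIV f) u)) - opapp C u = 0"
      using u f_dom[OF u] memB memC by (simp add: bounded_clinear_add[OF f(1)] eq_diff_eq add_ac)
  qed
  ultimately show ?thesis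
    unfolding regular_riccati_solution_def
    using selfadjoint_UNIV[OF f(1,3)] boundedly_invertible_UNIV[OF g] f(1)
    by (simp add: bounded_operator_def)
qed

end


section \<open>Riesz bases of Jordan chains\<close>

lemma linear_operator_sum:
  assumes "linear_operator T" "\<And>i. i \<in> I \<Longrightarrow> e i \<in> opdom T"
  shows "opapp T (\<Sum>i\<in>I. a i *\<^sub>C e i) = (\<Sum>i\<in>I. a i *\<^sub>C opapp T (e i))"
proof -
  note sub = linear_operator_csubspace[OF assms(1)]
  have "(\<Sum>i\<in>I. a i *\<^sub>C e i) \<in> opdom T \<and> opapp T (\<Sum>i\<in>I. a i *\<^sub>C e i) = (\<Sum>i\<in>I. a i *\<^sub>C opapp T (e i))"
    using assms(2)
  proof (induction I rule: infinite_finite_induct)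
    case (insert i I)
    then have "a i *\<^sub>C e i \<in> opdom T" "(\<Sum>i\<in>I. a i *\<^sub>C e i) \<in> opdom T"
      using csubspace_scale[OF sub] by auto
    then show ?case
      using insert linear_operator_add[OF assms(1)] linear_operator_scale[OF assms(1)]
        csubspace_add[OF sub] by auto
  qed (use csubspace_0[OF sub] linear_operator_0[OF assms(1)] in auto)
  then show ?thesis ..
qed

lemma symplectic_nondegenerate:
  assumes "\<And>y. symplectic x y = 0"
  shows "x = 0"
  using assms[of "(0, fst x)"] assms[of "(snd x, 0)"] by (simp add: symplectic_def prod_eq_iff)

text \<open>The coefficient \<open>1\<close> in the chain relation gives it the shape of
  \<open>chain_map_image\<close> with \<open>\<nu> = 1\<close>.\<close>

locale riesz_hamiltonian = hamiltonian +
  fixes J :: "nat set" and n :: "nat \<Rightarrow> nat" and \<zeta> :: "nat \<Rightarrow> complex"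
    and e :: "nat \<times> nat \<Rightarrow> 'a \<times> 'a" and \<Phi> :: "'a \<times> 'a \<Rightarrow> 'a \<times> 'a" and s :: real
  assumes r0: "r0_diagonally_dominant A B C"
    and e_root: "\<And>j k. j \<in> J \<Longrightarrow> k < n j \<Longrightarrow> e (j, k) \<in> root_subspace T (\<zeta> j)"
    and e_chain: "\<And>j k. j \<in> J \<Longrightarrow> k < n j \<Longrightarrow>
      opapp T (e (j, k)) = \<zeta> j *\<^sub>C e (j, k) + (if k = 0 then 0 else 1 *\<^sub>C e (j, k - 1))"
    and \<Phi>_iso: "isomorphism \<Phi>"
    and \<Phi>_e: "\<And>i l. i \<in> (SIGMA j:J. {..<n j}) \<Longrightarrow> l \<in> (SIGMA j:J. {..<n j}) \<Longrightarrow>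
      cinner (\<Phi> (e i)) (\<Phi> (e l)) = (if i = l then 1 else 0)"
    and \<Phi>_total: "closure (cspan ((\<Phi> \<circ> e) ` (SIGMA j:J. {..<n j}))) = UNIV"
    and s_nonneg: "0 \<le> s" and strip: "\<And>z. z \<in> eigenvalues T \<Longrightarrow> \<bar>Re z\<bar> \<le> s"
begin

text \<open>A predicate on chain numbers selects complete chains, so the spans below are invariant
  under \<open>T\<close>. Half-planes, discs and single eigenvalues are all described in this
  way.\<close>

definition Idx :: "(nat \<Rightarrow> bool) \<Rightarrow> (nat \<times> nat) set" where
  "Idx P = (SIGMA j:{j \<in> J. P j}. {..<n j})"

text \<open>Deliberately without closure: the span lies in the domain of \<open>T\<close>, where
  \<open>T\<close> can be applied and iterated.\<close>

definition E :: "(nat \<Rightarrow> bool) \<Rightarrow> ('a \<times> 'a) set" where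
  "E P = cspan (e ` Idx P)"

lemma Idx_mono: "Idx P \<subseteq> (SIGMA j:J. {..<n j})"
  by (auto simp: Idx_def)

lemma e_in_E: "i \<in> Idx P \<Longrightarrow> e i \<in> E P"
  unfolding E_def by (simp add: complex_vector.span_base)

lemma csubspace_E: "csubspace (E P)" and csubspace_closure_E: "csubspace (closure (E P))"
  by (simp_all add: E_def csubspace_cspan csubspace_closure_cspan)

lemma e_opdom: "i \<in> Idx P \<Longrightarrow> e i \<in> opdom T"
  using root_subspace_opdom[OF T_linear e_root] by (auto simp: Idx_def)

lemma E_opdom: "E P \<subseteq> opdom T"
  unfolding E_def using e_opdom
  by (intro complex_vector.span_minimal linear_operator_csubspace[OF T_linear]) auto

lemma T_e: "i \<in> Idx P \<Longrightarrow> opapp T (e i) \<in> E P"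
proof -
  assume "i \<in> Idx P"
  then obtain j k where i: "i = (j, k)" "j \<in> J" "P j" "k < n j"
    by (auto simp: Idx_def)
  then have "k \<noteq> 0 \<Longrightarrow> (j, k - 1) \<in> Idx P" "(j, k) \<in> Idx P"
    by (auto simp: Idx_def)
  then show ?thesis
    using i csubspace_E[of P] e_in_E
    by (auto simp: e_chain intro!: csubspace_add csubspace_scale)
qed

lemma T_E: "x \<in> E P \<Longrightarrow> opapp T x \<in> E P"
proof -
  note sub = linear_operator_csubspace[OF T_linear]
  have "csubspace {x \<in> opdom T. opapp T x \<in> E P}"
    using csubspace_E[of P] sub T_linear
    by (intro csubspaceI)
      (auto simp: csubspace_0 csubspace_add csubspace_scale linear_operator_0 linear_operator_add
        linear_operator_scale)
  then have "E P \<subseteq> {x \<in> opdom T. opapp T x \<in> E P}"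
    unfolding E_def[of P] using e_opdom T_e
    by (intro complex_vector.span_minimal) (auto simp: E_def)
  then show "x \<in> E P \<Longrightarrow> opapp T x \<in> E P" by auto
qed

lemma E_explicit:
  assumes "x \<in> E P"
  obtains F c where "finite F" "F \<subseteq> {j \<in> J. P j}" "x = (\<Sum>i\<in>(SIGMA j:F. {..<n j}). c i *\<^sub>C e i)"
  using assms unfolding E_def Idx_def by (rule cspan_chains_explicit)

section \<open>Estimates in the coordinates of the Riesz basis\<close>

lemma \<Phi>_bounded: "bounded_clinear \<Phi>" and \<Phi>_inv_bounded: "bounded_clinear (inv \<Phi>)"
  and inv_\<Phi>: "inv \<Phi> (\<Phi> x) = x"
  using \<Phi>_iso by (auto simp: isomorphism_def bij_def)

lemma \<Phi>_norms:
  obtains K1 K2 where "K1 > 0" "K2 > 0" "\<And>x. norm (\<Phi> x) \<le> K1 * norm x" "\<And>x. norm x \<le> K2 * norm (\<Phi> x)"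
  using bounded_clinear_bound[OF \<Phi>_bounded] bounded_clinear_bound[OF \<Phi>_inv_bounded] inv_\<Phi>
  by (metis (no_types))

lemma closure_E_total: "closure (E (\<lambda>_. True)) = UNIV"
proof -
  have "inv \<Phi> y \<in> closure (E (\<lambda>_. True))" for y
  proof (rule closure_cspan_map[OF \<Phi>_inv_bounded])
    show "y \<in> closure (cspan ((\<Phi> \<circ> e) ` (SIGMA j:J. {..<n j})))"
      unfolding \<Phi>_total by (rule UNIV_I)
    fix x assume "x \<in> (\<Phi> \<circ> e) ` (SIGMA j:J. {..<n j})"
    then obtain i where i: "i \<in> Idx (\<lambda>_. True)" "x = \<Phi> (e i)"
      by (auto simp: Idx_def)
    then show "inv \<Phi> x \<in> closure (E (\<lambda>_. True))"
      using closure_subset[THEN subsetD, OF e_in_E[OF i(1)]] by (simp add: inv_\<Phi>)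
  qed (auto simp: csubspace_closure_E)
  then show ?thesis
    by (metis UNIV_eq_I inv_\<Phi>)
qed

lemma \<Phi>_orthogonal:
  assumes "\<And>j. P j \<Longrightarrow> P' j \<Longrightarrow> False" "x \<in> closure (E P)" "y \<in> closure (E P')"
  shows "cinner (\<Phi> x) (\<Phi> y) = 0"
proof -
  have *: "csubspace {w. cinner w z = 0}" "closed {w. cinner w z = 0}" for z :: "'a \<times> 'a"
    by (intro csubspaceI; simp add: cinner_algebra) (intro closed_Collect_eq continuous_intros)
  have "\<Phi> x \<in> {w. cinner w (\<Phi> (e l)) = 0}" if "l \<in> Idx P'" for l
  proof (rule closure_cspan_map[OF \<Phi>_bounded _ *])
    show "x \<in> closure (cspan (e ` Idx P))"
      using assms(2) by (simp add: E_def)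
    fix y assume "y \<in> e ` Idx P"
    then show "\<Phi> y \<in> {w. cinner w (\<Phi> (e l)) = 0}"
      using that assms(1) \<Phi>_e Idx_mono[of P] Idx_mono[of P'] by (fastforce simp: Idx_def)
  qed
  then have e: "\<Phi> z \<in> {w. cinner w (\<Phi> x) = 0}" if "z \<in> e ` Idx P'" for z
    using that cinner_eq_0_commute[of _ "\<Phi> x"] by blast
  have "\<Phi> y \<in> {w. cinner w (\<Phi> x) = 0}"
    using closure_cspan_map[OF \<Phi>_bounded e *] assms(3) unfolding E_def by blast
  then show ?thesis
    by (simp add: cinner_eq_0_commute)
qed

lemma \<Phi>_pythagoras:
  assumes "x \<in> closure (E P)" "y \<in> closure (E (\<lambda>j. \<not> P j))"
  shows "norm (\<Phi> x) \<le> norm (\<Phi> (x + y))"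
proof -
  have "(norm (\<Phi> (x + y)))\<^sup>2 = (norm (\<Phi> x))\<^sup>2 + (norm (\<Phi> y))\<^sup>2"
    using \<Phi>_orthogonal[OF _ assms] by (simp add: bounded_clinear_add[OF \<Phi>_bounded] norm_add_square)
  then have "(norm (\<Phi> x))\<^sup>2 \<le> (norm (\<Phi> (x + y)))\<^sup>2" by simp
  then show ?thesis by (rule power2_le_imp_le) simp
qed

text \<open>\<open>\<Phi>\<close> makes complementary families of chains orthogonal, so Pythagoras
  bounds each part by the sum. The constant is the condition number of \<open>\<Phi>\<close> and
  therefore the same for every \<open>P\<close>.\<close>

lemma decomposition_bound:
  obtains c where "c > 0" "\<And>P x y. x \<in> closure (E P) \<Longrightarrow> y \<in> closure (E (\<lambda>j. \<not> P j)) \<Longrightarrow>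
    norm x \<le> c * norm (x + y)"
proof -
  obtain K1 K2 where K: "K1 > 0" "K2 > 0" "\<And>x. norm (\<Phi> x) \<le> K1 * norm x" "\<And>x. norm x \<le> K2 * norm (\<Phi> x)"
    by (rule \<Phi>_norms) blast
  have "norm x \<le> (K2 * K1) * norm (x + y)" if "x \<in> closure (E P)" "y \<in> closure (E (\<lambda>j. \<not> P j))" for P x y
  proof -
    have "norm x \<le> K2 * norm (\<Phi> x)"
      by (rule K)
    also have "\<dots> \<le> K2 * norm (\<Phi> (x + y))"
      using \<Phi>_pythagoras[OF that] K(2) by simp
    also have "\<dots> \<le> K2 * (K1 * norm (x + y))"
      using K(2,3) by simp
    finally show ?thesis by simp
  qed
  moreover have "K2 * K1 > 0"
    using K by simp
  ultimately show thesis using that by blast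
qed

lemma E_split:
  assumes "x \<in> E Q"
  shows "\<exists>p\<in>E (\<lambda>j. Q j \<and> P j). \<exists>q\<in>E (\<lambda>j. Q j \<and> \<not> P j). x = p + q"
proof -
  have "e ` Idx Q = e ` Idx (\<lambda>j. Q j \<and> P j) \<union> e ` Idx (\<lambda>j. Q j \<and> \<not> P j)"
    by (auto simp: Idx_def)
  with assms have "x \<in> cspan (e ` Idx (\<lambda>j. Q j \<and> P j) \<union> e ` Idx (\<lambda>j. Q j \<and> \<not> P j))"
    by (simp only: E_def)
  then have "x \<in> {p + q | p q. p \<in> E (\<lambda>j. Q j \<and> P j) \<and> q \<in> E (\<lambda>j. Q j \<and> \<not> P j)}"
    unfolding complex_vector.span_Un E_def .
  then show ?thesis by blast
qed

text \<open>Elements of the total span split algebraically. \<open>decomposition_bound\<close> makes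
  the parts of a convergent sequence Cauchy, so the splitting passes to limits.\<close>

lemma decomposition_exists:
  "\<exists>p\<in>closure (E P). \<exists>q\<in>closure (E (\<lambda>j. \<not> P j)). x = p + q"
proof -
  obtain c where c: "c > 0" "\<And>P x y. x \<in> closure (E P) \<Longrightarrow> y \<in> closure (E (\<lambda>j. \<not> P j)) \<Longrightarrow>
    norm x \<le> c * norm (x + y)"
    by (rule decomposition_bound) blast
  have "x \<in> closure (E (\<lambda>_. True))"
    by (simp add: closure_E_total)
  then obtain f where f: "\<And>m. f m \<in> E (\<lambda>_. True)" "f \<longlonglongrightarrow> x"
    by (auto simp: closure_sequential)
  have "\<exists>p q. p \<in> E P \<and> q \<in> E (\<lambda>j. \<not> P j) \<and> f m = p + q" for m
  proof -
    obtain p q where "p \<in> E (\<lambda>j. True \<and> P j)" "q \<in> E (\<lambda>j. True \<and> \<not> P j)" "f m = p + q"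
      using E_split[OF f(1)[of m], of P] by blast
    then show ?thesis
      by (intro exI[of _ p] exI[of _ q]) simp
  qed
  then obtain p q where pq: "\<And>m. p m \<in> E P" "\<And>m. q m \<in> E (\<lambda>j. \<not> P j)" "\<And>m. f m = p m + q m"
    by metis
  have le: "norm (p m - p m') \<le> c * norm (f m - f m')" for m m'
  proof -
    have "p m - p m' \<in> closure (E P)" "q m - q m' \<in> closure (E (\<lambda>j. \<not> P j))"
      using pq csubspace_diff[OF csubspace_E] closure_subset by blast+
    from c(2)[OF this] show ?thesis
      by (simp add: pq(3) algebra_simps)
  qed
  have "Cauchy p"
    by (rule Cauchy_norm_le[OF f(2) le])
  then obtain y where y: "p \<longlonglongrightarrow> y"
    using Cauchy_convergent convergent_def by blast
  have "(\<lambda>m. f m - p m) \<longlonglongrightarrow> x - y"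
    by (intro tendsto_diff f y)
  then have "q \<longlonglongrightarrow> x - y"
    by (simp add: pq(3))
  then have "x - y \<in> closure (E (\<lambda>j. \<not> P j))" "y \<in> closure (E P)"
    using y pq unfolding closure_sequential by blast+
  then show ?thesis
    by (intro bexI[of _ y] bexI[of _ "x - y"]) auto
qed

lemma norm_\<Phi>_sum:
  assumes "finite F" "F \<subseteq> J"
  shows "cinner (\<Phi> (\<Sum>i\<in>(SIGMA j:F. {..<n j}). c i *\<^sub>C e i)) (\<Phi> (\<Sum>i\<in>(SIGMA j:F. {..<n j}). c' i *\<^sub>C e i))
    = (\<Sum>i\<in>(SIGMA j:F. {..<n j}). c i * cnj (c' i))"
proof -
  let ?I = "SIGMA j:F. {..<n j}"
  have I: "?I \<subseteq> (SIGMA j:J. {..<n j})" and fin: "finite ?I"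
    using assms by auto
  have "cinner (\<Phi> (\<Sum>i\<in>?I. c i *\<^sub>C e i)) (\<Phi> (\<Sum>i\<in>?I. c' i *\<^sub>C e i))
    = (\<Sum>i\<in>?I. c i * (\<Sum>l\<in>?I. cnj (c' l) * cinner (\<Phi> (e i)) (\<Phi> (e l))))"
    unfolding bounded_clinear_sum[OF \<Phi>_bounded] bounded_clinear_scaleC[OF \<Phi>_bounded]
      cinner_sum_left cinner_scaleC_left
    unfolding cinner_sum_right cinner_scaleC_right ..
  also have "\<dots> = (\<Sum>i\<in>?I. c i * (\<Sum>l\<in>?I. if i = l then cnj (c' l) else 0))"
  proof (intro sum.cong refl arg_cong2[of _ _ _ _ "(*)"])
    fix i l assume "i \<in> ?I" "l \<in> ?I"
    then have "cinner (\<Phi> (e i)) (\<Phi> (e l)) = (if i = l then 1 else 0)"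
      using I by (intro \<Phi>_e) blast+
    then show "cnj (c' l) * cinner (\<Phi> (e i)) (\<Phi> (e l)) = (if i = l then cnj (c' l) else 0)"
      by simp
  qed
  also have "\<dots> = (\<Sum>i\<in>?I. c i * cnj (c' i))"
    using fin by (intro sum.cong refl) (simp add: sum.delta)
  finally show ?thesis .
qed

lemma norm_\<Phi>_sum_square:
  assumes "finite F" "F \<subseteq> J"
  shows "(norm (\<Phi> (\<Sum>i\<in>(SIGMA j:F. {..<n j}). c i *\<^sub>C e i)))\<^sup>2 = (\<Sum>i\<in>(SIGMA j:F. {..<n j}). (cmod (c i))\<^sup>2)"
proof -
  have "(norm (\<Phi> (\<Sum>i\<in>(SIGMA j:F. {..<n j}). c i *\<^sub>C e i)))\<^sup>2 = Re (\<Sum>i\<in>(SIGMA j:F. {..<n j}). c i * cnj (c i))"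
    by (simp only: Re_cinner_self[symmetric] norm_\<Phi>_sum[OF assms])
  then show ?thesis
    by (simp add: complex_norm_square[symmetric] del: of_real_power)
qed

lemma shift_norm_le:
  assumes "finite F"
  shows "(\<Sum>i\<in>(SIGMA j:F. {..<n j}). (cmod (if Suc (snd i) < n (fst i) then c (fst i, Suc (snd i)) else 0))\<^sup>2)
    \<le> (\<Sum>i\<in>(SIGMA j:F. {..<n j}). (cmod (c i))\<^sup>2)"
proof -
  have "(\<Sum>k<n j. (cmod (if Suc k < n j then c (j, Suc k) else 0))\<^sup>2) \<le> (\<Sum>k<n j. (cmod (c (j, k)))\<^sup>2)" for j
  proof (cases "n j")
    case (Suc N)
    have "(\<Sum>k<Suc N. (cmod (if Suc k < Suc N then c (j, Suc k) else 0))\<^sup>2) = (\<Sum>k<N. (cmod (c (j, Suc k)))\<^sup>2)"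
      by simp
    also have "\<dots> \<le> (\<Sum>k<Suc N. (cmod (c (j, k)))\<^sup>2)"
      unfolding sum.lessThan_Suc_shift by simp
    finally show ?thesis by (simp add: Suc)
  qed simp
  then have "(\<Sum>j\<in>F. \<Sum>k<n j. (cmod (if Suc k < n j then c (j, Suc k) else 0))\<^sup>2) \<le> (\<Sum>j\<in>F. \<Sum>k<n j. (cmod (c (j, k)))\<^sup>2)"
    by (rule sum_mono)
  moreover have "(\<Sum>i\<in>(SIGMA j:F. {..<n j}). h i) = (\<Sum>j\<in>F. \<Sum>k<n j. h (j, k))" for h :: "nat \<times> nat \<Rightarrow> real"
    using assms by (simp add: sum.Sigma)
  ultimately show ?thesis
    by (simp only: fst_conv snd_conv)
qed

text \<open>The nilpotent part of \<open>T\<close> shifts coordinates along the chains and so only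
  drops coefficients. Hence it is a contraction for \<open>norm (\<Phi> x)\<close> however long the
  chains are.\<close>

lemma T_diagonal_plus_contraction:
  assumes "x \<in> E P"
  obtains F c y where "finite F" "F \<subseteq> {j \<in> J. P j}"
    "x = (\<Sum>i\<in>(SIGMA j:F. {..<n j}). c i *\<^sub>C e i)"
    "opapp T x = (\<Sum>i\<in>(SIGMA j:F. {..<n j}). (\<zeta> (fst i) * c i) *\<^sub>C e i) + y"
    "norm (\<Phi> y) \<le> norm (\<Phi> x)"
proof -
  obtain F c where F: "finite F" "F \<subseteq> {j \<in> J. P j}" and x: "x = (\<Sum>i\<in>(SIGMA j:F. {..<n j}). c i *\<^sub>C e i)"
    using E_explicit[OF assms] .
  let ?I = "SIGMA j:F. {..<n j}"
  have FJ: "F \<subseteq> J"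
    using F by auto
  define y where "y = (\<Sum>i\<in>?I. (if Suc (snd i) < n (fst i) then c (fst i, Suc (snd i)) else 0) *\<^sub>C e i)"
  have "e i \<in> opdom T" if "i \<in> ?I" for i
    using that F e_opdom[of i P] by (auto simp: Idx_def)
  then have "opapp T x = (\<Sum>i\<in>?I. c i *\<^sub>C opapp T (e i))"
    unfolding x by (rule linear_operator_sum[OF T_linear])
  also have "\<dots> = (\<Sum>i\<in>?I. chain_map \<zeta> 1 n c i *\<^sub>C e i)"
    using e_chain FJ by (intro chain_map_image F) auto
  also have "\<dots> = (\<Sum>i\<in>?I. (\<zeta> (fst i) * c i) *\<^sub>C e i) + y"
    unfolding y_def sum.distrib[symmetric]
    by (intro sum.cong refl) (auto simp: chain_map_def scaleC_add_left)
  finally have T: "opapp T x = (\<Sum>i\<in>?I. (\<zeta> (fst i) * c i) *\<^sub>C e i) + y" .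
  have "(norm (\<Phi> y))\<^sup>2 \<le> (norm (\<Phi> x))\<^sup>2"
    unfolding x y_def norm_\<Phi>_sum_square[OF F(1) FJ] by (rule shift_norm_le[OF F(1)])
  then have "norm (\<Phi> y) \<le> norm (\<Phi> x)"
    by (rule power2_le_imp_le) simp
  then show thesis
    using that F x T by blast
qed

lemma \<zeta>_eigenvalue:
  assumes "j \<in> J" "0 < n j"
  shows "\<zeta> j \<in> eigenvalues T"
proof -
  have "e (j, 0) \<noteq> 0"
    using \<Phi>_e[of "(j, 0)" "(j, 0)"] assms bounded_clinear_0[OF \<Phi>_bounded] by auto
  then show ?thesis
    using root_subspace_eigenvalue[OF T_linear e_root] assms by blast
qed

text \<open>The diagonal part contributes \<open>s\<close>, because the eigenvalues lie in the
  strip, and the shift contributes 1.\<close>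

lemma \<Phi>_T_bound:
  assumes "x \<in> E P"
  shows "\<bar>Re (cinner (\<Phi> (opapp T x)) (\<Phi> x))\<bar> \<le> (s + 1) * (norm (\<Phi> x))\<^sup>2"
proof -
  obtain F c y where F: "finite F" "F \<subseteq> {j \<in> J. P j}" and x: "x = (\<Sum>i\<in>(SIGMA j:F. {..<n j}). c i *\<^sub>C e i)"
    and T: "opapp T x = (\<Sum>i\<in>(SIGMA j:F. {..<n j}). (\<zeta> (fst i) * c i) *\<^sub>C e i) + y"
    and y: "norm (\<Phi> y) \<le> norm (\<Phi> x)"
    using T_diagonal_plus_contraction[OF assms] .
  let ?I = "SIGMA j:F. {..<n j}"
  have FJ: "F \<subseteq> J"
    using F by auto
  have 1: "cinner (\<Phi> (\<Sum>i\<in>?I. (\<zeta> (fst i) * c i) *\<^sub>C e i)) (\<Phi> x) = (\<Sum>i\<in>?I. \<zeta> (fst i) * c i * cnj (c i))"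
    unfolding x by (rule norm_\<Phi>_sum[OF F(1) FJ])
  have "\<bar>Re (\<Sum>i\<in>?I. \<zeta> (fst i) * c i * cnj (c i))\<bar> = \<bar>\<Sum>i\<in>?I. Re (\<zeta> (fst i)) * (cmod (c i))\<^sup>2\<bar>"
    by (simp add: mult.assoc complex_norm_square[symmetric] del: of_real_power)
  also have "\<dots> \<le> (\<Sum>i\<in>?I. s * (cmod (c i))\<^sup>2)"
  proof (rule order_trans[OF sum_abs sum_mono])
    fix i assume "i \<in> ?I"
    then have "\<zeta> (fst i) \<in> eigenvalues T"
      using FJ by (intro \<zeta>_eigenvalue) auto
    then show "\<bar>Re (\<zeta> (fst i)) * (cmod (c i))\<^sup>2\<bar> \<le> s * (cmod (c i))\<^sup>2"
      using strip by (simp add: abs_mult mult_right_mono)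
  qed
  also have "\<dots> = s * (norm (\<Phi> x))\<^sup>2"
    unfolding x norm_\<Phi>_sum_square[OF F(1) FJ] by (simp add: sum_distrib_left)
  finally have "\<bar>Re (cinner (\<Phi> (\<Sum>i\<in>?I. (\<zeta> (fst i) * c i) *\<^sub>C e i)) (\<Phi> x))\<bar> \<le> s * (norm (\<Phi> x))\<^sup>2"
    unfolding 1 .
  moreover have "\<bar>Re (cinner (\<Phi> y) (\<Phi> x))\<bar> \<le> (norm (\<Phi> x))\<^sup>2"
  proof -
    have "\<bar>Re (cinner (\<Phi> y) (\<Phi> x))\<bar> \<le> norm (\<Phi> y) * norm (\<Phi> x)"
      by (meson abs_Re_le_cmod cinner_cauchy_schwarz order_trans)
    also have "\<dots> \<le> norm (\<Phi> x) * norm (\<Phi> x)"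
      using y by (intro mult_right_mono) auto
    finally show ?thesis by (simp add: power2_eq_square)
  qed
  ultimately show ?thesis
    unfolding T by (simp add: bounded_clinear_add[OF \<Phi>_bounded] cinner_add_left distrib_right)
qed

section \<open>Uniform definiteness on the spectral spans\<close>

lemma E_chains: "E P = cspan (e ` (SIGMA j:{j \<in> J. P j}. {..<n j}))"
  by (simp add: E_def Idx_def)

text \<open>The Lyapunov argument is applied to \<open>\<sigma> T\<close>, whose eigenvalues on the
  selected chains lie in the right half-plane; a negative \<open>\<sigma>\<close> reverses
  time.\<close>

lemma lyapunov_E:
  fixes \<sigma> :: real and q :: "'a \<times> 'a \<Rightarrow> 'a \<times> 'a \<Rightarrow> complex"
  defines "E\<sigma> \<equiv> E (\<lambda>j. 0 < \<sigma> * Re (\<zeta> j))"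
  assumes q_add: "\<And>x y z. x \<in> E\<sigma> \<Longrightarrow> y \<in> E\<sigma> \<Longrightarrow> z \<in> E\<sigma> \<Longrightarrow> q (x + y) z = q x z + q y z"
      "\<And>x y z. x \<in> E\<sigma> \<Longrightarrow> y \<in> E\<sigma> \<Longrightarrow> z \<in> E\<sigma> \<Longrightarrow> q z (x + y) = q z x + q z y"
    and q_scale: "\<And>c x y. x \<in> E\<sigma> \<Longrightarrow> y \<in> E\<sigma> \<Longrightarrow> q (c *\<^sub>C x) y = c * q x y"
      "\<And>c x y. x \<in> E\<sigma> \<Longrightarrow> y \<in> E\<sigma> \<Longrightarrow> q y (c *\<^sub>C x) = cnj c * q y x"
    and increasing: "\<And>x. x \<in> E\<sigma> \<Longrightarrow> 0 \<le> \<sigma> * Re (q (opapp T x) x + q x (opapp T x))"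
    and x: "x \<in> E\<sigma>"
  shows "0 \<le> Re (q x x)"
proof (rule lyapunov_cspan[where b = q and J = "{j \<in> J. 0 < \<sigma> * Re (\<zeta> j)}" and n = n and e = e and
      S = "\<lambda>x. complex_of_real \<sigma> *\<^sub>C opapp T x" and w = "\<lambda>j. \<sigma> * \<zeta> j" and \<nu> = "complex_of_real \<sigma>"];
    (unfold E_chains[symmetric] E\<sigma>_def[symmetric])?)
  fix x assume "x \<in> E\<sigma>"
  then show "0 \<le> Re (q (complex_of_real \<sigma> *\<^sub>C opapp T x) x + q x (complex_of_real \<sigma> *\<^sub>C opapp T x))"
    using increasing[of x] T_E by (simp add: q_scale E\<sigma>_def distrib_left)
next
  fix j k assume "j \<in> {j \<in> J. 0 < \<sigma> * Re (\<zeta> j)}" "k < n j"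
  then show "complex_of_real \<sigma> *\<^sub>C opapp T (e (j, k))
    = (\<sigma> * \<zeta> j) *\<^sub>C e (j, k) + (if k = 0 then 0 else complex_of_real \<sigma> *\<^sub>C e (j, k - 1))"
    by (simp add: e_chain scaleC_add_right scaleC_scaleC)
next
  fix x y :: "'a \<times> 'a" and c :: complex
  assume "x \<in> E\<sigma>"
  then have xT: "x \<in> opdom T"
    using E_opdom by (auto simp: E\<sigma>_def)
  then show "complex_of_real \<sigma> *\<^sub>C opapp T (c *\<^sub>C x) = c *\<^sub>C complex_of_real \<sigma> *\<^sub>C opapp T x"
    by (simp add: linear_operator_scale[OF T_linear] scaleC_scaleC mult.commute)
  assume "y \<in> E\<sigma>"
  then have "y \<in> opdom T"
    using E_opdom by (auto simp: E\<sigma>_def)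
  then show "complex_of_real \<sigma> *\<^sub>C opapp T (x + y) = complex_of_real \<sigma> *\<^sub>C opapp T x + complex_of_real \<sigma> *\<^sub>C opapp T y"
    using xT by (simp add: linear_operator_add[OF T_linear] scaleC_add_right)
qed (use x in \<open>auto simp: q_add q_scale\<close>)

text \<open>
  The strip condition bounds the growth of \<open>\<parallel>\<Phi> e\<^sup>t\<^sup>T x\<parallel>\<^sup>2\<close>, which turns the positivity of \<open>B\<close> and \<open>C\<close>
  into a uniform definiteness of the form on the spectral subspaces.
\<close>

lemma definite_on_E:
  obtains \<delta> where "\<delta> > 0"
    "\<And>x \<sigma>. \<sigma> = 1 \<or> \<sigma> = - 1 \<Longrightarrow> x \<in> E (\<lambda>j. 0 < \<sigma> * Re (\<zeta> j)) \<Longrightarrow> \<delta> * (norm x)\<^sup>2 \<le> \<sigma> * hyperbolic x"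
proof -
  obtain K1 K2 where K: "K1 > 0" "K2 > 0" "\<And>x. norm (\<Phi> x) \<le> K1 * norm x" "\<And>x. norm x \<le> K2 * norm (\<Phi> x)"
    by (rule \<Phi>_norms) blast
  \<comment> \<open>Chosen so that \<open>2 d (s + 1) K1^2 = \<gamma>\<close>: by
    \<open>\<Phi>_T_bound\<close> the term \<open>d * norm (\<Phi> x)^2\<close> then grows no faster
    than \<open>T_accretive\<close> makes \<open>hyperbolic\<close> grow.\<close>
  define d where "d = \<gamma> / (2 * (s + 1) * K1\<^sup>2)"
  have "0 < 2 * (s + 1) * K1\<^sup>2"
    using s_nonneg K(1) by simp
  then have "d > 0" "d * (2 * (s + 1) * K1\<^sup>2) = \<gamma>"
    using \<gamma>_pos unfolding d_def by (simp_all only: divide_pos_pos nonzero_eq_divide_eq[symmetric])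
  then have d: "d > 0" "2 * d * ((s + 1) * K1\<^sup>2) = \<gamma>"
    by (simp_all only: mult_ac)
  have "d / K2\<^sup>2 * (norm x)\<^sup>2 \<le> \<sigma> * hyperbolic x" if \<sigma>: "\<sigma> = 1 \<or> \<sigma> = - 1" and x: "x \<in> E (\<lambda>j. 0 < \<sigma> * Re (\<zeta> j))" for x \<sigma>
  proof -
    \<comment> \<open>Subtracting the \<open>\<Phi>\<close> term before the Lyapunov argument is
      what turns mere nonnegativity into a uniform bound; \<open>K2\<close> converts it back to the
      norm of \<open>x\<close>.\<close>
    define b where "b x y = \<sigma> * cinner (fst x) (snd y) - d * cinner (\<Phi> x) (\<Phi> y)" for x y :: "'a \<times> 'a"
    have "0 \<le> Re (b x x)"
    proof (rule lyapunov_E[where \<sigma> = \<sigma> and q = b])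
      fix x assume xE: "x \<in> E (\<lambda>j. 0 < \<sigma> * Re (\<zeta> j))"
      then have xT: "x \<in> opdom T"
        using E_opdom by blast
      have "(norm (\<Phi> x))\<^sup>2 \<le> (K1 * norm x)\<^sup>2"
        by (intro power_mono K) simp
      then have "2 * d * ((s + 1) * (norm (\<Phi> x))\<^sup>2) \<le> 2 * d * ((s + 1) * (K1 * norm x)\<^sup>2)"
        using d(1) s_nonneg by (intro mult_left_mono) auto
      also have "\<dots> = \<gamma> * (norm x)\<^sup>2"
        unfolding d(2)[symmetric] by (simp add: power_mult_distrib mult_ac)
      also have "\<dots> \<le> Re (cinner (fst (opapp T x)) (snd x) + cinner (fst x) (snd (opapp T x)))"
        by (rule T_accretive[OF xT])
      finally have 1: "2 * d * ((s + 1) * (norm (\<Phi> x))\<^sup>2)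
        \<le> Re (cinner (fst (opapp T x)) (snd x) + cinner (fst x) (snd (opapp T x)))" .
      have "\<sigma> * Re (cinner (\<Phi> (opapp T x)) (\<Phi> x)) \<le> (s + 1) * (norm (\<Phi> x))\<^sup>2"
        using \<Phi>_T_bound[OF xE] \<sigma> by auto
      then have 2: "2 * d * (\<sigma> * Re (cinner (\<Phi> (opapp T x)) (\<Phi> x))) \<le> 2 * d * ((s + 1) * (norm (\<Phi> x))\<^sup>2)"
        using d(1) by (intro mult_left_mono) auto
      have "\<sigma> * Re (b (opapp T x) x + b x (opapp T x))
        = \<sigma> * \<sigma> * Re (cinner (fst (opapp T x)) (snd x) + cinner (fst x) (snd (opapp T x)))
          - 2 * d * (\<sigma> * Re (cinner (\<Phi> (opapp T x)) (\<Phi> x)))"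
        by (simp add: b_def Re_cinner_commute[of "\<Phi> x"] algebra_simps)
      also have "\<sigma> * \<sigma> = 1"
        using \<sigma> by auto
      finally show "0 \<le> \<sigma> * Re (b (opapp T x) x + b x (opapp T x))"
        using 1 2 by simp
    next
      show "x \<in> E (\<lambda>j. 0 < \<sigma> * Re (\<zeta> j))" by (rule x)
    qed (simp_all add: b_def bounded_clinear_add[OF \<Phi>_bounded] bounded_clinear_scaleC[OF \<Phi>_bounded]
          cinner_algebra algebra_simps)
    then have "d * (norm (\<Phi> x))\<^sup>2 \<le> \<sigma> * hyperbolic x"
      by (simp add: b_def hyperbolic_def Re_cinner_self)
    moreover have "(norm x)\<^sup>2 \<le> (K2 * norm (\<Phi> x))\<^sup>2"
      by (intro power_mono K) simp
    then have "d / K2\<^sup>2 * (norm x)\<^sup>2 \<le> d / K2\<^sup>2 * (K2 * norm (\<Phi> x))\<^sup>2"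
      using d(1) by (intro mult_left_mono) auto
    then have "d / K2\<^sup>2 * (norm x)\<^sup>2 \<le> d * (norm (\<Phi> x))\<^sup>2"
      using K(2) by (simp add: power_mult_distrib)
    ultimately show ?thesis by linarith
  qed
  moreover have "d / K2\<^sup>2 > 0"
    using d(1) K(2) by simp
  ultimately show thesis using that by blast
qed

section \<open>The spectral subspaces of the two half-planes\<close>

definition W :: "real \<Rightarrow> ('a \<times> 'a) set" where
  "W \<sigma> = closure (E (\<lambda>j. 0 < \<sigma> * Re (\<zeta> j)))"

lemma csubspace_W: "csubspace (W \<sigma>)" and closed_W: "closed (W \<sigma>)"
  by (simp_all add: W_def csubspace_closure_E)

text \<open>Nonempty chains have no imaginary eigenvalue, so the chains outside one open half-plane
  are those of the other, and the decomposition results apply.\<close>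

lemma W_minus: "\<sigma> \<noteq> 0 \<Longrightarrow> W (- \<sigma>) = closure (E (\<lambda>j. \<not> 0 < \<sigma> * Re (\<zeta> j)))"
proof -
  assume "\<sigma> \<noteq> 0"
  have "Re (\<zeta> j) \<noteq> 0" if "j \<in> J" "k < n j" for j k
    using that \<zeta>_eigenvalue[of j] eigenvalue_Re_nonzero by force
  then have "Idx (\<lambda>j. 0 < - \<sigma> * Re (\<zeta> j)) = Idx (\<lambda>j. \<not> 0 < \<sigma> * Re (\<zeta> j))"
    using \<open>\<sigma> \<noteq> 0\<close> by (fastforce simp: Idx_def zero_less_mult_iff mult_less_0_iff not_less)
  then show ?thesis
    by (simp add: W_def E_def)
qed

lemma W_decomposition: "\<sigma> \<noteq> 0 \<Longrightarrow> \<exists>p\<in>W \<sigma>. \<exists>q\<in>W (- \<sigma>). x = p + q"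
  using decomposition_exists[of "\<lambda>j. 0 < \<sigma> * Re (\<zeta> j)" x] by (simp add: W_minus W_def[of \<sigma>])

lemma W_symplectic:
  assumes "x \<in> W \<sigma>" "y \<in> W \<sigma>"
  shows "symplectic x y = 0"
proof (rule symplectic_closure_cspan_eq_0)
  show "x \<in> closure (cspan (e ` Idx (\<lambda>j. 0 < \<sigma> * Re (\<zeta> j))))"
    "y \<in> closure (cspan (e ` Idx (\<lambda>j. 0 < \<sigma> * Re (\<zeta> j))))"
    using assms by (auto simp: W_def E_def)
  fix x y assume "x \<in> e ` Idx (\<lambda>j. 0 < \<sigma> * Re (\<zeta> j))" "y \<in> e ` Idx (\<lambda>j. 0 < \<sigma> * Re (\<zeta> j))"
  then obtain j k j' k' where *: "j \<in> J" "k < n j" "0 < \<sigma> * Re (\<zeta> j)" "x = e (j, k)"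
    "j' \<in> J" "k' < n j'" "0 < \<sigma> * Re (\<zeta> j')" "y = e (j', k')"
    by (auto simp: Idx_def)
  then have "0 < \<sigma> * Re (\<zeta> j + cnj (\<zeta> j'))"
    by (simp add: distrib_left)
  then have "\<zeta> j + cnj (\<zeta> j') \<noteq> 0"
    by (metis less_irrefl mult_zero_right zero_complex.sel(1))
  then show "symplectic x y = 0"
    using root_subspaces_symplectic[OF e_root e_root] * by simp
qed

text \<open>If \<open>x = p + q\<close> is orthogonal to \<open>W \<sigma>\<close>, then so is
  \<open>q\<close>. As a member of the neutral \<open>W (- \<sigma>)\<close> it is orthogonal to
  that as well, hence to everything, and nondegeneracy gives \<open>q = 0\<close>.\<close>

lemma W_hypermaximal:
  assumes "\<sigma> \<noteq> 0"
  shows "hypermaximal_neutral (W \<sigma>)"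
  unfolding hypermaximal_neutral_iff
proof (intro set_eqI iffI)
  fix x assume x: "x \<in> {x. \<forall>y\<in>W \<sigma>. symplectic x y = 0}"
  obtain p q where pq: "p \<in> W \<sigma>" "q \<in> W (- \<sigma>)" "x = p + q"
    using W_decomposition[OF assms] by blast
  have "symplectic q y = 0" for y
  proof -
    obtain u v where uv: "u \<in> W \<sigma>" "v \<in> W (- \<sigma>)" "y = u + v"
      using W_decomposition[OF assms] by blast
    have "symplectic x u = 0"
      using x uv by blast
    then have "symplectic q u = 0"
      using W_symplectic[OF pq(1) uv(1)] by (simp add: pq(3) symplectic_add_left)
    then show ?thesis
      using W_symplectic[OF pq(2) uv(2)] by (simp add: uv(3) symplectic_add_right)
  qed
  then have "q = 0"
    by (rule symplectic_nondegenerate)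
  then show "x \<in> W \<sigma>"
    using pq by simp
qed (auto simp: W_symplectic)

text \<open>Maximality reduces membership to orthogonality against the basis vectors of
  \<open>W \<sigma>\<close>, so an arbitrary root vector need not be expanded in the basis.\<close>

lemma root_subspace_W:
  assumes "\<sigma> \<noteq> 0" "0 < \<sigma> * Re z" "x \<in> root_subspace T z"
  shows "x \<in> W \<sigma>"
proof (rule hypermaximal_neutral_memI[OF W_hypermaximal[OF assms(1)]])
  fix y assume y: "y \<in> W \<sigma>"
  show "symplectic x y = 0"
  proof (rule symplectic_closure_cspan_eq_0)
    show "x \<in> closure (cspan {x})"
      using closure_subset complex_vector.span_superset by blast
    show "y \<in> closure (cspan (e ` Idx (\<lambda>j. 0 < \<sigma> * Re (\<zeta> j))))"
      using y by (simp add: W_def E_def)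
    fix x' y assume "x' \<in> {x}" "y \<in> e ` Idx (\<lambda>j. 0 < \<sigma> * Re (\<zeta> j))"
    then obtain j k where *: "j \<in> J" "k < n j" "0 < \<sigma> * Re (\<zeta> j)" "y = e (j, k)" "x' = x"
      by (auto simp: Idx_def)
    then have "0 < \<sigma> * Re (z + cnj (\<zeta> j))"
      using assms(2) by (simp add: distrib_left)
    then have "z + cnj (\<zeta> j) \<noteq> 0"
      by (metis less_irrefl mult_zero_right zero_complex.sel(1))
    then show "symplectic x' y = 0"
      using root_subspaces_symplectic[OF assms(3) e_root] * by simp
  qed
qed

text \<open>\<open>W\<close> is built from basis vectors so that the results on \<open>E\<close>
  apply to it; this links it to the complete root subspaces.\<close>

lemma W_spectral:
  assumes "\<sigma> \<noteq> 0"
  shows "spectral_subspace T {z. 0 < \<sigma> * Re z} = W \<sigma>"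
proof (rule subset_antisym)
  show "spectral_subspace T {z. 0 < \<sigma> * Re z} \<subseteq> W \<sigma>"
    unfolding spectral_subspace_def
    using root_subspace_W[OF assms] by (intro closure_cspan_minimal csubspace_W closed_W) auto
  have "e i \<in> (\<Union>z\<in>eigenvalues T \<inter> {z. 0 < \<sigma> * Re z}. root_subspace T z)" if "i \<in> Idx (\<lambda>j. 0 < \<sigma> * Re (\<zeta> j))" for i
    using that e_root \<zeta>_eigenvalue by (fastforce simp: Idx_def)
  then show "W \<sigma> \<subseteq> spectral_subspace T {z. 0 < \<sigma> * Re z}"
    unfolding spectral_subspace_def W_def E_def by (intro closure_cspan_mono) auto
qed

text \<open>A vector of the closure may lie in the domain of \<open>T\<close> without lying in the
  span. Skewness moves \<open>T\<close> to the basis vectors, where invariance is known, and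
  maximality brings \<open>T x\<close> back into \<open>W \<sigma>\<close>.\<close>

lemma W_invariant:
  assumes "\<sigma> \<noteq> 0"
  shows "invariant_subspace T (W \<sigma>)"
  unfolding invariant_subspace_def
proof (rule image_subsetI)
  fix x assume "x \<in> W \<sigma> \<inter> opdom T"
  then have x: "x \<in> W \<sigma>" "x \<in> opdom T"
    by simp_all
  show "opapp T x \<in> W \<sigma>"
  proof (rule hypermaximal_neutral_memI[OF W_hypermaximal[OF assms]])
    fix y assume y: "y \<in> W \<sigma>"
    show "symplectic (opapp T x) y = 0"
    proof (rule symplectic_closure_cspan_eq_0)
      show "opapp T x \<in> closure (cspan {opapp T x})"
        using closure_subset complex_vector.span_superset by blast
      show "y \<in> closure (cspan (e ` Idx (\<lambda>j. 0 < \<sigma> * Re (\<zeta> j))))"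
        using y by (simp add: W_def E_def)
      fix x' y assume "x' \<in> {opapp T x}" "y \<in> e ` Idx (\<lambda>j. 0 < \<sigma> * Re (\<zeta> j))"
      then obtain i where i: "i \<in> Idx (\<lambda>j. 0 < \<sigma> * Re (\<zeta> j))" "y = e i" "x' = opapp T x"
        by auto
      then have "opapp T y \<in> W \<sigma>"
        using T_e[OF i(1)] closure_subset by (auto simp: W_def)
      then show "symplectic x' y = 0"
        using T_skew[OF x(2) e_opdom[OF i(1)]] W_symplectic[OF x(1)] i by simp
    qed
  qed
qed

lemma W_compatible: "\<sigma> \<noteq> 0 \<Longrightarrow> compatible T (W \<sigma>)"
  using spectral_subspace_compatible[OF T_linear] W_spectral by metis

lemma W_dichotomy:
  obtains \<delta> where "dichotomy (W 1) (W (- 1)) \<delta>"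
proof -
  obtain \<delta> where \<delta>: "\<delta> > 0"
    "\<And>x \<sigma>. \<sigma> = 1 \<or> \<sigma> = - 1 \<Longrightarrow> x \<in> E (\<lambda>j. 0 < \<sigma> * Re (\<zeta> j)) \<Longrightarrow> \<delta> * (norm x)\<^sup>2 \<le> \<sigma> * hyperbolic x"
    by (rule definite_on_E) blast
  have W: "\<delta> * (norm x)\<^sup>2 \<le> \<sigma> * hyperbolic x" if "x \<in> W \<sigma>" "\<sigma> = 1 \<or> \<sigma> = - 1" for x \<sigma>
  proof -
    have "closed {x. \<delta> * (norm x)\<^sup>2 \<le> \<sigma> * hyperbolic x}"
      by (intro closed_Collect_le continuous_intros)
    then have "W \<sigma> \<subseteq> {x. \<delta> * (norm x)\<^sup>2 \<le> \<sigma> * hyperbolic x}"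
      unfolding W_def using \<delta>(2)[OF that(2)] by (intro closure_minimal) auto
    then show ?thesis using that by auto
  qed
  have "dichotomy (W 1) (W (- 1)) \<delta>"
    using \<delta>(1) W[of _ 1] W[of _ "- 1"] W_hypermaximal[of 1] W_hypermaximal[of "- 1"]
    by unfold_locales auto
  then show thesis by (rule that)
qed

lemma W_projection:
  obtains Pp where "bounded_clinear Pp" "\<And>x. Pp x \<in> W 1" "\<And>x. x - Pp x \<in> W (- 1)"
    "\<And>x. x \<in> W 1 \<Longrightarrow> Pp x = x" "\<And>x. x \<in> W (- 1) \<Longrightarrow> Pp x = 0"
proof -
  obtain c where c: "c > 0" "\<And>P x y. x \<in> closure (E P) \<Longrightarrow> y \<in> closure (E (\<lambda>j. \<not> P j)) \<Longrightarrow>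
    norm x \<le> c * norm (x + y)"
    by (rule decomposition_bound) blast
  have bound: "norm p \<le> c * norm (p + q)" if "p \<in> W 1" "q \<in> W (- 1)" for p q
    using c(2)[of p "\<lambda>j. 0 < 1 * Re (\<zeta> j)" q] that W_minus[of 1] by (simp add: W_def[of 1])
  have "\<exists>p. p \<in> W 1 \<and> x - p \<in> W (- 1)" for x
    using W_decomposition[of 1 x] by force
  then obtain Pp where Pp: "\<And>x. Pp x \<in> W 1" "\<And>x. x - Pp x \<in> W (- 1)"
    by metis
  have unique: "Pp x = p" if "p \<in> W 1" "x - p \<in> W (- 1)" for x p
  proof -
    have "Pp x - p \<in> W 1" "(x - Pp x) - (x - p) \<in> W (- 1)"
      using Pp that csubspace_diff[OF csubspace_W] by blast+
    from bound[OF this] show ?thesis by simp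
  qed
  have "bounded_clinear Pp"
  proof (rule bounded_clinearI)
    show "Pp (x + y) = Pp x + Pp y" for x y
      using csubspace_add[OF csubspace_W Pp(1) Pp(1), of x y] csubspace_add[OF csubspace_W Pp(2) Pp(2), of x y]
      by (intro unique) (simp_all add: algebra_simps)
    show "Pp (a *\<^sub>C x) = a *\<^sub>C Pp x" for a x
      using csubspace_scale[OF csubspace_W Pp(1), of a x] csubspace_scale[OF csubspace_W Pp(2), of a x]
      by (intro unique) (simp_all add: scaleC_diff_right)
    show "norm (Pp x) \<le> norm x * c" for x
      using bound[OF Pp(1)[of x] Pp(2)[of x]] by (simp add: mult.commute)
  qed
  moreover have "Pp x = x" if "x \<in> W 1" for x
    using that csubspace_0[OF csubspace_W] by (intro unique) auto
  moreover have "Pp x = 0" if "x \<in> W (- 1)" for x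
    using that csubspace_0[OF csubspace_W] by (intro unique) auto
  ultimately show thesis
    using that Pp by blast
qed

text \<open>On each root subspace \<open>Pp\<close> is the identity or zero, so it preserves every
  subspace from which a compatible \<open>U\<close> may be assembled.\<close>

lemma projection_compatible:
  assumes Pp: "bounded_clinear Pp" "\<And>x. x \<in> W 1 \<Longrightarrow> Pp x = x" "\<And>x. x \<in> W (- 1) \<Longrightarrow> Pp x = 0"
    and U: "compatible T U" and x: "x \<in> U"
  shows "Pp x \<in> U"
proof -
  obtain V where V: "\<And>z. z \<in> eigenvalues T \<Longrightarrow> V z \<subseteq> root_subspace T z"
    "U = closure (cspan (\<Union>z\<in>eigenvalues T. V z))"
    using U by (auto simp: compatible_def)
  have sub: "csubspace U" "closed U"
    by (simp_all add: V(2) csubspace_closure_cspan)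
  have VU: "(\<Union>z\<in>eigenvalues T. V z) \<subseteq> U"
    unfolding V(2) by (rule order_trans[OF complex_vector.span_superset closure_subset])
  have "Pp y \<in> U" if y_in: "y \<in> (\<Union>z\<in>eigenvalues T. V z)" for y
  proof -
    obtain z where z: "z \<in> eigenvalues T" "y \<in> V z"
      using y_in by blast
    then have y: "y \<in> root_subspace T z"
      using V(1) by blast
    consider "Re z > 0" | "Re z < 0"
      using eigenvalue_Re_nonzero[OF z(1)] by linarith
    then show ?thesis
    proof cases
      case 1
      then have "Pp y = y"
        using root_subspace_W[of 1 z y] y by (intro Pp(2)) simp
      then show ?thesis using VU y_in by auto
    next
      case 2
      then have "Pp y = 0"
        using root_subspace_W[of "- 1" z y] y by (intro Pp(3)) simp
      then show ?thesis using csubspace_0[OF sub(1)] by simp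
    qed
  qed
  from closure_cspan_map[OF Pp(1) this sub] x show ?thesis
    unfolding V(2) by blast
qed

lemma compatible_splits:
  assumes U: "csubspace U" "compatible T U"
  shows "splits_along (W 1) (W (- 1)) U"
  unfolding splits_along_def
proof
  fix x assume x: "x \<in> U"
  obtain Pp where Pp: "bounded_clinear Pp" "\<And>x. Pp x \<in> W 1" "\<And>x. x - Pp x \<in> W (- 1)"
    "\<And>x. x \<in> W 1 \<Longrightarrow> Pp x = x" "\<And>x. x \<in> W (- 1) \<Longrightarrow> Pp x = 0"
    by (rule W_projection) blast
  have "Pp x \<in> U"
    by (rule projection_compatible[OF Pp(1,4,5) U(2) x])
  then show "\<exists>p\<in>U \<inter> W 1. \<exists>q\<in>U \<inter> W (- 1). x = p + q"
    using Pp(2,3) x csubspace_diff[OF U(1)]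
    by (intro bexI[of _ "Pp x"] bexI[of _ "x - Pp x"]) auto
qed

lemma neutral_graph:
  assumes U: "hypermaximal_neutral U" "invariant_subspace T U" "compatible T U"
  obtains f g where "bounded_clinear f" "U = range (\<lambda>u. (u, f u))" "\<And>u v. cinner (f u) v = cinner u (f v)"
    "bounded_clinear g" "\<And>u. g (f u) = u" "\<And>v. f (g v) = v"
    "regular_riccati_solution A B C (Operator UNIV f)"
proof -
  obtain \<delta> where "dichotomy (W 1) (W (- 1)) \<delta>"
    by (rule W_dichotomy)
  then interpret dichotomy "W 1" "W (- 1)" \<delta> .
  note split = compatible_splits[OF hypermaximal_neutral_csubspace[OF U(1)] U(3)]
  obtain f where f: "bounded_clinear f" "U = range (\<lambda>u. (u, f u))" "\<And>u v. cinner (f u) v = cinner u (f v)"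
    using graph_exists[OF U(1) split] by blast
  obtain g where g: "bounded_clinear g" "\<And>u. g (f u) = u" "\<And>v. f (g v) = v"
    using inverse_graph_exists[OF U(1) split f(2)] by blast
  show thesis
    using that f g regular_riccati_solution_graph[OF r0 U(3,2) f g] by blast
qed

text \<open>\<open>P u\<close> is the first component of \<open>Pp (u, f u)\<close>. Since
  \<open>Pp\<close> maps the graph into itself, \<open>Pp (u, f u) = (P u, f (P u))\<close>, and
  idempotence of \<open>Pp\<close> becomes idempotence of \<open>P\<close>.\<close>

lemma graph_projection:
  assumes f: "bounded_clinear f" and U: "compatible T (range (\<lambda>u. (u, f u)))"
    and fp: "W 1 = range (\<lambda>u. (u, fp u))" and fm: "W (- 1) = range (\<lambda>u. (u, fm u))"
  shows "\<exists>P. projection P \<and> (\<forall>u. f u = fp (P u) + fm (u - P u))"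
proof -
  obtain Pp where Pp: "bounded_clinear Pp" "\<And>x. Pp x \<in> W 1" "\<And>x. x - Pp x \<in> W (- 1)"
    "\<And>x. x \<in> W 1 \<Longrightarrow> Pp x = x" "\<And>x. x \<in> W (- 1) \<Longrightarrow> Pp x = 0"
    by (rule W_projection) blast
  define P where "P u = fst (Pp (u, f u))" for u
  have 1: "Pp (u, f u) = (P u, fp (P u))" for u
    using Pp(2)[of "(u, f u)"] by (auto simp: fp P_def)
  have "(u, f u) - Pp (u, f u) = (u - P u, fm (u - P u))" for u
    using Pp(3)[of "(u, f u)"] by (auto simp: fm 1)
  then have sum: "f u = fp (P u) + fm (u - P u)" for u
    by (simp add: 1 diff_eq_eq add.commute)
  have idem: "P (P u) = P u" for u
  proof -
    have "Pp (u, f u) \<in> range (\<lambda>u. (u, f u))"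
      by (rule projection_compatible[OF Pp(1,4,5) U]) auto
    then have "Pp (u, f u) = (P u, f (P u))"
      by (auto simp: 1)
    then have "Pp (P u, f (P u)) = (P u, f (P u))"
      using Pp(2,4) by metis
    then show ?thesis by (simp add: P_def[of "P u"])
  qed
  obtain Kf Kp where K: "Kf > 0" "\<And>u. norm (f u) \<le> Kf * norm u" "Kp > 0" "\<And>x. norm (Pp x) \<le> Kp * norm x"
    using bounded_clinear_bound[OF f] bounded_clinear_bound[OF Pp(1)] by metis
  have "bounded_clinear P"
  proof (rule bounded_clinearI)
    show "P (x + y) = P x + P y" for x y
      using bounded_clinear_add[OF Pp(1), of "(x, f x)" "(y, f y)"]
      by (simp add: P_def bounded_clinear_add[OF f])
    show "P (c *\<^sub>C x) = c *\<^sub>C P x" for c x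
      using bounded_clinear_scaleC[OF Pp(1), of c "(x, f x)"]
      by (simp add: P_def bounded_clinear_scaleC[OF f] scaleC_Pair)
    show "norm (P x) \<le> norm x * (Kp * (1 + Kf))" for x
    proof -
      have "norm (P x) \<le> Kp * norm (x, f x)"
        using norm_fst_le_norm[of "Pp (x, f x)"] K(4)[of "(x, f x)"] by (simp add: P_def)
      also have "norm (x, f x) \<le> norm x + Kf * norm x"
        using norm_Pair_le[of x "f x"] K(2)[of x] by linarith
      finally show ?thesis
        using K(3) by (simp add: algebra_simps)
    qed
  qed
  then show ?thesis
    using sum idem by (auto simp: projection_def)
qed

end


section \<open>Symmetric solutions of the Riccati equation\<close>

text \<open>Polarization turns the bound on the quadratic form into an operator bound on the dense
  \<open>D\<close>; closedness of \<open>X\<close> then extends domain and bound to the whole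
  space.\<close>

lemma bounded_operator_if_form_bounded:
  fixes X :: "'a::complex_hilbert operator"
  assumes closed: "closed_operator X" and sym: "symmetric_operator X"
    and D: "csubspace D" "closure D = UNIV" "D \<subseteq> opdom X"
    and bound: "\<And>u. u \<in> D \<Longrightarrow> \<bar>Re (cinner (opapp X u) u)\<bar> \<le> c * (norm u)\<^sup>2" and "c > 0"
  shows "bounded_operator X"
proof -
  have lin: "linear_operator X"
    using sym by (simp add: symmetric_operator_def)
  have X_sym: "cinner (opapp X u) v = cinner u (opapp X v)" if "u \<in> D" "v \<in> D" for u v
    using sym that D(3) by (auto simp: symmetric_operator_def)
  have polar: "2 * Re (cinner (opapp X u) v) \<le> c * ((norm u)\<^sup>2 + (norm v)\<^sup>2)" if uv: "u \<in> D" "v \<in> D" for u v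
  proof -
    have dom: "u \<in> opdom X" "v \<in> opdom X"
      using uv D(3) by auto
    have "Re (cinner (opapp X (u + v)) (u + v)) - Re (cinner (opapp X (u - v)) (u - v))
        = 2 * Re (cinner (opapp X u) v) + 2 * Re (cinner (opapp X v) u)"
      by (simp add: linear_operator_add[OF lin dom] linear_operator_diff[OF lin dom] cinner_algebra)
    also have "Re (cinner (opapp X v) u) = Re (cinner (opapp X u) v)"
      using X_sym[OF uv] Re_cinner_commute[of "opapp X v" u] by simp
    finally have "4 * Re (cinner (opapp X u) v)
        = Re (cinner (opapp X (u + v)) (u + v)) - Re (cinner (opapp X (u - v)) (u - v))"
      by simp
    also have "\<dots> \<le> c * (norm (u + v))\<^sup>2 + c * (norm (u - v))\<^sup>2"
      using bound[OF csubspace_add[OF D(1) uv]] bound[OF csubspace_diff[OF D(1) uv]] by linarith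
    also have "\<dots> = 2 * (c * ((norm u)\<^sup>2 + (norm v)\<^sup>2))"
      by (simp add: norm_add_square norm_diff_square algebra_simps)
    finally show ?thesis by simp
  qed
  have X_bound: "norm (opapp X u) \<le> c * norm u" if u: "u \<in> D" for u
  proof -
    have "closed {v. 2 * Re (cinner (opapp X u) v) \<le> c * ((norm u)\<^sup>2 + (norm v)\<^sup>2)}"
      by (intro closed_Collect_le continuous_intros)
    then have "closure D \<subseteq> {v. 2 * Re (cinner (opapp X u) v) \<le> c * ((norm u)\<^sup>2 + (norm v)\<^sup>2)}"
      using polar[OF u] by (intro closure_minimal) auto
    then have "2 * Re (cinner (opapp X u) v) \<le> c * ((norm u)\<^sup>2 + (norm v)\<^sup>2)" for v
      using D(2) by auto
    \<comment> \<open>The choice \<open>v = X u / c\<close> is the one that turns the polarized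
      estimate into \<open>norm (X u)^2 \<le> (c * norm u)^2\<close>.\<close>
    from this[of "complex_of_real (1 / c) *\<^sub>C opapp X u"]
    have "2 / c * (norm (opapp X u))\<^sup>2 \<le> c * (norm u)\<^sup>2 + 1 / c * (norm (opapp X u))\<^sup>2"
      using \<open>c > 0\<close> unfolding cinner_scaleC_right norm_scaleC cinner_self norm_of_real
      by (simp add: power_mult_distrib power2_eq_square field_simps)
    then have sq: "(norm (opapp X u))\<^sup>2 \<le> (c * norm u)\<^sup>2"
      using \<open>c > 0\<close> by (simp add: field_simps power2_eq_square)
    have "0 \<le> c * norm u"
      using \<open>c > 0\<close> by simp
    with sq show ?thesis
      by (rule power2_le_imp_le)
  qed
  have lim: "u \<in> opdom X \<and> norm (opapp X u) \<le> norm u * c" for u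
  proof -
    have "u \<in> closure D"
      by (simp add: D(2))
    then obtain f where f: "\<And>m. f m \<in> D" "f \<longlonglongrightarrow> u"
      by (auto simp: closure_sequential)
    have diff: "norm (opapp X (f m) - opapp X (f k)) \<le> c * norm (f m - f k)" for m k
    proof -
      have "f m \<in> opdom X" "f k \<in> opdom X"
        using f(1) D(3) by blast+
      then show ?thesis
        using X_bound[OF csubspace_diff[OF D(1) f(1)[of m] f(1)[of k]]]
        by (simp add: linear_operator_diff[OF lin])
    qed
    have "Cauchy (\<lambda>m. opapp X (f m))"
      by (rule Cauchy_norm_le[OF f(2) diff])
    then obtain v where v: "(\<lambda>m. opapp X (f m)) \<longlonglongrightarrow> v"
      using Cauchy_convergent convergent_def by blast
    have "(\<lambda>m. (f m, opapp X (f m))) \<longlonglongrightarrow> (u, v)"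
      by (intro tendsto_intros f v)
    moreover have "(f m, opapp X (f m)) \<in> graph X" for m
      using f(1) D(3) by (auto simp: graph_def)
    ultimately have "(u, v) \<in> graph X"
      using closed_sequentially[of "graph X" "\<lambda>m. (f m, opapp X (f m))"] closed
      by (simp add: closed_operator_def)
    then have u: "u \<in> opdom X" "opapp X u = v"
      by (auto simp: graph_def)
    have "norm v \<le> c * norm u"
    proof (rule LIMSEQ_le)
      show "(\<lambda>m. norm (opapp X (f m))) \<longlonglongrightarrow> norm v"
        by (intro tendsto_intros v)
      show "(\<lambda>m. c * norm (f m)) \<longlonglongrightarrow> c * norm u"
        by (intro tendsto_intros f)
    qed (use X_bound[OF f(1)] in auto)
    then show ?thesis
      using u by (simp add: mult.commute)
  qed
  then have "opdom X = UNIV"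
    by auto
  then show ?thesis
    unfolding bounded_operator_def
    using lim linear_operator_add[OF lin] linear_operator_scale[OF lin]
    by (intro conjI bounded_clinearI[of "opapp X" c]) auto
qed

context riesz_hamiltonian
begin

text \<open>Resolvents preserve the span itself, not only its closure, so approximants remain where
  the Lyapunov argument is valid.\<close>

lemma resolvent_E:
  assumes R: "hamiltonian_resolvent \<epsilon> z R" and x: "x \<in> E P"
  shows "R x \<in> E P"
proof -
  have Rb: "bounded_clinear R"
    using R by (simp add: hamiltonian_resolvent_def)
  have inv: "invariant_subspace T (E P)"
    using T_E by (auto simp: invariant_subspace_def)
  have "csubspace {x. R x \<in> E P}"
    by (intro clinear_vimage_csubspace csubspace_E)
      (simp_all add: bounded_clinear_add[OF Rb] bounded_clinear_scaleC[OF Rb])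
  moreover have "R (e i) \<in> E P" if "i \<in> Idx P" for i
  proof (rule resolvent_root_subspace[OF R csubspace_E inv])
    show "e i \<in> root_subspace T (\<zeta> (fst i))"
      using that e_root by (auto simp: Idx_def)
    show "e i \<in> E P"
      by (rule e_in_E[OF that])
  qed
  ultimately have "E P \<subseteq> {x. R x \<in> E P}"
    unfolding E_def[of P] by (intro complex_vector.span_minimal) (auto simp: E_def)
  then show ?thesis using x by auto
qed

end

locale weak_riccati = riesz_hamiltonian +
  fixes X :: "'a operator"
  assumes X_symmetric: "symmetric_operator X"
    and A_X: "opdom A \<subseteq> opdom X" and X_B: "opapp X ` opdom A \<subseteq> opdom B"
    and weak: "\<And>u v. u \<in> opdom A \<Longrightarrow> v \<in> opdom A \<Longrightarrow>
      cinner (opapp X u) (opapp A v) + cinner (opapp A u) (opapp X v)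
        + cinner (opapp B (opapp X u)) (opapp X v) - cinner (opapp C u) v = 0"
begin

lemma X_linear: "linear_operator X" and X_sym: "u \<in> opdom X \<Longrightarrow> v \<in> opdom X \<Longrightarrow>
    cinner (opapp X u) v = cinner u (opapp X v)"
  and X_dense: "closure (opdom X) = UNIV"
  using X_symmetric by (auto simp: symmetric_operator_def densely_defined_def)

text \<open>
  The difference \<open>d = h u - X u\<close> of two solutions satisfies \<open>2 Re (d | (A + B h) u) = (B d | d)\<close>.
\<close>

lemma riccati_difference:
  assumes h: "bounded_clinear h" "\<And>u v. cinner (h u) v = cinner u (h v)"
    and ric: "riccati_solution A B C (Operator UNIV h)" and u: "u \<in> opdom A"
  shows "0 \<le> Re (cinner (h u - opapp X u) (opapp A u + opapp B (h u)))"
proof -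
  define p q where "p = h u" and "q = opapp X u"
  have p: "p \<in> opdom A'" "opapp A' p + h (opapp A u) + h (opapp B p) - opapp C u = 0"
    using ric u by (auto simp: riccati_solution_def p_def)
  have pB: "p \<in> opdom B" "q \<in> opdom B"
    using memB[OF p(1)] X_B u by (auto simp: q_def)
  have dB: "p - q \<in> opdom B"
    using pB BC_linear(1) by (intro csubspace_diff linear_operator_csubspace)
  have "cinner (opapp A' p + h (opapp A u) + h (opapp B p) - opapp C u) u = 0"
    by (simp add: p(2))
  moreover have "cinner (opapp A' p) u = cinner p (opapp A u)"
    using A'_eq[OF p(1) u] by (metis cinner_commute)
  ultimately have "cinner p (opapp A u) + cinner (opapp A u) p + cinner (opapp B p) p - cinner (opapp C u) u = 0"
    by (simp add: cinner_algebra h(2) p_def)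
  then have 1: "2 * Re (cinner p (opapp A u)) + Re (cinner (opapp B p) p) = Re (cinner (opapp C u) u)"
    using Re_cinner_commute[of "opapp A u" p] by (simp add: complex_eq_iff)
  have 2: "2 * Re (cinner q (opapp A u)) + Re (cinner (opapp B q) q) = Re (cinner (opapp C u) u)"
    using weak[OF u u] Re_cinner_commute[of "opapp A u" q] by (simp add: complex_eq_iff q_def)
  \<comment> \<open>Subtracting the two quadratic identities eliminates \<open>C\<close>; what
    remains, together with \<open>2 Re (p - q | B p)\<close>, completes to the square
    \<open>(B (p - q) | p - q)\<close>.\<close>
  have "cinner (opapp B (p - q)) (p - q) = cinner (opapp B p) p - cinner (opapp B p) q - cinner (opapp B q) p + cinner (opapp B q) q"
    by (simp add: linear_operator_diff[OF BC_linear(1) pB] cinner_algebra)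
  moreover have "Re (cinner (opapp B q) p) = Re (cinner (opapp B p) q)" "Re (cinner q (opapp B p)) = Re (cinner (opapp B p) q)"
      "Re (cinner p (opapp B p)) = Re (cinner (opapp B p) p)"
    using B_sym[OF pB(2,1)] B_sym[OF pB] Re_cinner_commute by metis+
  ultimately have "2 * Re (cinner (p - q) (opapp A u + opapp B p)) = Re (cinner (opapp B (p - q)) (p - q))"
    using 1 2 by (simp add: cinner_algebra)
  also have "0 \<le> \<dots>"
    using B_positive[OF dB] \<gamma>_pos by (meson mult_nonneg_nonneg order_trans less_imp_le zero_le_power2)
  finally show ?thesis by (simp add: p_def q_def)
qed

text \<open>On the span of chains the Lyapunov argument applies to the form of \<open>h - X\<close>.
  To reach an arbitrary \<open>u\<close> in the domain of \<open>A\<close>, approximants of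
  \<open>(u, h u)\<close> are needed along which \<open>X\<close> converges too; the resolvent
  provides them.\<close>

lemma weak_riccati_between:
  fixes \<sigma> :: real
  assumes \<sigma>: "\<sigma> = 1 \<or> \<sigma> = - 1" and W: "W \<sigma> = range (\<lambda>u. (u, h u))"
    and h: "bounded_clinear h" "\<And>u v. cinner (h u) v = cinner u (h v)"
    and ric: "riccati_solution A B C (Operator UNIV h)" and u: "u \<in> opdom A"
  shows "\<sigma> * Re (cinner (opapp X u) u) \<le> \<sigma> * Re (cinner (h u) u)"
proof -
  let ?E = "E (\<lambda>j. 0 < \<sigma> * Re (\<zeta> j))"
  have \<sigma>0: "\<sigma> \<noteq> 0"
    using \<sigma> by auto
  have E_graph: "x = (fst x, h (fst x))" "fst x \<in> opdom A" "fst x \<in> opdom X"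
    "fst (opapp T x) \<in> opdom A" "fst (opapp T x) \<in> opdom X"
    "fst (opapp T x) = opapp A (fst x) + opapp B (h (fst x))" if "x \<in> ?E" for x
  proof -
    have "x \<in> W \<sigma>"
      using that closure_subset by (auto simp: W_def)
    then show x: "x = (fst x, h (fst x))"
      unfolding W by auto
    have "x \<in> opdom T" "opapp T x \<in> opdom T"
      using that E_opdom T_E by blast+
    then show "fst x \<in> opdom A" "fst (opapp T x) \<in> opdom A"
      by (simp_all add: mem_opdom_T)
    then show "fst x \<in> opdom X" "fst (opapp T x) \<in> opdom X"
      using A_X by auto
    show "fst (opapp T x) = opapp A (fst x) + opapp B (h (fst x))"
      by (subst x) (simp add: opapp_T)
  qed
  define b where "b x y = \<sigma> * cinner (h (fst x) - opapp X (fst x)) (fst y)" for x y :: "'a \<times> 'a"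
  have on_E: "0 \<le> Re (b x x)" if x: "x \<in> ?E" for x
  proof (rule lyapunov_E[where \<sigma> = \<sigma> and q = b])
    fix x assume xE: "x \<in> ?E"
    define y where "y = opapp T x"
    note g = E_graph[OF xE, folded y_def]
    have "cinner (h (fst y) - opapp X (fst y)) (fst x) = cinner (fst y) (h (fst x) - opapp X (fst x))"
      using X_sym[OF g(5,3)] by (simp add: cinner_algebra h(2))
    then have "Re (cinner (h (fst y) - opapp X (fst y)) (fst x)) = Re (cinner (h (fst x) - opapp X (fst x)) (fst y))"
      using Re_cinner_commute by metis
    moreover have "\<sigma> * \<sigma> = 1"
      using \<sigma> by auto
    ultimately have "\<sigma> * Re (b y x + b x y) = 2 * Re (cinner (h (fst x) - opapp X (fst x)) (fst y))"
      by (simp add: b_def mult.assoc[symmetric] distrib_left)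
    also have "\<dots> \<ge> 0"
      using riccati_difference[OF h ric g(2)] by (simp add: g(6))
    finally show "0 \<le> \<sigma> * Re (b (opapp T x) x + b x (opapp T x))"
      by (simp add: y_def)
  next
    fix x y z :: "'a \<times> 'a" and c :: complex
    assume x: "x \<in> ?E"
    have "opapp X (c *\<^sub>C fst x) = c *\<^sub>C opapp X (fst x)"
      by (rule linear_operator_scale[OF X_linear E_graph(3)[OF x]])
    then show "b (c *\<^sub>C x) y = c * b x y" "b y (c *\<^sub>C x) = cnj c * b y x"
      by (simp_all add: b_def bounded_clinear_scaleC[OF h(1)] cinner_scaleC_left cinner_scaleC_right
          flip: scaleC_diff_right)
    assume y: "y \<in> ?E"
    have "opapp X (fst x + fst y) = opapp X (fst x) + opapp X (fst y)"
      by (rule linear_operator_add[OF X_linear E_graph(3)[OF x] E_graph(3)[OF y]])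
    then show "b (x + y) z = b x z + b y z" "b z (x + y) = b z x + b z y"
      by (simp_all add: b_def bounded_clinear_add[OF h(1)] cinner_algebra algebra_simps)
  qed (use x in auto)
  obtain z Q R where R: "hamiltonian_resolvent 1 z R"
    by (rule resolvent_of_any_accuracy[OF r0 zero_less_one]) blast
  have Rb: "bounded_clinear R" and RT: "\<And>x. x \<in> opdom T \<Longrightarrow> R (opapp T x - z *\<^sub>C x) = x"
    and R_dom: "\<And>\<xi>. R \<xi> \<in> opdom T"
    using R unfolding hamiltonian_resolvent_def by blast+
  have R_dom': "fst (R \<xi>) \<in> opdom X" for \<xi>
    using R_dom[of \<xi>] A_X by (auto simp: mem_opdom_T)
  \<comment> \<open>\<open>L\<close> is defined everywhere. Symmetry moves \<open>X\<close> to the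
    other factor, so \<open>|(L y | v)| \<le> K |y| |X v|\<close> for \<open>v\<close> in the dense
    domain of \<open>X\<close>, and weak boundedness becomes boundedness.\<close>
  define L where "L \<xi> = opapp X (fst (R \<xi>))" for \<xi>
  obtain K where K: "K > 0" "\<And>\<xi>. norm (R \<xi>) \<le> K * norm \<xi>"
    by (rule bounded_clinear_bound[OF Rb]) blast
  have L_add: "L (x + y) = L x + L y" for x y
    by (simp add: L_def bounded_clinear_add[OF Rb] linear_operator_add[OF X_linear] R_dom')
  have L_scale: "L (r *\<^sub>R x) = r *\<^sub>R L x" for r x
    by (simp add: L_def scaleR_scaleC bounded_clinear_scaleC[OF Rb] linear_operator_scale[OF X_linear] R_dom')
  have "\<exists>M. \<forall>y. norm (L y) \<le> norm y * M"
  proof (rule weakly_bounded_imp_bounded[OF L_add L_scale X_dense])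
    fix v assume v: "v \<in> opdom X"
    have "cmod (cinner (L y) v) \<le> norm y * (K * norm (opapp X v))" for y
    proof -
      have "cmod (cinner (L y) v) \<le> norm (fst (R y)) * norm (opapp X v)"
        unfolding L_def X_sym[OF R_dom' v] by (rule cinner_cauchy_schwarz)
      also have "norm (fst (R y)) \<le> K * norm y"
        using norm_fst_le_norm[of "R y"] K(2)[of y] by linarith
      finally show ?thesis
        by (simp add: mult_ac mult_right_mono)
    qed
    then show "\<exists>M. \<forall>y. cmod (cinner (L y) v) \<le> norm y * M" by blast
  qed
  then obtain M where "\<And>y. norm (L y) \<le> norm y * M"
    by blast
  then have L: "bounded_linear L"
    by (rule bounded_linear_intro[OF L_add L_scale])
  have hu: "h u \<in> opdom A'"
    using ric u by (auto simp: riccati_solution_def)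
  define x where "x = (u, h u)"
  have x: "x \<in> W \<sigma>" "x \<in> opdom T"
    using u hu by (auto simp: W x_def mem_opdom_T)
  \<comment> \<open>\<open>y\<close> lies in \<open>W \<sigma>\<close> and
    \<open>R y = (u, h u)\<close>. If elements \<open>g m\<close> of the span tend to
    \<open>y\<close>, then both \<open>R (g m)\<close> and \<open>X\<close> of their first
    components converge.\<close>
  define y where "y = opapp T x - z *\<^sub>C x"
  have "y \<in> W \<sigma>"
    using W_invariant[OF \<sigma>0] x unfolding y_def invariant_subspace_def
    by (intro csubspace_diff csubspace_scale csubspace_W) auto
  then obtain g where g: "\<And>m. g m \<in> ?E" "g \<longlonglongrightarrow> y"
    unfolding W_def by (auto simp: closure_sequential)
  have Ry: "R y = x"
    using RT[OF x(2)] by (simp add: y_def)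
  have lim1: "(\<lambda>m. fst (R (g m))) \<longlonglongrightarrow> u"
    using tendsto_fst[OF bounded_clinear_tendsto[OF Rb g(2)]] by (simp add: Ry x_def)
  have lim2: "(\<lambda>m. opapp X (fst (R (g m)))) \<longlonglongrightarrow> opapp X u"
    using bounded_linear.tendsto[OF L g(2)] by (simp add: L_def Ry x_def)
  have "(\<lambda>m. Re (b (R (g m)) (R (g m)))) \<longlonglongrightarrow> Re (\<sigma> * cinner (h u - opapp X u) u)"
    unfolding b_def
    by (intro tendsto_Re tendsto_mult tendsto_const tendsto_cinner tendsto_diff lim1 lim2
        bounded_clinear_tendsto[OF h(1)])
  moreover have "0 \<le> Re (b (R (g m)) (R (g m)))" for m
    by (rule on_E[OF resolvent_E[OF R g(1)]])
  ultimately have "0 \<le> Re (\<sigma> * cinner (h u - opapp X u) u)"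
    by (intro LIMSEQ_le_const) auto
  then show ?thesis
    by (simp add: cinner_algebra right_diff_distrib)
qed

text \<open>With \<open>X\<close> everywhere defined, the weak equation says that
  \<open>(A v | X u)\<close> equals \<open>(v | w)\<close> for a fixed \<open>w\<close> and all
  \<open>v\<close> in the domain of \<open>A\<close>, which is the definition of the adjoint at
  \<open>X u\<close>.\<close>

lemma weak_riccati_strong:
  assumes X: "bounded_operator X"
  shows "u \<in> opdom A \<Longrightarrow> opapp X u \<in> opdom A'" and "riccati_solution A B C X"
proof -
  have dom: "opdom X = UNIV" and Xb: "bounded_clinear (opapp X)"
    using X by (auto simp: bounded_operator_def)
  have *: "opapp X u \<in> opdom A'"
    "opapp A' (opapp X u) = opapp C u - opapp X (opapp A u) - opapp X (opapp B (opapp X u))"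
    if u: "u \<in> opdom A" for u
  proof -
    have eq: "cinner (opapp A v) (opapp X u)
        = cinner v (opapp C u - opapp X (opapp A u) - opapp X (opapp B (opapp X u)))" if v: "v \<in> opdom A" for v
    proof -
      have "cinner (opapp X u) (opapp A v)
          = cinner (opapp C u - opapp X (opapp A u) - opapp X (opapp B (opapp X u))) v"
        using weak[OF u v] by (simp add: cinner_algebra X_sym dom algebra_simps)
      then show ?thesis
        by (metis cinner_commute)
    qed
    show "opapp X u \<in> opdom A'"
      "opapp A' (opapp X u) = opapp C u - opapp X (opapp A u) - opapp X (opapp B (opapp X u))"
      using adjoint_opI[OF A_dense eq] by blast+
  qed
  then show "u \<in> opdom A \<Longrightarrow> opapp X u \<in> opdom A'" by blast
  show "riccati_solution A B C X"
    unfolding riccati_solution_def using * memB memC by (auto simp: dom)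
qed

text \<open>The inequalities are first known on the domain of \<open>A\<close> only. They bound the
  form there, which makes \<open>X\<close> bounded, and continuity then extends them to all
  vectors.\<close>

lemma weak_riccati_bounded:
  assumes closed: "closed_operator X"
    and Wp: "W 1 = range (\<lambda>u. (u, fp u))" "bounded_clinear fp" "\<And>u v. cinner (fp u) v = cinner u (fp v)"
      "riccati_solution A B C (Operator UNIV fp)"
    and Wm: "W (- 1) = range (\<lambda>u. (u, fm u))" "bounded_clinear fm" "\<And>u v. cinner (fm u) v = cinner u (fm v)"
      "riccati_solution A B C (Operator UNIV fm)"
  shows "bounded_operator X"
    and "Re (cinner (fm u) u) \<le> Re (cinner (opapp X u) u)" "Re (cinner (opapp X u) u) \<le> Re (cinner (fp u) u)"
proof -
  have between: "Re (cinner (fm u) u) \<le> Re (cinner (opapp X u) u)" "Re (cinner (opapp X u) u) \<le> Re (cinner (fp u) u)"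
    if "u \<in> opdom A" for u
    using weak_riccati_between[OF _ Wp that] weak_riccati_between[OF _ Wm that] by auto
  obtain cp cm where c: "cp > 0" "\<And>u. norm (fp u) \<le> cp * norm u" "cm > 0" "\<And>u. norm (fm u) \<le> cm * norm u"
    using bounded_clinear_bound[OF Wp(2)] bounded_clinear_bound[OF Wm(2)] by metis
  have "\<bar>Re (cinner (opapp X u) u)\<bar> \<le> (cp + cm) * (norm u)\<^sup>2" if "u \<in> opdom A" for u
  proof -
    have "Re (cinner (fp u) u) \<le> cp * norm u * norm u"
      by (rule order_trans[OF Re_cinner_le mult_right_mono[OF c(2)]]) simp
    moreover have "Re (cinner (- fm u) u) \<le> norm (- fm u) * norm u"
      by (rule Re_cinner_le)
    then have "- Re (cinner (fm u) u) \<le> norm (fm u) * norm u"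
      by simp
    moreover have "norm (fm u) * norm u \<le> cm * norm u * norm u"
      by (intro mult_right_mono c) simp
    moreover have "0 \<le> cp * norm u * norm u" "0 \<le> cm * norm u * norm u"
      using c by auto
    ultimately show ?thesis
      using between[OF that] by (simp add: power2_eq_square algebra_simps abs_le_iff)
  qed
  then show X: "bounded_operator X"
    using A_dense A_linear A_X c(1,3) closed X_symmetric
    by (intro bounded_operator_if_form_bounded[of X "opdom A" "cp + cm"])
      (auto simp: densely_defined_def linear_operator_csubspace)
  then have Xb: "bounded_clinear (opapp X)"
    by (simp add: bounded_operator_def)
  have "closed {u. Re (cinner (fm u) u) \<le> Re (cinner (opapp X u) u)}"
    "closed {u. Re (cinner (opapp X u) u) \<le> Re (cinner (fp u) u)}"
    using Xb Wp(2) Wm(2)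
    by (auto intro!: closed_Collect_le continuous_intros bounded_clinear_continuous_on)
  then have "closure (opdom A) \<subseteq> {u. Re (cinner (fm u) u) \<le> Re (cinner (opapp X u) u)}"
    "closure (opdom A) \<subseteq> {u. Re (cinner (opapp X u) u) \<le> Re (cinner (fp u) u)}"
    by (intro closure_minimal subsetI; simp add: between)+
  then show "Re (cinner (fm u) u) \<le> Re (cinner (opapp X u) u)" "Re (cinner (opapp X u) u) \<le> Re (cinner (fp u) u)"
    using A_dense by (auto simp: densely_defined_def)
qed

end


section \<open>Compact resolvent and compatibility\<close>

context hamiltonian
begin

text \<open>Compatibility of the graph is still to be shown, so invariance under \<open>R\<close>
  cannot come from root vectors. Instead \<open>(T - z) (w, f w) = (g, f g)\<close> is solved inside
  the graph: the first component asks for \<open>(A + B f - z) w = g\<close>, solvable because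
  \<open>B f (A - z)^(-1)\<close> is a contraction, and the second then follows from the Riccati
  equation.\<close>

lemma graph_resolvent_invariant:
  assumes r0: "r0_diagonally_dominant A B C"
    and f: "bounded_clinear f" and ric: "riccati_solution A B C (Operator UNIV f)"
  obtains \<epsilon> z R where "hamiltonian_resolvent \<epsilon> z R"
    "\<And>x. x \<in> range (\<lambda>u. (u, f u)) \<Longrightarrow> R x \<in> range (\<lambda>u. (u, f u))"
proof -
  obtain c where c: "c > 0" "\<And>u. norm (f u) \<le> c * norm u"
    by (rule bounded_clinear_bound[OF f]) blast
  \<comment> \<open>Small enough for \<open>\<beta> \<le> 1/4 * norm y + 1/4 * \<beta>\<close>
    below, which gives the contraction constant \<open>1/3\<close>.\<close>
  define \<epsilon> where "\<epsilon> = 1 / (4 * (c + 1))"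
  have \<epsilon>: "0 < \<epsilon>" "\<epsilon> \<le> 1" "\<epsilon> * c \<le> 1/4" "\<epsilon> * (\<epsilon> + c) \<le> 1/4"
  proof -
    show 1: "0 < \<epsilon>" "\<epsilon> \<le> 1" "\<epsilon> * c \<le> 1/4"
      using c(1) by (simp_all add: \<epsilon>_def field_simps)
    have "\<epsilon> * (\<epsilon> + c) \<le> \<epsilon> * (1 + c)"
      using 1 by (intro mult_left_mono) auto
    also have "\<dots> = 1/4"
      using c(1) by (simp add: \<epsilon>_def field_simps)
    finally show "\<epsilon> * (\<epsilon> + c) \<le> 1/4" .
  qed
  obtain z Q R where Q: "diagonal_resolvent \<epsilon> z Q" and R: "hamiltonian_resolvent \<epsilon> z R"
    by (rule resolvent_of_any_accuracy[OF r0 \<epsilon>(1)]) blast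
  have Qb: "bounded_clinear Q" and QT: "\<And>\<xi>. Q \<xi> \<in> opdom T" and GQ: "\<And>\<xi>. opapp G (Q \<xi>) - z *\<^sub>C Q \<xi> = \<xi>"
    and S: "\<And>x. x \<in> opdom T \<Longrightarrow> norm (opapp S x) \<le> \<epsilon> * norm (opapp G x - z *\<^sub>C x)"
    using Q unfolding diagonal_resolvent_def by blast+
  have RT: "\<And>x. x \<in> opdom T \<Longrightarrow> R (opapp T x - z *\<^sub>C x) = x"
    using R unfolding hamiltonian_resolvent_def by blast
  have zero: "0 \<in> opdom A" "0 \<in> opdom A'"
    using A_linear A'_linear by (auto intro: csubspace_0 linear_operator_csubspace)
  have B_small: "norm (opapp B v) \<le> \<epsilon> * norm (opapp A' v + z *\<^sub>C v)" if "v \<in> opdom A'" for v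
  proof -
    have "norm (- opapp A' v - z *\<^sub>C v) = norm (opapp A' v + z *\<^sub>C v)"
      by (metis minus_add norm_minus_cancel add_uminus_conv_diff add.commute)
    then show ?thesis
      using S[of "(0, v)"] that zero
      by (simp add: mem_opdom_T opapp_S opapp_G scaleC_Pair linear_operator_0[OF A_linear]
          linear_operator_0[OF BC_linear(2)] norm_Pair)
  qed
  have C_small: "norm (opapp C u) \<le> \<epsilon> * norm (opapp A u - z *\<^sub>C u)" if "u \<in> opdom A" for u
    using S[of "(u, 0)"] that zero
    by (simp add: mem_opdom_T opapp_S opapp_G scaleC_Pair linear_operator_0[OF A'_linear]
        linear_operator_0[OF BC_linear(1)] norm_Pair)
  have f_dom: "f u \<in> opdom A'" and f_ric: "opapp A' (f u) + f (opapp A u) + f (opapp B (f u)) - opapp C u = 0"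
    if "u \<in> opdom A" for u
    using ric that by (auto simp: riccati_solution_def)
  define RA where "RA y = fst (Q (y, 0))" for y
  have RA: "RA y \<in> opdom A" "opapp A (RA y) - z *\<^sub>C RA y = y" for y
    using QT[of "(y, 0)"] arg_cong[OF GQ[of "(y, 0)"], of fst]
    by (auto simp: RA_def mem_opdom_T opapp_G)
  have RA_diff: "RA (x - y) = RA x - RA y" for x y
    using bounded_clinear_diff[OF Qb, of "(x, 0)" "(y, 0)"] by (simp add: RA_def)
  have BfRA_diff: "opapp B (f (RA (x - y))) = opapp B (f (RA x)) - opapp B (f (RA y))" for x y
    using memB[OF f_dom[OF RA(1)]]
    by (simp add: RA_diff bounded_clinear_diff[OF f] linear_operator_diff[OF BC_linear(1)])
  have contr: "norm (opapp B (f (RA y))) \<le> 1/3 * norm y" for y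
  proof -
    define w where "w = RA y"
    define \<beta> where "\<beta> = norm (opapp B (f w))"
    have w: "w \<in> opdom A" "opapp A w - z *\<^sub>C w = y"
      using RA by (simp_all add: w_def)
    \<comment> \<open>No bound on \<open>A'\<close> after \<open>f\<close> is available directly;
      the Riccati equation expresses it through \<open>C w\<close>, \<open>f y\<close> and
      \<open>B (f w)\<close>. The last term is the one to be estimated and is absorbed.\<close>
    have "opapp A' (f w) + z *\<^sub>C f w = opapp C w - f (opapp A w - z *\<^sub>C w) - f (opapp B (f w))"
      using f_ric[OF w(1)] by (simp add: bounded_clinear_diff[OF f] bounded_clinear_scaleC[OF f] algebra_simps)
    then have "norm (opapp A' (f w) + z *\<^sub>C f w) \<le> norm (opapp C w) + norm (f y) + norm (f (opapp B (f w)))"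
      unfolding w(2) using norm_triangle_ineq4[of "opapp C w - f y" "f (opapp B (f w))"]
        norm_triangle_ineq4[of "opapp C w" "f y"] by simp
    also have "\<dots> \<le> \<epsilon> * norm y + c * norm y + c * \<beta>"
      using C_small[OF w(1)] c(2)[of y] c(2)[of "opapp B (f w)"] by (simp add: w(2) \<beta>_def)
    finally have "\<epsilon> * norm (opapp A' (f w) + z *\<^sub>C f w) \<le> \<epsilon> * (\<epsilon> * norm y + c * norm y + c * \<beta>)"
      using \<epsilon>(1) by (intro mult_left_mono) auto
    then have "\<beta> \<le> \<epsilon> * (\<epsilon> * norm y + c * norm y + c * \<beta>)"
      using B_small[OF f_dom[OF w(1)]] unfolding \<beta>_def by linarith
    also have "\<dots> = \<epsilon> * (\<epsilon> + c) * norm y + \<epsilon> * c * \<beta>"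
      by (simp add: algebra_simps)
    also have "\<dots> \<le> 1/4 * norm y + 1/4 * \<beta>"
      using \<epsilon> by (intro add_mono mult_right_mono) (auto simp: \<beta>_def)
    finally show ?thesis
      by (simp add: \<beta>_def w_def)
  qed
  have "R x \<in> range (\<lambda>u. (u, f u))" if x_graph: "x \<in> range (\<lambda>u. (u, f u))" for x
  proof -
    obtain g where x: "x = (g, f g)"
      using x_graph by auto
    have "norm (opapp B (f (RA x)) - opapp B (f (RA y))) \<le> 1/3 * norm (x - y)" for x y
      using contr[of "x - y"] by (simp add: BfRA_diff)
    then obtain y where y: "y + opapp B (f (RA y)) = g"
      using id_plus_contraction_surj[of "\<lambda>y. opapp B (f (RA y))" "1/3" g] by auto
    define w where "w = RA y"
    have w: "w \<in> opdom A" "opapp A w + opapp B (f w) - z *\<^sub>C w = g"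
      using RA[of y] y by (auto simp: w_def algebra_simps)
    have dom: "(w, f w) \<in> opdom T"
      using w(1) f_dom by (simp add: mem_opdom_T)
    have "opapp C w - opapp A' (f w) = f (opapp A w + opapp B (f w))"
      using f_ric[OF w(1)] by (simp add: bounded_clinear_add[OF f] algebra_simps)
    then have "opapp T (w, f w) - z *\<^sub>C (w, f w) = x"
      unfolding x w(2)[symmetric]
      by (simp add: opapp_T scaleC_Pair bounded_clinear_diff[OF f] bounded_clinear_scaleC[OF f])
    then have "R x = (w, f w)"
      using RT[OF dom] by simp
    then show ?thesis by simp
  qed
  then show thesis
    using that R by blast
qed

lemma graph_invariant:
  assumes f: "bounded_clinear f" and ric: "riccati_solution A B C (Operator UNIV f)"
  shows "invariant_subspace T (range (\<lambda>u. (u, f u)))"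
  unfolding invariant_subspace_def
proof (rule image_subsetI)
  fix x assume "x \<in> range (\<lambda>u. (u, f u)) \<inter> opdom T"
  then obtain u where x: "x = (u, f u)" "u \<in> opdom A"
    by (auto simp: mem_opdom_T)
  then have "opapp C u - opapp A' (f u) = f (opapp A u + opapp B (f u))"
    using ric by (auto simp: riccati_solution_def bounded_clinear_add[OF f] algebra_simps)
  then show "opapp T x \<in> range (\<lambda>u. (u, f u))"
    by (auto simp: x opapp_T)
qed

end

context riesz_hamiltonian
begin

section \<open>Finite families of chains and their projections\<close>

lemma norm_\<Phi>_e: "i \<in> Idx P \<Longrightarrow> norm (\<Phi> (e i)) = 1"
  using \<Phi>_e[of i i] subsetD[OF Idx_mono[of P]] by (simp add: norm_eq_sqrt_cinner)

text \<open>The leading vectors \<open>e (j, 0)\<close> are images, under the compact resolvent, of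
  a bounded set. Orthonormality under \<open>\<Phi>\<close> keeps any two of them more than
  \<open>1 / K1\<close> apart, so a finite cover by balls of radius \<open>1 / (2 * K1)\<close>
  contains at most one in each ball.\<close>

lemma finitely_many_near:
  assumes "has_compact_resolvent T"
  shows "finite {j \<in> J. 0 < n j \<and> cmod (\<zeta> j - z) \<le> r}" (is "finite ?F")
proof -
  obtain z0 where z0: "z0 \<in> resolvent_set T"
    and comp: "\<And>M. bounded M \<Longrightarrow> compact (closure (opapp (resolvent T z0) ` M))"
    using assms by (auto simp: has_compact_resolvent_def)
  have bij: "bij_betw (\<lambda>x. opapp T x - z0 *\<^sub>C x) (opdom T) UNIV"
    using z0 by (simp add: resolvent_set_def boundedly_invertible_def bij_betw_def inj_on_def image_def)
  have R0: "opapp (resolvent T z0) (opapp T x - z0 *\<^sub>C x) = x" if "x \<in> opdom T" for x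
    using inv_into_f_f[OF bij_betw_imp_inj_on[OF bij] that]
    by (simp add: resolvent_def inverse_op_def shift_op_def)
  obtain K1 K2 where K: "K1 > 0" "K2 > 0" "\<And>x. norm (\<Phi> x) \<le> K1 * norm x" "\<And>x. norm x \<le> K2 * norm (\<Phi> x)"
    by (rule \<Phi>_norms) blast
  define M where "M = (\<lambda>j. (\<zeta> j - z0) *\<^sub>C e (j, 0)) ` ?F"
  have idx: "(j, 0) \<in> Idx (\<lambda>_. True)" if "j \<in> ?F" for j
    using that by (simp add: Idx_def)
  have "bounded M"
    unfolding bounded_iff
  proof (intro exI ballI)
    fix x assume "x \<in> M"
    then obtain j where j: "j \<in> ?F" "x = (\<zeta> j - z0) *\<^sub>C e (j, 0)"
      by (auto simp: M_def)
    have "cmod (\<zeta> j - z0) \<le> r + cmod (z - z0)"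
      using j(1) norm_triangle_ineq[of "\<zeta> j - z" "z - z0"] by simp
    moreover have "norm (e (j, 0)) \<le> K2"
      using K(4)[of "e (j, 0)"] norm_\<Phi>_e[OF idx[OF j(1)]] by simp
    ultimately show "norm x \<le> (r + cmod (z - z0)) * K2"
      unfolding j(2) norm_scaleC by (intro mult_mono) (auto intro: order_trans[OF norm_ge_zero])
  qed
  from comp[OF this] have "compact (closure (opapp (resolvent T z0) ` M))" .
  then have tot: "\<forall>d>0. \<exists>k. finite k \<and> k \<subseteq> closure (opapp (resolvent T z0) ` M) \<and>
      closure (opapp (resolvent T z0) ` M) \<subseteq> (\<Union>x\<in>k. ball x d)"
    by (intro seq_compact_imp_totally_bounded) (simp add: compact_eq_seq_compact_metric)
  have "0 < 1 / (2 * K1)"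
    using K(1) by simp
  from tot[rule_format, OF this] obtain k where k: "finite k"
    "closure (opapp (resolvent T z0) ` M) \<subseteq> (\<Union>x\<in>k. ball x (1 / (2 * K1)))"
    by (elim exE conjE)
  have "e (j, 0) \<in> closure (opapp (resolvent T z0) ` M)" if j: "j \<in> ?F" for j
  proof -
    have "opapp T (e (j, 0)) - z0 *\<^sub>C e (j, 0) = (\<zeta> j - z0) *\<^sub>C e (j, 0)"
      using j e_chain[of j 0] by (simp add: scaleC_diff_left)
    then have "e (j, 0) = opapp (resolvent T z0) ((\<zeta> j - z0) *\<^sub>C e (j, 0))"
      using R0[OF e_opdom[OF idx[OF j]]] by simp
    then have "e (j, 0) \<in> opapp (resolvent T z0) ` M"
      using j unfolding M_def by blast
    then show ?thesis
      by (rule subsetD[OF closure_subset])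
  qed
  then have "\<forall>j\<in>?F. \<exists>x. x \<in> k \<and> dist x (e (j, 0)) < 1 / (2 * K1)"
    using k(2) unfolding subset_iff UN_iff mem_ball by blast
  then obtain g where "\<forall>j\<in>?F. g j \<in> k \<and> dist (g j) (e (j, 0)) < 1 / (2 * K1)"
    by (rule bchoice[THEN exE])
  then have g: "\<And>j. j \<in> ?F \<Longrightarrow> g j \<in> k" "\<And>j. j \<in> ?F \<Longrightarrow> dist (g j) (e (j, 0)) < 1 / (2 * K1)"
    by blast+
  have "inj_on g ?F"
  proof (rule inj_onI, rule ccontr)
    fix j j' assume j: "j \<in> ?F" "j' \<in> ?F" "g j = g j'" "j \<noteq> j'"
    have "dist (e (j, 0)) (e (j', 0)) < 1 / (2 * K1) + 1 / (2 * K1)"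
      using g(2)[OF j(1)] g(2)[OF j(2)] dist_triangle3[of "e (j, 0)" "e (j', 0)" "g j"]
      by (simp add: j(3))
    then have less: "K1 * norm (e (j, 0) - e (j', 0)) < 1"
      using K(1) by (simp add: dist_norm field_simps)
    have "cinner (\<Phi> (e (j, 0))) (\<Phi> (e (j', 0))) = 0"
      using \<Phi>_e[of "(j, 0)" "(j', 0)"] j by simp
    then have "(norm (\<Phi> (e (j, 0) - e (j', 0))))\<^sup>2 = 2"
      using norm_\<Phi>_e[OF idx[OF j(1)]] norm_\<Phi>_e[OF idx[OF j(2)]]
      by (simp add: bounded_clinear_diff[OF \<Phi>_bounded] norm_diff_square)
    moreover have "norm (\<Phi> (e (j, 0) - e (j', 0))) < 1"
      using K(3) less by (rule le_less_trans)
    then have "(norm (\<Phi> (e (j, 0) - e (j', 0))))\<^sup>2 \<le> 1"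
      by (simp add: power_le_one)
    ultimately show False by simp
  qed
  moreover have "g ` ?F \<subseteq> k"
    using g(1) by blast
  ultimately show ?thesis
    using k(1) finite_subset finite_imageD by blast
qed

text \<open>The projection to \<open>E P\<close> that \<open>\<Phi>\<close> makes orthogonal. If
  \<open>Idx P\<close> is infinite, the sum is 0 by convention; hence the finiteness assumptions
  below.\<close>

definition proj :: "(nat \<Rightarrow> bool) \<Rightarrow> 'a \<times> 'a \<Rightarrow> 'a \<times> 'a" where
  "proj P x = (\<Sum>i\<in>Idx P. cinner (\<Phi> x) (\<Phi> (e i)) *\<^sub>C e i)"

lemma proj_mem: "proj P x \<in> E P"
  unfolding proj_def
  by (intro csubspace_sum[OF csubspace_E] csubspace_scale[OF csubspace_E] e_in_E)

lemma bounded_clinear_proj: "bounded_clinear (proj P)"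
proof -
  obtain K where K: "K > 0" "\<And>x. norm (\<Phi> x) \<le> K * norm x"
    by (rule bounded_clinear_bound[OF \<Phi>_bounded]) blast
  show ?thesis
  proof (rule bounded_clinearI)
    show "proj P (x + y) = proj P x + proj P y" for x y
      by (simp add: proj_def bounded_clinear_add[OF \<Phi>_bounded] cinner_add_left scaleC_add_left sum.distrib)
    show "proj P (c *\<^sub>C x) = c *\<^sub>C proj P x" for c x
      by (simp add: proj_def bounded_clinear_scaleC[OF \<Phi>_bounded] cinner_scaleC_left scaleC_sum_right scaleC_scaleC)
    show "norm (proj P x) \<le> norm x * (\<Sum>i\<in>Idx P. K * norm (\<Phi> (e i)) * norm (e i))" for x
    proof -
      have "norm (proj P x) \<le> (\<Sum>i\<in>Idx P. norm (cinner (\<Phi> x) (\<Phi> (e i)) *\<^sub>C e i))"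
        unfolding proj_def by (rule norm_sum)
      also have "\<dots> \<le> (\<Sum>i\<in>Idx P. (K * norm x * norm (\<Phi> (e i))) * norm (e i))"
        unfolding norm_scaleC
        by (intro sum_mono mult_right_mono norm_ge_zero order_trans[OF cinner_cauchy_schwarz] K)
      also have "\<dots> = norm x * (\<Sum>i\<in>Idx P. K * norm (\<Phi> (e i)) * norm (e i))"
        by (simp add: sum_distrib_left mult_ac)
      finally show ?thesis .
    qed
  qed
qed

lemma proj_id:
  assumes fin: "finite (Idx P)" and x: "x \<in> closure (E P)"
  shows "proj P x = x"
proof -
  have "proj P (e l) = e l" if l: "l \<in> Idx P" for l
  proof -
    have "proj P (e l) = (\<Sum>i\<in>Idx P. (if l = i then 1 else 0) *\<^sub>C e i)"
      unfolding proj_def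
    proof (intro sum.cong refl arg_cong2[of _ _ _ _ scaleC])
      fix i assume "i \<in> Idx P"
      then show "cinner (\<Phi> (e l)) (\<Phi> (e i)) = (if l = i then 1 else 0)"
        using l Idx_mono[of P] by (intro \<Phi>_e) blast+
    qed
    also have "\<dots> = (\<Sum>i\<in>Idx P. if l = i then e i else 0)"
      by (intro sum.cong) auto
    also have "\<dots> = e l"
      using fin l by (simp add: sum.delta)
    finally show ?thesis .
  qed
  then have "e ` Idx P \<subseteq> {x. proj P x = x}"
    by auto
  moreover have "csubspace {x. proj P x = x}"
    using bounded_clinear_proj[of P]
    by (intro csubspaceI) (simp_all add: bounded_clinear_0 bounded_clinear_add bounded_clinear_scaleC)
  moreover have "closed {x. proj P x = x}"
    by (intro closed_Collect_eq continuous_intros bounded_clinear_continuous_on bounded_clinear_proj)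
  ultimately have "closure (E P) \<subseteq> {x. proj P x = x}"
    unfolding E_def by (rule closure_cspan_minimal)
  then show ?thesis using x by auto
qed

lemma proj_zero:
  assumes "x \<in> closure (E (\<lambda>j. \<not> P j))"
  shows "proj P x = 0"
  unfolding proj_def
proof (rule sum.neutral, rule ballI)
  fix i assume "i \<in> Idx P"
  then have "e i \<in> closure (E P)"
    using closure_subset e_in_E by blast
  then have "cinner (\<Phi> x) (\<Phi> (e i)) = 0"
    using \<Phi>_orthogonal[of "\<lambda>j. \<not> P j" P x "e i"] assms by blast
  then show "cinner (\<Phi> x) (\<Phi> (e i)) *\<^sub>C e i = 0" by simp
qed

lemma proj_complement:
  assumes "finite (Idx P)"
  shows "x - proj P x \<in> closure (E (\<lambda>j. \<not> P j))"
proof -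
  obtain p q where pq: "p \<in> closure (E P)" "q \<in> closure (E (\<lambda>j. \<not> P j))" "x = p + q"
    using decomposition_exists[of P x] by blast
  then have "proj P x = p"
    using proj_id[OF assms pq(1)] proj_zero[OF pq(2)]
    by (simp add: bounded_clinear_add[OF bounded_clinear_proj])
  then show ?thesis using pq by simp
qed

lemma proj_best:
  assumes "finite (Idx P)" "f \<in> E P"
  shows "norm (\<Phi> (x - proj P x)) \<le> norm (\<Phi> (x - f))"
proof -
  \<comment> \<open>The double negation fits \<open>\<Phi>_pythagoras\<close>, here used for the
    complement of \<open>P\<close> and with the roles of the two parts exchanged.\<close>
  have "proj P x - f \<in> closure (E (\<lambda>j. \<not> \<not> P j))"
    unfolding not_not by (rule subsetD[OF closure_subset csubspace_diff[OF csubspace_E proj_mem assms(2)]])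
  from \<Phi>_pythagoras[OF proj_complement[OF assms(1), of x] this] show ?thesis
    by simp
qed

text \<open>Apply \<open>T - z\<close> to \<open>R x\<close>: the diagonal part enlarges
  \<open>norm (\<Phi> (R x))\<close> at least by the factor \<open>r\<close>, and the shift takes
  away at most the factor 1.\<close>

lemma resolvent_tail_bound:
  assumes R: "hamiltonian_resolvent \<epsilon> z R" and r: "0 \<le> r"
    and x: "x \<in> closure (E (\<lambda>j. \<not> cmod (\<zeta> j - z) \<le> r))" (is "x \<in> closure (E ?P)")
  shows "(r - 1) * norm (\<Phi> (R x)) \<le> norm (\<Phi> x)"
proof -
  have Rb: "bounded_clinear R" and TR: "\<And>\<xi>. opapp T (R \<xi>) - z *\<^sub>C R \<xi> = \<xi>"
    using R unfolding hamiltonian_resolvent_def by blast+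
  have "(r - 1) * norm (\<Phi> (R x)) \<le> norm (\<Phi> x)" if x: "x \<in> E ?P" for x
  proof -
    obtain F c y where F: "finite F" "F \<subseteq> {j \<in> J. ?P j}"
      and Rx: "R x = (\<Sum>i\<in>(SIGMA j:F. {..<n j}). c i *\<^sub>C e i)"
      and TRx: "opapp T (R x) = (\<Sum>i\<in>(SIGMA j:F. {..<n j}). (\<zeta> (fst i) * c i) *\<^sub>C e i) + y"
      and y: "norm (\<Phi> y) \<le> norm (\<Phi> (R x))"
      using T_diagonal_plus_contraction[OF resolvent_E[OF R x]] .
    let ?I = "SIGMA j:F. {..<n j}"
    have FJ: "F \<subseteq> J"
      using F by auto
    define d where "d = (\<Sum>i\<in>?I. ((\<zeta> (fst i) - z) * c i) *\<^sub>C e i)"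
    have "x = opapp T (R x) - z *\<^sub>C R x"
      by (simp add: TR)
    also have "\<dots> = d + y"
      unfolding TRx unfolding Rx d_def
      by (simp add: scaleC_sum_right scaleC_scaleC left_diff_distrib scaleC_diff_left sum_subtractf)
    finally have x_eq: "x = d + y" .
    have "(r * norm (\<Phi> (R x)))\<^sup>2 = (\<Sum>i\<in>?I. r\<^sup>2 * (cmod (c i))\<^sup>2)"
      unfolding power_mult_distrib Rx norm_\<Phi>_sum_square[OF F(1) FJ] by (simp add: sum_distrib_left)
    also have "\<dots> \<le> (\<Sum>i\<in>?I. (cmod ((\<zeta> (fst i) - z) * c i))\<^sup>2)"
    proof (rule sum_mono)
      fix i assume "i \<in> ?I"
      then have "r \<le> cmod (\<zeta> (fst i) - z)"
        using F(2) by auto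
      then have "r\<^sup>2 \<le> (cmod (\<zeta> (fst i) - z))\<^sup>2"
        using r by (intro power_mono)
      then show "r\<^sup>2 * (cmod (c i))\<^sup>2 \<le> (cmod ((\<zeta> (fst i) - z) * c i))\<^sup>2"
        by (simp add: norm_mult power_mult_distrib mult_right_mono)
    qed
    also have "\<dots> = (norm (\<Phi> d))\<^sup>2"
      unfolding d_def norm_\<Phi>_sum_square[OF F(1) FJ] ..
    finally have "r * norm (\<Phi> (R x)) \<le> norm (\<Phi> d)"
      by (rule power2_le_imp_le) simp
    moreover have "norm (\<Phi> d) \<le> norm (\<Phi> x) + norm (\<Phi> y)"
      using norm_triangle_ineq4[of "\<Phi> x" "\<Phi> y"] by (simp add: x_eq bounded_clinear_add[OF \<Phi>_bounded])
    ultimately show ?thesis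
      using y by (simp add: left_diff_distrib)
  qed
  then have "E ?P \<subseteq> {x. (r - 1) * norm (\<Phi> (R x)) \<le> norm (\<Phi> x)}"
    by blast
  moreover have "continuous_on UNIV (\<lambda>x. \<Phi> (R x))"
    using continuous_on_compose2[OF bounded_clinear_continuous_on[OF \<Phi>_bounded, of UNIV]
        bounded_clinear_continuous_on[OF Rb, of UNIV]] by auto
  then have "closed {x. (r - 1) * norm (\<Phi> (R x)) \<le> norm (\<Phi> x)}"
    by (intro closed_Collect_le continuous_intros bounded_clinear_continuous_on[OF \<Phi>_bounded])
  ultimately have "closure (E ?P) \<subseteq> {x. (r - 1) * norm (\<Phi> (R x)) \<le> norm (\<Phi> x)}"
    by (rule closure_minimal)
  then show ?thesis using x by auto
qed

section \<open>Operators that are triangular on every chain\<close>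

definition chain_span :: "nat \<Rightarrow> nat \<Rightarrow> ('a \<times> 'a) set" where
  "chain_span j k = cspan (e ` ({j} \<times> {..<k}))"

text \<open>On chain \<open>j\<close> the map \<open>Q\<close> is upper triangular with constant
  diagonal \<open>c\<close>. For a polynomial in the resolvent, \<open>c\<close> is the value of the
  polynomial at \<open>1 / (\<zeta> j - z)\<close>.\<close>

definition triangular :: "('a \<times> 'a \<Rightarrow> 'a \<times> 'a) \<Rightarrow> nat \<Rightarrow> complex \<Rightarrow> bool" where
  "triangular Q j c \<longleftrightarrow> (\<forall>k<n j. Q (e (j, k)) - c *\<^sub>C e (j, k) \<in> chain_span j k)"

lemma csubspace_chain_span: "csubspace (chain_span j k)"
  by (simp add: chain_span_def csubspace_cspan)

lemma chain_span_mono: "k \<le> k' \<Longrightarrow> chain_span j k \<subseteq> chain_span j k'"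
  unfolding chain_span_def by (intro complex_vector.span_mono) auto

lemma e_in_chain_span: "i < k \<Longrightarrow> e (j, i) \<in> chain_span j k"
  unfolding chain_span_def by (intro complex_vector.span_base) auto

lemma chain_span_0: "chain_span j 0 = {0}"
  by (simp add: chain_span_def)

lemma chain_span_map:
  assumes Q: "bounded_clinear Q" and "\<And>i. i < k \<Longrightarrow> Q (e (j, i)) \<in> M" and "csubspace M"
    and x: "x \<in> chain_span j k"
  shows "Q x \<in> M"
proof -
  have "csubspace {x. Q x \<in> M}"
    by (intro clinear_vimage_csubspace assms)
      (simp_all add: bounded_clinear_add[OF Q] bounded_clinear_scaleC[OF Q])
  then have "chain_span j k \<subseteq> {x. Q x \<in> M}"
    unfolding chain_span_def using assms(2) by (intro complex_vector.span_minimal) auto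
  then show ?thesis using x by auto
qed

lemma triangular_chain_span:
  assumes Q: "bounded_clinear Q" "triangular Q j c" and k: "k \<le> n j" and x: "x \<in> chain_span j k"
  shows "Q x \<in> chain_span j k"
proof (rule chain_span_map[OF Q(1) _ csubspace_chain_span x])
  fix i assume i: "i < k"
  then have "Q (e (j, i)) - c *\<^sub>C e (j, i) \<in> chain_span j k"
    using Q(2) k chain_span_mono[of i k j] by (auto simp: triangular_def)
  then have "(Q (e (j, i)) - c *\<^sub>C e (j, i)) + c *\<^sub>C e (j, i) \<in> chain_span j k"
    using e_in_chain_span[OF i] by (intro csubspace_add csubspace_scale csubspace_chain_span)
  then show "Q (e (j, i)) \<in> chain_span j k" by simp
qed

text \<open>With zero diagonal each application shortens the initial piece of the chain by one, so
  as many applications as the chain has members kill it.\<close>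

lemma triangular_nilpotent:
  assumes Q: "bounded_clinear Q" "triangular Q j 0" and x: "x \<in> chain_span j (n j)" and m: "n j \<le> m"
  shows "(Q ^^ m) x = 0"
proof -
  have "(Q ^^ m) x \<in> chain_span j (n j - m)" for m
  proof (induction m)
    case (Suc m)
    show ?case
    proof (cases "n j - m")
      case 0
      then show ?thesis
        using Suc bounded_clinear_0[OF Q(1)] by (simp add: chain_span_0)
    next
      case (Suc k)
      have "Q ((Q ^^ m) x) \<in> chain_span j k"
      proof (rule chain_span_map[OF Q(1) _ csubspace_chain_span])
        show "(Q ^^ m) x \<in> chain_span j (Suc k)"
          using Suc.IH by (simp add: Suc)
        fix i assume "i < Suc k"
        then show "Q (e (j, i)) \<in> chain_span j k"
          using Q(2) Suc chain_span_mono[of i k j] by (auto simp: triangular_def)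
      qed
      moreover have "n j - Suc m = k"
        using Suc by simp
      ultimately show ?thesis by simp
    qed
  qed (simp add: x)
  from this[of m] show ?thesis
    using m by (simp add: chain_span_0)
qed

lemma triangular_id: "triangular (\<lambda>x. x) j 1"
  using csubspace_0[OF csubspace_chain_span] by (simp add: triangular_def)

lemma triangular_comp:
  assumes Q: "bounded_clinear Q" "triangular Q j c" and Q': "triangular Q' j c'"
  shows "triangular (\<lambda>x. Q (Q' x)) j (c * c')"
  unfolding triangular_def
proof (intro allI impI)
  fix k assume k: "k < n j"
  have "Q (Q' (e (j, k)) - c' *\<^sub>C e (j, k)) + c' *\<^sub>C (Q (e (j, k)) - c *\<^sub>C e (j, k)) \<in> chain_span j k"
    using k Q(2) Q' triangular_chain_span[OF Q, of k]
    by (intro csubspace_add csubspace_scale csubspace_chain_span) (auto simp: triangular_def)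
  then show "Q (Q' (e (j, k))) - (c * c') *\<^sub>C e (j, k) \<in> chain_span j k"
    by (simp add: bounded_clinear_diff[OF Q(1)] bounded_clinear_scaleC[OF Q(1)] scaleC_diff_right
        scaleC_scaleC mult.commute)
qed

lemma triangular_funpow:
  assumes "bounded_clinear Q" "triangular Q j c"
  shows "triangular (Q ^^ m) j (c ^ m)"
proof (induction m)
  case 0
  show ?case using triangular_id by (simp add: id_def)
next
  case (Suc m)
  then show ?case
    using triangular_comp[OF assms Suc.IH] by (simp add: comp_def)
qed

lemma triangular_affine:
  assumes "triangular Q j c"
  shows "triangular (\<lambda>x. t *\<^sub>C (Q x - d *\<^sub>C x)) j (t * (c - d))"
  unfolding triangular_def
proof (intro allI impI)
  fix k assume "k < n j"
  then have "t *\<^sub>C (Q (e (j, k)) - c *\<^sub>C e (j, k)) \<in> chain_span j k"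
    using assms by (intro csubspace_scale csubspace_chain_span) (auto simp: triangular_def)
  then show "t *\<^sub>C (Q (e (j, k)) - d *\<^sub>C e (j, k)) - (t * (c - d)) *\<^sub>C e (j, k) \<in> chain_span j k"
    by (simp add: scaleC_diff_right scaleC_scaleC scaleC_diff_left right_diff_distrib)
qed

lemma triangular_id_minus:
  assumes "triangular Q j c"
  shows "triangular (\<lambda>x. x - Q x) j (1 - c)"
  using triangular_affine[OF assms, of "- 1" 1] by simp

text \<open>Applying \<open>R\<close> to the chain relation expresses \<open>R (e (j, k))\<close>
  through \<open>e (j, k)\<close> and \<open>R (e (j, k - 1))\<close>, so the claim follows along
  the chain.\<close>

lemma triangular_resolvent:
  assumes R: "hamiltonian_resolvent \<epsilon> z R" and j: "j \<in> J" "0 < n j"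
  shows "\<zeta> j \<noteq> z" "triangular R j (1 / (\<zeta> j - z))"
proof -
  have Rb: "bounded_clinear R" and RT: "\<And>x. x \<in> opdom T \<Longrightarrow> R (opapp T x - z *\<^sub>C x) = x"
    using R unfolding hamiltonian_resolvent_def by blast+
  have dom: "e (j, k) \<in> opdom T" if "k < n j" for k
    using that j by (intro e_opdom[of _ "\<lambda>_. True"]) (simp add: Idx_def)
  have step: "e (j, k) = (\<zeta> j - z) *\<^sub>C R (e (j, k)) + (if k = 0 then 0 else R (e (j, k - 1)))" if "k < n j" for k
  proof -
    have "opapp T (e (j, k)) - z *\<^sub>C e (j, k) = (\<zeta> j - z) *\<^sub>C e (j, k) + (if k = 0 then 0 else e (j, k - 1))"
      using that j by (simp add: e_chain scaleC_diff_left)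
    then have "e (j, k) = R ((\<zeta> j - z) *\<^sub>C e (j, k) + (if k = 0 then 0 else e (j, k - 1)))"
      using RT[OF dom[OF that]] by simp
    then show ?thesis
      by (cases "k = 0") (simp_all add: bounded_clinear_add[OF Rb] bounded_clinear_scaleC[OF Rb])
  qed
  have "e (j, 0) \<noteq> 0"
    using \<Phi>_e[of "(j, 0)" "(j, 0)"] j bounded_clinear_0[OF \<Phi>_bounded] by auto
  then show ne: "\<zeta> j \<noteq> z"
    using step[of 0] j by auto
  have "R (e (j, k)) - (1 / (\<zeta> j - z)) *\<^sub>C e (j, k) \<in> chain_span j k" if "k < n j" for k
    using that
  proof (induction k)
    case 0
    have "(1 / (\<zeta> j - z)) *\<^sub>C e (j, 0) = (1 / (\<zeta> j - z)) *\<^sub>C (\<zeta> j - z) *\<^sub>C R (e (j, 0))"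
      using step[OF 0] by simp
    also have "\<dots> = R (e (j, 0))"
      using ne by (simp add: scaleC_scaleC)
    finally show ?case
      by (simp add: chain_span_0)
  next
    case (Suc k)
    then have "R (e (j, k)) - (1 / (\<zeta> j - z)) *\<^sub>C e (j, k) \<in> chain_span j (Suc k)"
      using chain_span_mono[of k "Suc k" j] by auto
    then have "(R (e (j, k)) - (1 / (\<zeta> j - z)) *\<^sub>C e (j, k)) + (1 / (\<zeta> j - z)) *\<^sub>C e (j, k) \<in> chain_span j (Suc k)"
      by (intro csubspace_add csubspace_scale csubspace_chain_span e_in_chain_span) auto
    then have *: "- (1 / (\<zeta> j - z)) *\<^sub>C R (e (j, k)) \<in> chain_span j (Suc k)"
      by (intro csubspace_scale csubspace_chain_span) simp
    have "(1 / (\<zeta> j - z)) *\<^sub>C e (j, Suc k)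
        = (1 / (\<zeta> j - z)) *\<^sub>C ((\<zeta> j - z) *\<^sub>C R (e (j, Suc k)) + R (e (j, k)))"
      using step[OF Suc.prems] by simp
    also have "\<dots> = R (e (j, Suc k)) + (1 / (\<zeta> j - z)) *\<^sub>C R (e (j, k))"
      using ne by (simp add: scaleC_add_right scaleC_scaleC)
    finally have "R (e (j, Suc k)) - (1 / (\<zeta> j - z)) *\<^sub>C e (j, Suc k) = - (1 / (\<zeta> j - z)) *\<^sub>C R (e (j, k))"
      by simp
    then show ?case
      using * by simp
  qed
  then show "triangular R j (1 / (\<zeta> j - z))"
    by (simp add: triangular_def)
qed

text \<open>Stands for the polynomials in the resolvent: the class is closed under composition and
  affine changes, and it retains the two properties used of them, invariance of \<open>U\<close> and
  triangularity on chains.\<close>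

definition admissible :: "('a \<times> 'a) set \<Rightarrow> ('a \<times> 'a \<Rightarrow> 'a \<times> 'a) \<Rightarrow> bool" where
  "admissible U Q \<longleftrightarrow> bounded_clinear Q \<and> (\<forall>x\<in>U. Q x \<in> U) \<and> (\<forall>j\<in>J. 0 < n j \<longrightarrow> (\<exists>c. triangular Q j c))"

lemma bounded_clinear_comp:
  assumes Q: "bounded_clinear Q" and Q': "bounded_clinear Q'"
  shows "bounded_clinear (\<lambda>x. Q (Q' x))"
  using bounded_linear_compose[of Q Q'] assms by (auto simp: bounded_clinear_def)

lemma admissible_id: "admissible U (\<lambda>x. x)"
  using triangular_id by (auto simp: admissible_def bounded_clinear_def bounded_linear_ident)

lemma admissible_comp:
  assumes "admissible U Q" "admissible U Q'"
  shows "admissible U (\<lambda>x. Q (Q' x))"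
  using assms triangular_comp[of Q] bounded_clinear_comp[of Q Q'] unfolding admissible_def by blast

lemma admissible_funpow:
  assumes "admissible U Q"
  shows "admissible U (Q ^^ m)"
proof (induction m)
  case 0
  show ?case using admissible_id by (simp add: id_def)
next
  case (Suc m)
  then show ?case using admissible_comp[OF assms Suc.IH] by (simp add: comp_def)
qed

lemma admissible_affine:
  assumes Q: "admissible U Q" and U: "csubspace U"
  shows "admissible U (\<lambda>x. t *\<^sub>C (Q x - d *\<^sub>C x))"
proof -
  have Sb: "bounded_clinear Q" and SU: "\<And>x. x \<in> U \<Longrightarrow> Q x \<in> U"
    and St: "\<And>j. j \<in> J \<Longrightarrow> 0 < n j \<Longrightarrow> \<exists>c. triangular Q j c"
    using Q by (auto simp: admissible_def)
  have "bounded_linear (\<lambda>x. t *\<^sub>C (Q x - d *\<^sub>C x))"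
    using Sb unfolding bounded_clinear_def
    by (intro bounded_linear_compose[OF bounded_linear_scaleC] bounded_linear_sub bounded_linear_scaleC) auto
  then have "bounded_clinear (\<lambda>x. t *\<^sub>C (Q x - d *\<^sub>C x))"
    using bounded_clinear_scaleC[OF Sb]
    by (simp add: bounded_clinear_def scaleC_diff_right scaleC_scaleC mult_ac)
  moreover have "t *\<^sub>C (Q x - d *\<^sub>C x) \<in> U" if "x \<in> U" for x
    using that by (intro csubspace_scale csubspace_diff U SU)
  ultimately show ?thesis
    unfolding admissible_def using St triangular_affine by blast
qed

lemma admissible_id_minus:
  assumes "admissible U Q" "csubspace U"
  shows "admissible U (\<lambda>x. x - Q x)"
  using admissible_affine[OF assms, of "- 1" 1] by simp

text \<open>
  The polynomial \<open>1 - (1 - t\<^sup>m)\<^sup>N\<close> vanishes to order \<open>m\<close> at \<open>0\<close> and takes the value \<open>1\<close> to order \<open>N\<close>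
  at \<open>1\<close>, so nilpotent parts do not matter at these two eigenvalues.
\<close>

definition sieve :: "nat \<Rightarrow> nat \<Rightarrow> ('a \<times> 'a \<Rightarrow> 'a \<times> 'a) \<Rightarrow> 'a \<times> 'a \<Rightarrow> 'a \<times> 'a" where
  "sieve m N Q x = x - ((\<lambda>x. x - (Q ^^ m) x) ^^ N) x"

lemma admissible_sieve:
  assumes "admissible U Q" "csubspace U"
  shows "admissible U (sieve m N Q)"
proof -
  have "admissible U (\<lambda>x. x - ((\<lambda>x. x - (Q ^^ m) x) ^^ N) x)"
    by (intro admissible_id_minus admissible_funpow assms)
  then show ?thesis
    by (simp add: sieve_def[abs_def])
qed

lemma sieve_one:
  assumes Q: "admissible U Q" "csubspace U" and "triangular Q j 1" and x: "x \<in> chain_span j (n j)" and "n j \<le> N"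
  shows "sieve m N Q x = x"
proof -
  have Sb: "bounded_clinear Q"
    using Q(1) by (simp add: admissible_def)
  have "triangular (\<lambda>x. x - (Q ^^ m) x) j 0"
    using triangular_id_minus[OF triangular_funpow[OF Sb assms(3)]] by simp
  moreover have "bounded_clinear (\<lambda>x. x - (Q ^^ m) x)"
    using admissible_id_minus[OF admissible_funpow[OF Q(1)] Q(2)] by (simp add: admissible_def)
  ultimately show ?thesis
    using triangular_nilpotent x assms(5) by (simp add: sieve_def)
qed

lemma sieve_zero:
  assumes Q: "bounded_clinear Q" "triangular Q j 0" and x: "x \<in> chain_span j (n j)" and "n j \<le> N"
  shows "sieve N N Q x = 0"
proof -
  have "(Q ^^ N) x = 0"
    by (rule triangular_nilpotent[OF assms])
  then have "((\<lambda>x. x - (Q ^^ N) x) ^^ m) x = x" for m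
    by (induction m) simp_all
  then show ?thesis by (simp add: sieve_def)
qed

text \<open>For fixed \<open>N\<close>, the powers \<open>Q^m\<close> tend to 0 on \<open>M\<close>,
  so \<open>(1 - Q^m)^N\<close> tends strongly to the identity there, and the sieve to 0.\<close>

lemma sieve_tail:
  assumes Q: "bounded_clinear Q" and M: "csubspace M" "\<And>y. y \<in> M \<Longrightarrow> Q y \<in> M"
    and contr: "\<And>y. y \<in> M \<Longrightarrow> norm (\<Phi> (Q y)) \<le> 1/2 * norm (\<Phi> y)" and y: "y \<in> M"
  shows "(\<lambda>m. sieve m N Q y) \<longlonglongrightarrow> 0"
proof -
  obtain K1 K2 where K: "K1 > 0" "K2 > 0" "\<And>x. norm (\<Phi> x) \<le> K1 * norm x" "\<And>x. norm x \<le> K2 * norm (\<Phi> x)"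
    by (rule \<Phi>_norms) blast
  have pow: "(Q ^^ m) y \<in> M \<and> norm (\<Phi> ((Q ^^ m) y)) \<le> (1/2) ^ m * norm (\<Phi> y)" if "y \<in> M" for m y
  proof (induction m)
    case (Suc m)
    then have "norm (\<Phi> (Q ((Q ^^ m) y))) \<le> 1/2 * ((1/2) ^ m * norm (\<Phi> y))"
      using contr[of "(Q ^^ m) y"] by linarith
    then show ?case
      using Suc M(2) by simp
  qed (simp add: that)
  define a where "a N m = ((\<lambda>x. x - (Q ^^ m) x) ^^ N) y" for N m
  have "(\<forall>m. a N m \<in> M) \<and> (\<lambda>m. a N m) \<longlonglongrightarrow> y" for N
  proof (induction N)
    case 0
    show ?case by (simp add: a_def y)
  next
    case (Suc N)
    have a_Suc: "a (Suc N) m = a N m - (Q ^^ m) (a N m)" for m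
      by (simp add: a_def)
    have "(\<lambda>m. K2 * K1 * ((1/2) ^ m * norm (a N m))) \<longlonglongrightarrow> K2 * K1 * (0 * norm y)"
      using Suc.IH by (intro tendsto_intros LIMSEQ_realpow_zero) auto
    then have lim0: "(\<lambda>m. K2 * K1 * ((1/2) ^ m * norm (a N m))) \<longlonglongrightarrow> 0"
      by simp
    have "norm ((Q ^^ m) (a N m)) \<le> K2 * K1 * ((1/2) ^ m * norm (a N m))" for m
    proof -
      have "norm ((Q ^^ m) (a N m)) \<le> K2 * norm (\<Phi> ((Q ^^ m) (a N m)))"
        by (rule K)
      also have "\<dots> \<le> K2 * ((1/2) ^ m * norm (\<Phi> (a N m)))"
        using pow[of "a N m" m] Suc.IH K(2) by simp
      also have "\<dots> \<le> K2 * ((1/2) ^ m * (K1 * norm (a N m)))"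
        using K(2,3) by simp
      finally show ?thesis by (simp add: mult_ac)
    qed
    then have "(\<lambda>m. (Q ^^ m) (a N m)) \<longlonglongrightarrow> 0"
      by (intro tendsto_0_le[OF lim0, of _ 1]) (auto simp: abs_mult K less_imp_le)
    then have "(\<lambda>m. a N m - (Q ^^ m) (a N m)) \<longlonglongrightarrow> y - 0"
      using Suc.IH by (intro tendsto_diff) auto
    then show ?case
      using Suc.IH pow M(1) by (simp add: a_Suc csubspace_diff)
  qed
  then have "(\<lambda>m. y - a N m) \<longlonglongrightarrow> y - y"
    by (intro tendsto_diff tendsto_const) auto
  then show ?thesis
    by (simp add: sieve_def a_def)
qed

lemma finite_Idx:
  assumes "has_compact_resolvent T"
  shows "finite (Idx (\<lambda>j. cmod (\<zeta> j - z) \<le> r))"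
proof -
  have "Idx (\<lambda>j. cmod (\<zeta> j - z) \<le> r) \<subseteq> (SIGMA j:{j \<in> J. 0 < n j \<and> cmod (\<zeta> j - z) \<le> r}. {..<n j})"
    by (auto simp: Idx_def)
  moreover have "finite (SIGMA j:{j \<in> J. 0 < n j \<and> cmod (\<zeta> j - z) \<le> r}. {..<n j})"
    using finitely_many_near[OF assms] by (intro finite_SigmaI) auto
  ultimately show ?thesis
    by (rule finite_subset)
qed

lemma finite_Idx_eq:
  assumes "has_compact_resolvent T"
  shows "finite (Idx (\<lambda>j. \<zeta> j = l))"
  using finite_Idx[OF assms, of l 0] by (simp add: Idx_def)

text \<open>
  The projection to a root subspace is a strong limit of polynomials in the resolvent.  The finitely
  many eigenvalues near \<open>z\<close> are removed by sieves, and on the rest the resolvent is small.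
\<close>

lemma proj_in_invariant:
  assumes comp: "has_compact_resolvent T" and R: "hamiltonian_resolvent \<epsilon> z R"
    and U: "csubspace U" "closed U" "\<And>x. x \<in> U \<Longrightarrow> R x \<in> U"
    and l: "l \<in> eigenvalues T" and x: "x \<in> U"
  shows "proj (\<lambda>j. \<zeta> j = l) x \<in> U"
proof -
  \<comment> \<open>With this radius \<open>resolvent_tail_bound\<close> makes
    \<open>(l - z) R\<close> a contraction with constant \<open>1/2\<close> away from the disc, and
    \<open>l\<close> itself lies in the disc.\<close>
  define r where "r = 1 + 2 * cmod (l - z)"
  define near where "near j \<longleftrightarrow> cmod (\<zeta> j - z) \<le> r" for j
  define H where "H = {j \<in> J. 0 < n j \<and> near j}"
  \<comment> \<open>An exponent that dominates the length of every chain near \<open>z\<close>, so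
    one sieve order serves for all of them.\<close>
  define N where "N = (\<Sum>j\<in>H. n j)"
  have Rb: "bounded_clinear R" and RT: "\<And>x. x \<in> opdom T \<Longrightarrow> R (opapp T x - z *\<^sub>C x) = x"
    using R unfolding hamiltonian_resolvent_def by blast+
  have "l \<noteq> z"
  proof
    assume "l = z"
    obtain y where "y \<noteq> 0" "y \<in> opdom T" "opapp T y - l *\<^sub>C y = 0"
      using l by (auto simp: eigenvalues_def kernel_def)
    then show False
      using RT[of y] bounded_clinear_0[OF Rb] \<open>l = z\<close> by simp
  qed
  have finH: "finite H"
    using finitely_many_near[OF comp] by (simp add: H_def near_def)
  have N: "n j \<le> N" if "j \<in> H" for j
    unfolding N_def using member_le_sum[OF that, of n] finH by simp
  have near_l: "near j" if "\<zeta> j = l" for j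
    using that by (simp add: near_def r_def)
  have R_adm: "admissible U R"
    unfolding admissible_def using Rb U(3) triangular_resolvent[OF R] by blast
  \<comment> \<open>The unwanted chains near \<open>z\<close> are removed one at a time, by
    composing sieves that fix the chains of \<open>l\<close>.\<close>
  have "\<exists>Z. admissible U Z \<and> (\<forall>j\<in>J. \<zeta> j = l \<longrightarrow> (\<forall>k<n j. Z (e (j, k)) = e (j, k))) \<and>
      (\<forall>j\<in>F. \<forall>k<n j. Z (e (j, k)) = 0)" if "F \<subseteq> {j \<in> H. \<zeta> j \<noteq> l}" for F
  proof -
    have "finite F"
      using that finH finite_subset by fastforce
    then show ?thesis
      using that
    proof (induction F rule: finite_induct)
      case empty
      show ?case
        using admissible_id by (intro exI[of _ "\<lambda>x. x"]) auto
    next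
      case (insert i F)
      then have F: "F \<subseteq> {j \<in> H. \<zeta> j \<noteq> l}"
        by simp
      obtain Z where Z: "admissible U Z" "\<forall>j\<in>J. \<zeta> j = l \<longrightarrow> (\<forall>k<n j. Z (e (j, k)) = e (j, k))"
        "\<forall>j\<in>F. \<forall>k<n j. Z (e (j, k)) = 0"
        using insert.IH[OF F] by (elim exE conjE)
      have i: "i \<in> H" "i \<in> J" "0 < n i" "\<zeta> i \<noteq> l"
        using insert.prems by (auto simp: H_def)
      \<comment> \<open>\<open>a\<close> and \<open>d\<close> normalize the resolvent affinely: the
        diagonal value of \<open>Q\<close> becomes 0 on chain \<open>i\<close> and 1 on the chains
        of \<open>l\<close>.\<close>
      define d where "d = 1 / (\<zeta> i - z)"
      define a where "a = 1 / (1 / (l - z) - d)"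
      define Q where "Q x = a *\<^sub>C (R x - d *\<^sub>C x)" for x
      have S_adm: "admissible U Q"
        unfolding Q_def[abs_def] by (rule admissible_affine[OF R_adm U(1)])
      have Sb: "bounded_clinear Q"
        using S_adm by (simp add: admissible_def)
      have "\<zeta> i \<noteq> z"
        by (rule triangular_resolvent(1)[OF R i(2,3)])
      then have ne: "1 / (l - z) - d \<noteq> 0"
        using i(4) \<open>l \<noteq> z\<close> by (simp add: d_def)
      have S_i: "triangular Q i 0"
        using triangular_affine[OF triangular_resolvent(2)[OF R i(2,3)], of a d]
        by (simp add: Q_def[abs_def] d_def)
      have S_l: "triangular Q j 1" if "j \<in> J" "0 < n j" "\<zeta> j = l" for j
        using triangular_affine[OF triangular_resolvent(2)[OF R that(1,2)], of a d] that(3) ne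
        by (simp add: Q_def[abs_def] a_def)
      define Z' where "Z' x = sieve N N Q (Z x)" for x
      have "admissible U Z'"
        unfolding Z'_def[abs_def] by (rule admissible_comp[OF admissible_sieve[OF S_adm U(1)] Z(1)])
      moreover have "Z' (e (j, k)) = e (j, k)" if j: "j \<in> J" "\<zeta> j = l" "k < n j" for j k
      proof -
        have "j \<in> H"
          using j near_l by (auto simp: H_def)
        moreover have "0 < n j"
          using j by simp
        ultimately show ?thesis
          unfolding Z'_def Z(2)[rule_format, OF j]
          by (intro sieve_one[OF S_adm U(1) S_l[OF j(1) _ j(2)] e_in_chain_span[OF j(3)] N])
      qed
      moreover have "Z' (e (j, k)) = 0" if j: "j \<in> insert i F" "k < n j" for j k
      proof (cases "j = i")
        case True
        obtain c where c: "triangular Z i c"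
          using Z(1) i by (auto simp: admissible_def)
        have "bounded_clinear Z" "k < n i"
          using Z(1) j True by (simp_all add: admissible_def)
        then have "Z (e (i, k)) \<in> chain_span i (n i)"
          by (intro triangular_chain_span[OF _ c order_refl e_in_chain_span])
        then show ?thesis
          unfolding Z'_def True by (rule sieve_zero[OF Sb S_i _ N[OF i(1)]])
      next
        case False
        have "bounded_clinear (sieve N N Q)"
          using admissible_sieve[OF S_adm U(1)] by (simp add: admissible_def)
        then show ?thesis
          using False j Z(3) by (simp add: Z'_def bounded_clinear_0)
      qed
      ultimately show ?case by blast
    qed
  qed
  from this[OF order_refl] obtain Z where Z: "admissible U Z"
    "\<And>j k. j \<in> J \<Longrightarrow> \<zeta> j = l \<Longrightarrow> k < n j \<Longrightarrow> Z (e (j, k)) = e (j, k)"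
    "\<And>j k. j \<in> H \<Longrightarrow> \<zeta> j \<noteq> l \<Longrightarrow> k < n j \<Longrightarrow> Z (e (j, k)) = 0"
    by blast
  have Zb: "bounded_clinear Z"
    using Z(1) by (simp add: admissible_def)
  \<comment> \<open>Diagonal value 1 on the chains of \<open>l\<close> and small on the tail; the
    vanishing summand only matches the form of \<open>admissible_affine\<close>.\<close>
  define Q where "Q x = (l - z) *\<^sub>C (R x - 0 *\<^sub>C x)" for x
  have S_adm: "admissible U Q"
    unfolding Q_def[abs_def] by (rule admissible_affine[OF R_adm U(1)])
  have Sb: "bounded_clinear Q"
    using S_adm by (simp add: admissible_def)
  have S_l: "triangular Q j 1" if "j \<in> J" "0 < n j" "\<zeta> j = l" for j
    using triangular_affine[OF triangular_resolvent(2)[OF R that(1,2)], of "l - z" 0] that(3) \<open>l \<noteq> z\<close>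
    by (simp add: Q_def[abs_def])
  \<comment> \<open>Independently of \<open>m\<close>, \<open>D m\<close> fixes the chains of
    \<open>l\<close> and kills the other chains near \<open>z\<close>. Only its effect on the tail
    depends on \<open>m\<close>, and there it tends to 0.\<close>
  define D where "D m x = Z (sieve m N Q x)" for m x
  have D_adm: "admissible U (D m)" for m
    unfolding D_def[abs_def] by (rule admissible_comp[OF Z(1) admissible_sieve[OF S_adm U(1)]])
  have Db: "bounded_clinear (D m)" for m
    using D_adm by (simp add: admissible_def)
  have D_e: "D m (e i) = (if \<zeta> (fst i) = l then e i else 0)" if i_near: "i \<in> Idx near" for m i
  proof -
    obtain j k where i: "i = (j, k)" "j \<in> H" "j \<in> J" "k < n j" "0 < n j"
      using i_near by (fastforce simp: Idx_def H_def)
    show ?thesis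
    proof (cases "\<zeta> j = l")
      case True
      have "sieve m N Q (e (j, k)) = e (j, k)"
        by (rule sieve_one[OF S_adm U(1) S_l[OF i(3,5) True] e_in_chain_span[OF i(4)] N[OF i(2)]])
      then show ?thesis
        using True i Z(2) by (simp add: D_def)
    next
      case False
      obtain c where c: "triangular (sieve m N Q) j c"
        using admissible_sieve[OF S_adm U(1), of m N] i by (auto simp: admissible_def)
      have "bounded_clinear (sieve m N Q)"
        using admissible_sieve[OF S_adm U(1), of m N] by (simp add: admissible_def)
      then have span: "sieve m N Q (e (j, k)) \<in> chain_span j (n j)"
        by (rule triangular_chain_span[OF _ c order_refl e_in_chain_span[OF i(4)]])
      have "Z (e (j, k)) \<in> {0}" if "k < n j" for k
        using Z(3)[OF i(2) False that] by simp
      then have "Z (sieve m N Q (e (j, k))) \<in> {0}"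
        by (rule chain_span_map[OF Zb _ complex_vector.subspace_single_0 span])
      then show ?thesis
        using False i by (simp add: D_def)
    qed
  qed
  have finN: "finite (Idx near)"
    using finite_Idx[OF comp, of z r] by (simp add: near_def[abs_def])
  have D_proj: "D m (proj near x) = proj (\<lambda>j. \<zeta> j = l) x" for m
  proof -
    have "D m (proj near x) = (\<Sum>i\<in>Idx near. cinner (\<Phi> x) (\<Phi> (e i)) *\<^sub>C D m (e i))"
      by (simp add: proj_def bounded_clinear_sum[OF Db] bounded_clinear_scaleC[OF Db])
    also have "\<dots> = (\<Sum>i\<in>Idx near. if \<zeta> (fst i) = l then cinner (\<Phi> x) (\<Phi> (e i)) *\<^sub>C e i else 0)"
      by (intro sum.cong) (auto simp: D_e)
    also have "\<dots> = (\<Sum>i\<in>Idx near \<inter> {i. \<zeta> (fst i) = l}. cinner (\<Phi> x) (\<Phi> (e i)) *\<^sub>C e i)"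
      using finN by (simp add: sum.If_cases)
    also have "Idx near \<inter> {i. \<zeta> (fst i) = l} = Idx (\<lambda>j. \<zeta> j = l)"
      using near_l by (auto simp: Idx_def)
    finally show ?thesis
      by (simp add: proj_def)
  qed
  define y where "y = x - proj near x"
  let ?M = "closure (E (\<lambda>j. \<not> near j))"
  have y: "y \<in> ?M"
    unfolding y_def by (rule proj_complement[OF finN])
  have R_M: "R v \<in> ?M" if "v \<in> ?M" for v
    using that unfolding E_def
  proof (rule closure_cspan_map[OF Rb, rotated 3])
    fix v assume "v \<in> e ` Idx (\<lambda>j. \<not> near j)"
    then show "R v \<in> closure (cspan (e ` Idx (\<lambda>j. \<not> near j)))"
      using resolvent_E[OF R e_in_E[of _ "\<lambda>j. \<not> near j"]] closure_subset by (auto simp: E_def)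
  qed (simp_all add: csubspace_closure_cspan)
  have "(\<lambda>m. sieve m N Q y) \<longlonglongrightarrow> 0"
  proof (rule sieve_tail[OF Sb csubspace_closure_E _ _ y])
    fix v assume v: "v \<in> ?M"
    show "Q v \<in> ?M"
      using R_M[OF v] by (simp add: Q_def csubspace_scale[OF csubspace_closure_E])
    have "(r - 1) * norm (\<Phi> (R v)) \<le> norm (\<Phi> v)"
      using v by (intro resolvent_tail_bound[OF R]) (auto simp: near_def[abs_def] r_def)
    then show "norm (\<Phi> (Q v)) \<le> 1/2 * norm (\<Phi> v)"
      by (simp add: Q_def bounded_clinear_scaleC[OF \<Phi>_bounded] norm_scaleC r_def)
  qed
  then have "(\<lambda>m. D m y) \<longlonglongrightarrow> Z 0"
    unfolding D_def by (rule bounded_clinear_tendsto[OF Zb])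
  then have "(\<lambda>m. proj (\<lambda>j. \<zeta> j = l) x + D m y) \<longlonglongrightarrow> proj (\<lambda>j. \<zeta> j = l) x + 0"
    using bounded_clinear_0[OF Zb] by (intro tendsto_add tendsto_const) simp
  moreover have "proj (\<lambda>j. \<zeta> j = l) x + D m y = D m x" for m
    using bounded_clinear_add[OF Db, of m "proj near x" y] by (simp add: y_def D_proj)
  ultimately have "(\<lambda>m. D m x) \<longlonglongrightarrow> proj (\<lambda>j. \<zeta> j = l) x"
    by simp
  moreover have "D m x \<in> U" for m
    using D_adm x by (simp add: admissible_def)
  ultimately show ?thesis
    using closed_sequentially[OF U(2), of "\<lambda>m. D m x"] by blast
qed

text \<open>An approximant \<open>f\<close> of \<open>x\<close> in the span of all chains involves
  finitely many eigenvalues. Projecting \<open>x\<close> itself to those root subspaces is at least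
  as good in the \<open>\<Phi>\<close> norm, and by \<open>proj_in_invariant\<close> the result is a
  sum of root vectors inside \<open>U\<close>.\<close>

lemma compatible_if_compact_resolvent:
  assumes comp: "has_compact_resolvent T" and R: "hamiltonian_resolvent \<epsilon> z R"
    and U: "csubspace U" "closed U" "\<And>x. x \<in> U \<Longrightarrow> R x \<in> U"
  shows "compatible T U"
proof -
  define V where "V l = U \<inter> root_subspace T l" for l
  let ?C = "cspan (\<Union>l\<in>eigenvalues T. V l)"
  have "closure ?C \<subseteq> U"
    by (intro closure_cspan_minimal U) (auto simp: V_def)
  moreover have "U \<subseteq> closure ?C"
  proof
    fix x assume x: "x \<in> U"
    obtain K1 K2 where K: "K1 > 0" "K2 > 0" "\<And>x. norm (\<Phi> x) \<le> K1 * norm x" "\<And>x. norm x \<le> K2 * norm (\<Phi> x)"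
      by (rule \<Phi>_norms) blast
    show "x \<in> closure ?C"
      unfolding closure_approachable
    proof (intro allI impI)
      fix d :: real assume "0 < d"
      then have "0 < d / (K2 * K1)"
        using K by simp
      moreover have "x \<in> closure (E (\<lambda>_. True))"
        by (simp add: closure_E_total)
      ultimately obtain f where f: "f \<in> E (\<lambda>_. True)" "dist f x < d / (K2 * K1)"
        unfolding closure_approachable by blast
      obtain F c where F: "finite F" "F \<subseteq> {j \<in> J. True}" "f = (\<Sum>i\<in>(SIGMA j:F. {..<n j}). c i *\<^sub>C e i)"
        using E_explicit[OF f(1)] .
      \<comment> \<open>Empty chains are left out, because their \<open>\<zeta> j\<close> need not
        be an eigenvalue.\<close>
      define L where "L = \<zeta> ` {j \<in> F. 0 < n j}"
      have L: "finite L" "L \<subseteq> eigenvalues T"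
        using F \<zeta>_eigenvalue by (auto simp: L_def)
      have Idx_L: "Idx (\<lambda>j. \<zeta> j \<in> L) = (\<Union>l\<in>L. Idx (\<lambda>j. \<zeta> j = l))"
        by (auto simp: Idx_def)
      have fin: "finite (Idx (\<lambda>j. \<zeta> j \<in> L))"
        unfolding Idx_L using L(1) finite_Idx_eq[OF comp] by simp
      have fE: "f \<in> E (\<lambda>j. \<zeta> j \<in> L)"
        unfolding F(3)
      proof (intro csubspace_sum[OF csubspace_E] csubspace_scale[OF csubspace_E] e_in_E)
        fix i assume "i \<in> (SIGMA j:F. {..<n j})"
        then show "i \<in> Idx (\<lambda>j. \<zeta> j \<in> L)"
          using F(2) by (fastforce simp: Idx_def L_def)
      qed
      have "proj (\<lambda>j. \<zeta> j \<in> L) x = (\<Sum>l\<in>L. proj (\<lambda>j. \<zeta> j = l) x)"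
        unfolding proj_def Idx_L using finite_Idx_eq[OF comp] L(1)
        by (intro sum.UNION_disjoint) (auto simp: Idx_def)
      also have "\<dots> \<in> ?C"
      proof (intro csubspace_sum[OF csubspace_cspan] complex_vector.span_base)
        fix l assume l: "l \<in> L"
        have "e ` Idx (\<lambda>j. \<zeta> j = l) \<subseteq> root_subspace T l"
          using e_root by (auto simp: Idx_def)
        then have "E (\<lambda>j. \<zeta> j = l) \<subseteq> root_subspace T l"
          unfolding E_def by (intro complex_vector.span_minimal csubspace_root_subspace[OF T_linear])
        then have "proj (\<lambda>j. \<zeta> j = l) x \<in> V l"
          using proj_mem[of "\<lambda>j. \<zeta> j = l" x] proj_in_invariant[OF comp R U _ x, of l] l L(2)
          unfolding V_def by blast
        then show "proj (\<lambda>j. \<zeta> j = l) x \<in> (\<Union>l\<in>eigenvalues T. V l)"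
          using l L(2) by blast
      qed
      finally have "proj (\<lambda>j. \<zeta> j \<in> L) x \<in> ?C" .
      moreover have "dist (proj (\<lambda>j. \<zeta> j \<in> L) x) x < d"
      proof -
        have "norm (x - proj (\<lambda>j. \<zeta> j \<in> L) x) \<le> K2 * norm (\<Phi> (x - proj (\<lambda>j. \<zeta> j \<in> L) x))"
          by (rule K)
        also have "\<dots> \<le> K2 * norm (\<Phi> (x - f))"
          using proj_best[OF fin fE] K(2) by simp
        also have "\<dots> \<le> K2 * (K1 * norm (x - f))"
          using K(2,3) by simp
        also have "\<dots> < d"
          using f(2) K(1,2) by (simp add: dist_norm norm_minus_commute field_simps)
        finally show ?thesis
          by (simp add: dist_norm norm_minus_commute)
      qed
      ultimately show "\<exists>y\<in>?C. dist y x < d" by blast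
    qed
  qed
  ultimately have "U = closure ?C"
    by (rule subset_antisym[rotated])
  moreover have "csubspace (V l)" "V l \<subseteq> root_subspace T l" for l
    using complex_vector.subspace_inter[OF U(1) csubspace_root_subspace[OF T_linear]] by (auto simp: V_def)
  ultimately show ?thesis
    unfolding compatible_def by (intro exI[of _ V]) auto
qed

lemma riccati_graph_compatible:
  assumes comp: "has_compact_resolvent T"
    and f: "bounded_clinear f" "\<And>u v. cinner (f u) v = cinner u (f v)"
    and ric: "riccati_solution A B C (Operator UNIV f)"
  shows "compatible T (range (\<lambda>u. (u, f u)))"
proof -
  obtain \<epsilon> z R where R: "hamiltonian_resolvent \<epsilon> z R"
    "\<And>x. x \<in> range (\<lambda>u. (u, f u)) \<Longrightarrow> R x \<in> range (\<lambda>u. (u, f u))"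
    by (rule graph_resolvent_invariant[OF r0 f(1) ric]) blast
  note hm = hypermaximal_neutral_range[of f, OF f(2)]
  show ?thesis
    by (rule compatible_if_compact_resolvent[OF comp R(1) hypermaximal_neutral_csubspace[OF hm]
          hypermaximal_neutral_closed[OF hm] R(2)])
qed

end


section \<open>The Riccati equation\<close>

lemma le_op_UNIV: "Operator UNIV f \<le>\<^sub>o\<^sub>p Operator UNIV g \<longleftrightarrow>
    (\<forall>u. Re (cinner (f u) u) \<le> Re (cinner (g u) u))"
  by (simp add: le_op_def)

lemma uniformly_definite_graph:
  assumes \<delta>: "\<delta> > 0" and x: "\<And>x. x \<in> range (\<lambda>u. (u, f u)) \<Longrightarrow> \<delta> * (norm x)\<^sup>2 \<le> \<sigma> * hyperbolic x"
  shows "\<exists>\<delta>>0. \<forall>u. \<delta> * (norm u)\<^sup>2 \<le> \<sigma> * Re (cinner (f u) u)"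
proof (intro exI[of _ \<delta>] conjI allI \<delta>)
  fix u
  have "(norm u)\<^sup>2 \<le> (norm (u, f u))\<^sup>2"
    by (intro power_mono norm_fst_le_norm[of "(u, f u)", simplified]) simp
  then have "\<delta> * (norm u)\<^sup>2 \<le> \<delta> * (norm (u, f u))\<^sup>2"
    using \<delta> by simp
  also have "\<dots> \<le> \<sigma> * hyperbolic (u, f u)"
    by (rule x) simp
  finally show "\<delta> * (norm u)\<^sup>2 \<le> \<sigma> * Re (cinner (f u) u)"
    by (simp add: hyperbolic_def Re_cinner_commute[of u])
qed

text \<open>\<open>Xp\<close> and \<open>Xm\<close> are everywhere defined and hence fixed by their
  graphs, so one pair of witnesses serves all parts. The conjuncts on \<open>Up\<close> and
  \<open>Um\<close> record that both are themselves instances of the subspaces \<open>U\<close> in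
  part (i).\<close>

theorem theorem7p7:
  fixes A B C :: "'a::complex_hilbert operator"
    and T :: "('a \<times> 'a) operator"
    and Up Um :: "('a \<times> 'a) set"
  assumes separable: "\<exists>D :: 'a set. countable D \<and> closure D = UNIV"
    and hamiltonian: "is_hamiltonian A B C"
    and T_def: "T = hamiltonian_matrix A B C"
    and positive: "uniformly_positive_hamiltonian B C"
    and dominant: "r0_diagonally_dominant A B C"
    and basis: "has_riesz_basis_of_jordan_chains T"
    and multiplicity: "\<forall>z\<in>eigenvalues T. finite_multiplicity T z"
    and strip: "\<exists>a\<ge>0. \<forall>z\<in>eigenvalues T. \<bar>Re z\<bar> \<le> a"
    and Up_def: "Up = spectral_subspace T {z. Re z > 0}"
    and Um_def: "Um = spectral_subspace T {z. Re z < 0}"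
  shows "\<exists>Xp Xm.
    hypermaximal_neutral Up \<and> invariant_subspace T Up \<and> compatible T Up \<and>
    hypermaximal_neutral Um \<and> invariant_subspace T Um \<and> compatible T Um \<and>
    Up = graph Xp \<and> regular_riccati_solution A B C Xp \<and> uniformly_positive Xp \<and>
    Um = graph Xm \<and> regular_riccati_solution A B C Xm \<and> uniformly_negative Xm \<and>
    (\<forall>U. csubspace U \<and> hypermaximal_neutral U \<and> invariant_subspace T U \<and> compatible T U \<longrightarrow>
      (\<exists>X. U = graph X \<and> regular_riccati_solution A B C X \<and>
        Xm \<le>\<^sub>o\<^sub>p X \<and> X \<le>\<^sub>o\<^sub>p Xp \<and>
        inverse_op Xm \<le>\<^sub>o\<^sub>p inverse_op X \<and> inverse_op X \<le>\<^sub>o\<^sub>p inverse_op Xp)) \<and>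
    (\<forall>X. closed_operator X \<and> symmetric_operator X \<and>
        opdom A \<subseteq> opdom X \<and> opapp X ` opdom A \<subseteq> opdom B \<and>
        (\<forall>u\<in>opdom A. \<forall>v\<in>opdom A.
          cinner (opapp X u) (opapp A v) + cinner (opapp A u) (opapp X v)
            + cinner (opapp B (opapp X u)) (opapp X v) - cinner (opapp C u) v = 0) \<longrightarrow>
      bounded_operator X \<and> opapp X ` opdom A \<subseteq> opdom (adjoint_op A) \<and>
      riccati_solution A B C X \<and> Xm \<le>\<^sub>o\<^sub>p X \<and> X \<le>\<^sub>o\<^sub>p Xp \<and>
      (has_compact_resolvent T \<longrightarrow>
        hypermaximal_neutral (graph X) \<and> invariant_subspace T (graph X) \<and>
        compatible T (graph X) \<and> regular_riccati_solution A B C X \<and>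
        inverse_op Xm \<le>\<^sub>o\<^sub>p inverse_op X \<and> inverse_op X \<le>\<^sub>o\<^sub>p inverse_op Xp)) \<and>
    (\<forall>X. bounded_operator X \<and> invariant_subspace T (graph X) \<and> compatible T (graph X) \<longrightarrow>
      (\<exists>P. projection P \<and> (\<forall>u. opapp X u = opapp Xp (P u) + opapp Xm (u - P u))))"
proof -
  obtain \<gamma> where \<gamma>: "\<gamma> > 0" "\<forall>v\<in>opdom B. Re (cinner (opapp B v) v) \<ge> \<gamma> * (norm v)\<^sup>2"
    "\<forall>v\<in>opdom C. Re (cinner (opapp C v) v) \<ge> \<gamma> * (norm v)\<^sup>2"
    using positive by (auto simp: uniformly_positive_hamiltonian_def)
  have dd: "diagonally_dominant A B C"
    using dominant by (simp add: r0_diagonally_dominant_def)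
  then obtain a b where ab: "0 \<le> a" "0 \<le> b"
    "\<forall>u\<in>opdom A. norm (opapp C u) \<le> a * norm u + b * norm (opapp A u)"
    "\<forall>v\<in>opdom (adjoint_op A). norm (opapp B v) \<le> a * norm v + b * norm (opapp (adjoint_op A) v)"
    unfolding diagonally_dominant_def by blast
  obtain s where s: "0 \<le> s" "\<forall>z\<in>eigenvalues T. \<bar>Re z\<bar> \<le> s"
    using strip by blast
  obtain J :: "nat set" and n \<zeta> x where chains: "\<forall>j\<in>J. jordan_chain T (\<zeta> j) (n j) (x j)"
    and rb: "riesz_basis (SIGMA j:J. {..<n j}) (\<lambda>(j, k). x j k)"
    using basis unfolding has_riesz_basis_of_jordan_chains_def by (elim exE conjE)
  define e where "e = (\<lambda>(j, k). x j k)"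
  obtain \<Phi> where \<Phi>: "isomorphism \<Phi>" "orthonormal_basis (SIGMA j:J. {..<n j}) (\<Phi> \<circ> e)"
    using rb unfolding riesz_basis_def e_def by blast
  interpret riesz_hamiltonian A B C \<gamma> a b J n \<zeta> e \<Phi> s
  proof unfold_locales
    show "linear_operator A" "densely_defined A" "symmetric_operator B" "symmetric_operator C"
      using hamiltonian by (auto simp: is_hamiltonian_def)
    show "opdom A \<subseteq> opdom C" "opdom (adjoint_op A) \<subseteq> opdom B"
      using dd by (auto simp: diagonally_dominant_def)
    fix j k assume "j \<in> J" "k < n j"
    then have "x j k \<in> root_subspace T (\<zeta> j)" "opapp T (x j k) - \<zeta> j *\<^sub>C x j k = (if k = 0 then 0 else x j (k - 1))"
      using chains by (auto simp: jordan_chain_def)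
    then show "e (j, k) \<in> root_subspace (hamiltonian_matrix A B C) (\<zeta> j)"
      "opapp (hamiltonian_matrix A B C) (e (j, k)) = \<zeta> j *\<^sub>C e (j, k) + (if k = 0 then 0 else 1 *\<^sub>C e (j, k - 1))"
      by (simp_all add: e_def T_def diff_eq_eq add.commute split: if_splits)
  next
    fix i l assume "i \<in> (SIGMA j:J. {..<n j})" "l \<in> (SIGMA j:J. {..<n j})"
    then show "cinner (\<Phi> (e i)) (\<Phi> (e l)) = (if i = l then 1 else 0)"
      using \<Phi>(2) by (simp only: orthonormal_basis_def comp_apply)
  next
    show "closure (cspan ((\<Phi> \<circ> e) ` (SIGMA j:J. {..<n j}))) = UNIV"
      using \<Phi>(2) by (simp only: orthonormal_basis_def)
  qed (use \<gamma> ab s \<Phi>(1) dominant in \<open>auto simp: T_def\<close>)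
  let ?T = "hamiltonian_matrix A B C"
  have nz: "(1::real) \<noteq> 0" "(- 1::real) \<noteq> 0"
    by simp_all
  obtain \<delta> where dich: "dichotomy (W 1) (W (- 1)) \<delta>"
    by (rule W_dichotomy)
  then interpret dichotomy "W 1" "W (- 1)" \<delta> .
  obtain fp gp where fp: "bounded_clinear fp" "W 1 = range (\<lambda>u. (u, fp u))" "\<And>u v. cinner (fp u) v = cinner u (fp v)"
    and gp: "bounded_clinear gp" "\<And>u. gp (fp u) = u" "\<And>v. fp (gp v) = v"
    and rp: "regular_riccati_solution A B C (Operator UNIV fp)"
    by (rule neutral_graph[OF W_hypermaximal[OF nz(1)] W_invariant[OF nz(1)] W_compatible[OF nz(1)]]) blast
  obtain fm gm where fm: "bounded_clinear fm" "W (- 1) = range (\<lambda>u. (u, fm u))" "\<And>u v. cinner (fm u) v = cinner u (fm v)"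
    and gm: "bounded_clinear gm" "\<And>u. gm (fm u) = u" "\<And>v. fm (gm v) = v"
    and rm: "regular_riccati_solution A B C (Operator UNIV fm)"
    by (rule neutral_graph[OF W_hypermaximal[OF nz(2)] W_invariant[OF nz(2)] W_compatible[OF nz(2)]]) blast
  let ?Xp = "Operator UNIV fp" and ?Xm = "Operator UNIV fm"
  note inverse_eq = inverse_op_UNIV[OF gp(2,3)] inverse_op_UNIV[OF gm(2,3)]
  have up: "uniformly_positive ?Xp"
    using uniformly_definite_graph[OF \<delta>_pos, of fp 1] Up_positive
    unfolding fp(2) by (simp add: uniformly_positive_def)
  have um: "uniformly_negative ?Xm"
    using uniformly_definite_graph[OF \<delta>_pos, of fm "- 1"] Um_negative
    unfolding fm(2) by (simp add: uniformly_negative_def)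
  have inverse_between: "inverse_op ?Xm \<le>\<^sub>o\<^sub>p inverse_op (Operator UNIV f) \<and> inverse_op (Operator UNIV f) \<le>\<^sub>o\<^sub>p inverse_op ?Xp"
    if U: "hypermaximal_neutral U" "compatible ?T U" "U = range (\<lambda>u. (u, f u))"
      and g: "bounded_clinear g" "\<And>u. g (f u) = u" "\<And>v. f (g v) = v" for U f g
    using inverse_graph_between[OF U(1) compatible_splits[OF hypermaximal_neutral_csubspace[OF U(1)] U(2)] U(3) g
        fp(2) gp fm(2) gm]
    by (simp add: inverse_eq inverse_op_UNIV[OF g(2,3)] le_op_UNIV)
  have i: "\<exists>X. U = graph X \<and> regular_riccati_solution A B C X \<and> ?Xm \<le>\<^sub>o\<^sub>p X \<and> X \<le>\<^sub>o\<^sub>p ?Xp \<and>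
      inverse_op ?Xm \<le>\<^sub>o\<^sub>p inverse_op X \<and> inverse_op X \<le>\<^sub>o\<^sub>p inverse_op ?Xp"
    if U: "hypermaximal_neutral U" "invariant_subspace ?T U" "compatible ?T U" for U
  proof -
    obtain f g where f: "bounded_clinear f" "U = range (\<lambda>u. (u, f u))" "\<And>u v. cinner (f u) v = cinner u (f v)"
      and g: "bounded_clinear g" "\<And>u. g (f u) = u" "\<And>v. f (g v) = v"
      and r: "regular_riccati_solution A B C (Operator UNIV f)"
      by (rule neutral_graph[OF U]) blast
    have "Re (cinner (fm u) u) \<le> Re (cinner (f u) u)" "Re (cinner (f u) u) \<le> Re (cinner (fp u) u)" for u
      using graph_between[OF U(1) compatible_splits[OF hypermaximal_neutral_csubspace[OF U(1)] U(3)] f(1,2)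
          fp(1,2) fm(1,2)] .
    then show ?thesis
      using f(2) r inverse_between[OF U(1,3) f(2) g]
      by (intro exI[of _ "Operator UNIV f"]) (simp add: graph_UNIV le_op_UNIV)
  qed
  have ii: "bounded_operator X \<and> opapp X ` opdom A \<subseteq> opdom A' \<and>
      riccati_solution A B C X \<and> ?Xm \<le>\<^sub>o\<^sub>p X \<and> X \<le>\<^sub>o\<^sub>p ?Xp \<and>
      (has_compact_resolvent ?T \<longrightarrow>
        hypermaximal_neutral (graph X) \<and> invariant_subspace ?T (graph X) \<and>
        compatible ?T (graph X) \<and> regular_riccati_solution A B C X \<and>
        inverse_op ?Xm \<le>\<^sub>o\<^sub>p inverse_op X \<and> inverse_op X \<le>\<^sub>o\<^sub>p inverse_op ?Xp)"
    if X: "closed_operator X" "symmetric_operator X" "opdom A \<subseteq> opdom X" "opapp X ` opdom A \<subseteq> opdom B"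
      and weak: "\<forall>u\<in>opdom A. \<forall>v\<in>opdom A.
          cinner (opapp X u) (opapp A v) + cinner (opapp A u) (opapp X v)
            + cinner (opapp B (opapp X u)) (opapp X v) - cinner (opapp C u) v = 0" for X
  proof -
    interpret weak_riccati A B C \<gamma> a b J n \<zeta> e \<Phi> s X
      using X weak by unfold_locales auto
    have ric: "riccati_solution A B C ?Xp" "riccati_solution A B C ?Xm"
      using rp rm by (auto simp: regular_riccati_solution_def)
    note bounded = weak_riccati_bounded[OF X(1) fp(2,1,3) ric(1) fm(2,1,3) ric(2)]
    define f where "f = opapp X"
    have X_eq: "X = Operator UNIV f"
      using bounded(1) by (cases X) (simp add: bounded_operator_def f_def)
    have f: "bounded_clinear f" "cinner (f u) v = cinner u (f v)" for u v
      using bounded(1) X_sym[of u v] by (simp_all add: bounded_operator_def f_def)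
    note strong = weak_riccati_strong[OF bounded(1)]
    have ric_f: "riccati_solution A B C (Operator UNIV f)"
      using strong(2) X_eq by simp
    let ?U = "range (\<lambda>u. (u, f u))"
    have "hypermaximal_neutral ?U" "invariant_subspace ?T ?U" "compatible ?T ?U"
      "regular_riccati_solution A B C X" "inverse_op ?Xm \<le>\<^sub>o\<^sub>p inverse_op X \<and> inverse_op X \<le>\<^sub>o\<^sub>p inverse_op ?Xp"
      if comp: "has_compact_resolvent ?T"
    proof -
      \<comment> \<open>Symmetry gives neutrality, the Riccati equation invariance, and the compact
        resolvent compatibility; from here the graph is treated as any \<open>U\<close> of part
        (i).\<close>
      show U: "hypermaximal_neutral ?U" "invariant_subspace ?T ?U" "compatible ?T ?U"
        by (rule hypermaximal_neutral_range[of f, OF f(2)] graph_invariant[OF f(1) ric_f]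
            riccati_graph_compatible[OF comp f ric_f])+
      obtain g where g: "bounded_clinear g" "\<And>u. g (f u) = u" "\<And>v. f (g v) = v"
        by (rule inverse_graph_exists[OF U(1) compatible_splits[OF hypermaximal_neutral_csubspace[OF U(1)] U(3)] refl])
          blast
      show "regular_riccati_solution A B C X"
        unfolding X_eq by (rule regular_riccati_solution_graph[OF r0 U(3,2) f(1) refl f(2) g])
      show "inverse_op ?Xm \<le>\<^sub>o\<^sub>p inverse_op X \<and> inverse_op X \<le>\<^sub>o\<^sub>p inverse_op ?Xp"
        unfolding X_eq by (rule inverse_between[OF U(1,3) refl g])
    qed
    moreover have "?Xm \<le>\<^sub>o\<^sub>p X" "X \<le>\<^sub>o\<^sub>p ?Xp"
      using bounded(2,3) by (simp_all add: X_eq le_op_UNIV)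
    moreover have "graph X = ?U"
      by (simp add: X_eq graph_UNIV)
    ultimately show ?thesis
      using bounded(1) strong by (simp add: image_subset_iff)
  qed
  have iii: "\<exists>P. projection P \<and> (\<forall>u. opapp X u = fp (P u) + fm (u - P u))"
    if X: "bounded_operator X" "compatible ?T (graph X)" for X
  proof (rule graph_projection[OF _ _ fp(2) fm(2)])
    show "bounded_clinear (opapp X)"
      using X(1) by (simp add: bounded_operator_def)
    have "graph X = range (\<lambda>u. (u, opapp X u))"
      using X(1) by (auto simp: graph_def bounded_operator_def)
    then show "compatible ?T (range (\<lambda>u. (u, opapp X u)))"
      using X(2) by simp
  qed
  have "Up = W 1" "Um = W (- 1)"
    using W_spectral[of 1] W_spectral[of "- 1"] by (simp_all add: Up_def Um_def T_def)
  then show ?thesis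
    using W_hypermaximal[of 1] W_hypermaximal[of "- 1"] W_invariant[of 1] W_invariant[of "- 1"]
      W_compatible[of 1] W_compatible[of "- 1"] fp(2) fm(2) rp rm up um i ii iii
    unfolding T_def by (intro exI[of _ ?Xp] exI[of _ ?Xm]) (simp add: graph_UNIV)
qed

end
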